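(* Let $n_1,\dots,n_d \geq 1$ be positive integers such that $n_i/n_j$ is not an integral power of $p$ for each $i \neq j$. For each $i$ take polynomials $u_{i1},\dots,u_{ir_i} \in \overline{K}[t]$ with $\|u_{ij}\|_\infty < |\theta|_\infty^{n_i q/(q-1)}$ for $j=1,\dots,r_i$. If for each $i$ the elements $\tilde{\pi}^{n_i}, L_{u_{i1},n_i}(\theta),\dots,L_{u_{ir_i},n_i}(\theta)$ are linearly independent over $K$, then the $1+\sum_{i=1}^d r_i$ elements $\tilde{\pi}$, $L_{u_{ij},n_i}(\theta)$ ($1 \leq i \leq d$, $1 \leq j \leq r_i$) are algebraically independent over $\overline{K}$.
   Context: Let $\mathbb{F}_q$ be the finite field with $q$ elements, $p$ its characteristic, $K = \mathbb{F}_q(\theta)$, $K_\infty = \mathbb{F}_q((\theta^{-1}))$ with absolute value $|\cdot|_\infty$ ($|\theta|_\infty>1$), $\mathbb{C}_\infty$ the completion of an algebraic closure of $K_\infty$, $\overline{K}$ the algebraic closure of $K$ in $\mathbb{C}_\infty$, and $t$ a variable independent of $\theta$. Fixing a $(q-1)$-st root of $-\theta$, $\tilde{\pi} = (-\theta)^{q/(q-1)} \prod_{i=1}^\infty (1-\theta^{1-q^i})^{-1}$. For $u = \sum_j \alpha_j t^j \in \overline{K}[t]$ put $\|u\|_\infty = \max_j |\alpha_j|_\infty$ and, for $i \geq 0$, $u^{(i)} = \sum_j \alpha_j^{q^i} t^j$. For a positive integer $n$ and $u \in \overline{K}[t]$ with $\|u\|_\infty < |\theta|_\infty^{nq/(q-1)}$,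 set $$L_{u,n}(t) = \sum_{i \geq 0} \frac{u^{(i)}}{\big((t-\theta^q)(t-\theta^{q^2})\cdots(t-\theta^{q^i})\big)^n}$$ (empty product $=1$ for $i=0$), a power series in $t$ converging on $|t|_\infty < |\theta|_\infty^q$; $L_{u,n}(\theta)$ denotes its value at $t=\theta$. *)

theory Defs
  imports "HOL-Analysis.Analysis" "HOL-Computational_Algebra.Polynomial"
begin

definition nonarch_abs :: "('c::field \<Rightarrow> real) \<Rightarrow> bool" where
  "nonarch_abs av \<longleftrightarrow> av 0 = 0 \<and> (\<forall>x. x \<noteq> 0 \<longrightarrow> av x > 0)
     \<and> (\<forall>x y. av (x * y) = av x * av y) \<and> (\<forall>x y. av (x + y) \<le> max (av x) (av y))"

definition av_complete :: "('c::field \<Rightarrow> real) \<Rightarrow> bool" where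
  "av_complete av \<longleftrightarrow> (\<forall>X::nat \<Rightarrow> 'c.
     (\<forall>e>0. \<exists>N. \<forall>m\<ge>N. \<forall>k\<ge>N. av (X m - X k) < e) \<longrightarrow> (\<exists>L. (\<lambda>k. av (X k - L)) \<longlonglongrightarrow> 0))"

definition alg_closed :: "'c::field itself \<Rightarrow> bool" where
  "alg_closed _ \<longleftrightarrow> (\<forall>P::'c poly. degree P > 0 \<longrightarrow> (\<exists>x. poly P x = 0))"

text \<open>The finite field with q elements inside C (q a power of the characteristic).\<close>
definition Fq :: "nat \<Rightarrow> 'c::field set" where
  "Fq q = {x. x ^ q = x}"

definition algebraic_over :: "'c::field set \<Rightarrow> 'c \<Rightarrow> bool" where
  "algebraic_over S x \<longleftrightarrow> (\<exists>P. P \<noteq> 0 \<and> (\<forall>i. coeff P i \<in> S) \<and> poly P x = 0)"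

definition Kfield :: "nat \<Rightarrow> 'c::field \<Rightarrow> 'c set" where
  "Kfield q \<theta> = {poly f \<theta> / poly g \<theta> | f g. (\<forall>i. coeff f i \<in> Fq q) \<and> (\<forall>i. coeff g i \<in> Fq q) \<and> g \<noteq> 0}"

definition Kbar :: "nat \<Rightarrow> 'c::field \<Rightarrow> 'c set" where
  "Kbar q \<theta> = {x. algebraic_over (Kfield q \<theta>) x}"

definition av_sums :: "('c::field \<Rightarrow> real) \<Rightarrow> (nat \<Rightarrow> 'c) \<Rightarrow> 'c \<Rightarrow> bool" where
  "av_sums av f s \<longleftrightarrow> (\<lambda>N. av ((\<Sum>i<N. f i) - s)) \<longlonglongrightarrow> 0"

definition av_suminf :: "('c::field \<Rightarrow> real) \<Rightarrow> (nat \<Rightarrow> 'c) \<Rightarrow> 'c" where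
  "av_suminf av f = (THE s. av_sums av f s)"

definition av_prodinf :: "('c::field \<Rightarrow> real) \<Rightarrow> (nat \<Rightarrow> 'c) \<Rightarrow> 'c" where
  "av_prodinf av f = (THE P. (\<lambda>N. av ((\<Prod>i\<in>{1..N}. f i) - P)) \<longlonglongrightarrow> 0)"

text \<open>pi-tilde = (-theta) * zeta * prod_{i>=1} (1 - theta^(1-q^i))^(-1), where zeta^(q-1) = -theta,
  so that (-theta)*zeta is the chosen value of (-theta)^(q/(q-1)).\<close>
definition pi_tilde :: "('c::field \<Rightarrow> real) \<Rightarrow> nat \<Rightarrow> 'c \<Rightarrow> 'c \<Rightarrow> 'c" where
  "pi_tilde av q \<theta> \<zeta> = (- \<theta>) * \<zeta> * av_prodinf av (\<lambda>i. inverse (1 - inverse (\<theta> ^ (q ^ i - 1))))"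

definition poly_norm :: "('c::field \<Rightarrow> real) \<Rightarrow> 'c poly \<Rightarrow> real" where
  "poly_norm av u = Max {av (coeff u j) | j. j \<le> degree u}"

definition frob_eval :: "nat \<Rightarrow> nat \<Rightarrow> 'c::field poly \<Rightarrow> 'c \<Rightarrow> 'c" where
  "frob_eval q i u x = (\<Sum>j\<le>degree u. (coeff u j) ^ (q ^ i) * x ^ j)"

definition Lval :: "('c::field \<Rightarrow> real) \<Rightarrow> nat \<Rightarrow> 'c \<Rightarrow> 'c poly \<Rightarrow> nat \<Rightarrow> 'c" where
  "Lval av q \<theta> u n = av_suminf av
     (\<lambda>i. frob_eval q i u \<theta> / ((\<Prod>k\<in>{1..i}. \<theta> - \<theta> ^ (q ^ k)) ^ n))"

definition lin_indep_over :: "'c::field set \<Rightarrow> ('i \<Rightarrow> 'c) \<Rightarrow> 'i set \<Rightarrow> bool" where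
  "lin_indep_over S x I \<longleftrightarrow> (\<forall>c. (\<forall>i\<in>I. c i \<in> S) \<and> (\<Sum>i\<in>I. c i * x i) = 0 \<longrightarrow> (\<forall>i\<in>I. c i = 0))"

definition alg_indep_over :: "'c::field set \<Rightarrow> ('i \<Rightarrow> 'c) \<Rightarrow> 'i set \<Rightarrow> bool" where
  "alg_indep_over S x I \<longleftrightarrow> (\<forall>M c. finite M \<and> (\<forall>m\<in>M. \<forall>i. i \<notin> I \<longrightarrow> m i = 0)
      \<and> (\<forall>m\<in>M. c m \<in> S) \<and> (\<Sum>m\<in>M. c m * (\<Prod>i\<in>I. x i ^ m i)) = 0
      \<longrightarrow> (\<forall>m\<in>M. c m = 0))"

end

theory Submission
  imports Defs "HOL-Computational_Algebra.Computational_Algebra"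
begin

unbundle no vec_syntax
unbundle fps_syntax

text \<open>
  Write \<open>\<tau> = t - \<theta>^q\<close> and let the Frobenius act on the coefficients of power series in \<open>t\<close>. The series
  \<open>L\<close> of \<open>u\<close> and \<open>n\<close> satisfies \<open>L^(1) = \<tau>^n (L - u)\<close>, and \<open>\<Pi> = \<zeta>^q \<Prod> (1 - t / \<theta>^(q^i))^(-1)\<close>, whose value at
  \<open>\<theta>\<close> is the period, satisfies \<open>\<Pi>^(1) = \<tau> \<Pi>\<close>. Hence the monomials in these series solve a linear
  Frobenius difference system.

  A linear relation \<open>\<rho>\<close> between the values at \<open>\<theta>\<close> of such monomials lifts to the functions, by the argument
  of Anderson, Brownawell and Papanikolas: a pigeonhole argument gives a combination \<open>E\<close> of the functions,
  with small polynomial coefficients, all of whose values at \<open>\<theta>^(1/q^i)\<close>, \<open>i < N\<close>, are multiples of the given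
  relation and therefore vanish. By the Schwarz lemma \<open>E\<close> is tiny. A second pigeonhole argument gives a
  Frobenius difference equation for \<open>E\<close>, so its leading coefficient is a root of an additive
  polynomial of controlled size and cannot be tiny. So \<open>E = 0\<close>.

  If the functions are algebraically dependent, then the quotients \<open>g = L / \<Pi>^n\<close>, on which the Frobenius acts
  by \<open>g \<mapsto> g - u \<Pi>^(-n)\<close>, satisfy an invariant polynomial relation, and an invariant of minimal
  degree is additive. Comparing powers of \<open>\<Pi>\<close> isolates one value of \<open>n\<close> and one power of \<open>p\<close>, because the \<open>n\<close>
  do not differ by powers of \<open>p\<close>. Extracting \<open>p\<close>-power roots leaves a linear relation over \<open>F_q[t]\<close>
  between the \<open>L\<close>, a polynomial \<open>h\<close> and \<open>\<Pi>^n\<close>, where \<open>h\<close> vanishes at \<open>\<theta>\<close>.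
\<close>

section \<open>Nonarchimedean power series\<close>

text \<open>Zeros at roots of \<theta> would bring in inseparable extensions. Twisting all functions
  by \<open>q ^ N\<close> moves them to \<open>\<theta> ^ (q ^ j)\<close>, \<open>j < N\<close>, and
  keeps the coefficients in one finite extension of \<open>K\<close>, where elements of bounded size
  form finite sets of known cardinality: this is what pigeonhole needs. All sizes grow like a
  constant times \<open>q ^ N\<close>, because the sum of the \<open>q ^ j\<close> with
  \<open>j < N\<close> is at most \<open>q ^ N\<close>. So the competing bounds are
  \<open>q ^ N\<close>-th powers up to constants, and only the Schwarz factor contains a free
  parameter, the excess \<nu> of zeros over the degree, which is chosen last.

  On the algebraic side the obstacle is the characteristic. Additive polynomials include
  \<open>Y ^ (p ^ i)\<close>, so an invariant only yields a relation between \<open>p ^ i\<close>-th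
  powers of the series, of weight \<open>n * p ^ i\<close>. The hypothesis on quotients says that
  such weights never agree for different indices. The coefficients of that relation are in general
  not \<open>p ^ i\<close>-th powers, so roots are taken in each residue class of exponents modulo
  \<open>p ^ i\<close>.\<close>

locale na_field =
  fixes av :: "'c::field \<Rightarrow> real"
  assumes na: "nonarch_abs av"
begin

lemma av_0 [simp]: "av 0 = 0"
  and av_pos: "x \<noteq> 0 \<Longrightarrow> av x > 0"
  and av_mult: "av (x * y) = av x * av y"
  and av_add: "av (x + y) \<le> max (av x) (av y)"
  using na unfolding nonarch_abs_def by auto

lemma av_nonneg [simp]: "0 \<le> av x"
  by (cases "x = 0") (auto simp: av_pos less_imp_le)

lemma av_eq_0 [simp]: "av x = 0 \<longleftrightarrow> x = 0"
  using av_pos[of x] by fastforce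

lemma av_1 [simp]: "av 1 = 1"
  using av_mult[of 1 1] av_pos[of 1] by simp

lemma av_power: "av (x ^ n) = av x ^ n"
  by (induction n) (auto simp: av_mult)

lemma av_minus [simp]: "av (- x) = av x"
proof -
  have "av (-1) * av (-1) = 1"
    using av_mult[of "-1" "-1"] by simp
  hence "av (-1) = 1"
    using power2_eq_1_iff[of "av (-1)"] av_nonneg[of "-1"] by (simp add: power2_eq_square del: av_nonneg)
  thus ?thesis using av_mult[of "-1" x] by simp
qed

lemma av_inverse: "av (inverse x) = inverse (av x)"
proof (cases "x = 0")
  case False
  hence "av x * av (inverse x) = 1" using av_mult[of x "inverse x"] by simp
  thus ?thesis by (simp add: inverse_unique)
qed auto

lemma av_divide: "av (x / y) = av x / av y"
  by (simp add: divide_inverse av_mult av_inverse)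

lemma av_add_le: "av x \<le> B \<Longrightarrow> av y \<le> B \<Longrightarrow> av (x + y) \<le> B"
  using av_add[of x y] by linarith

lemma av_diff_le: "av x \<le> B \<Longrightarrow> av y \<le> B \<Longrightarrow> av (x - y) \<le> B"
  using av_add_le[of x B "-y"] by simp

lemma av_diff_commute: "av (x - y) = av (y - x)"
  using av_minus[of "x - y"] by simp

lemma av_sum_le: "0 \<le> B \<Longrightarrow> (\<And>i. i \<in> A \<Longrightarrow> av (f i) \<le> B) \<Longrightarrow> av (sum f A) \<le> B"
  by (induction A rule: infinite_finite_induct) (auto intro: av_add_le)

lemma av_add_eq:
  assumes "av x < av y" shows "av (x + y) = av y"
proof (rule antisym)
  show "av (x + y) \<le> av y" using av_add[of x y] assms by linarith
  show "av y \<le> av (x + y)"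
    using av_add[of "x + y" "-x"] assms by simp
qed

section \<open>Convergence for the absolute value\<close>

definition av_lim :: "(nat \<Rightarrow> 'c) \<Rightarrow> 'c \<Rightarrow> bool" where
  "av_lim X L \<longleftrightarrow> (\<lambda>k. av (X k - L)) \<longlonglongrightarrow> 0"

lemma av_lim_iff: "av_lim X L \<longleftrightarrow> (\<forall>e>0. \<exists>N. \<forall>k\<ge>N. av (X k - L) < e)"
  unfolding av_lim_def LIMSEQ_def dist_real_def by simp

lemma av_lim_unique:
  assumes "av_lim X L" "av_lim X M" shows "L = M"
proof (rule ccontr)
  assume "L \<noteq> M"
  hence e: "av (L - M) > 0" by (simp add: av_pos)
  obtain N1 where N1: "\<And>k. k \<ge> N1 \<Longrightarrow> av (X k - L) < av (L - M)"
    using assms(1) e unfolding av_lim_iff by blast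
  obtain N2 where N2: "\<And>k. k \<ge> N2 \<Longrightarrow> av (X k - M) < av (L - M)"
    using assms(2) e unfolding av_lim_iff by blast
  let ?k = "max N1 N2"
  have "av ((X ?k - M) - (X ?k - L)) \<le> max (av (X ?k - M)) (av (X ?k - L))"
    using av_add[of "X ?k - M" "-(X ?k - L)"] av_minus[of "X ?k - L"] by simp
  thus False using N1[of ?k] N2[of ?k] by simp
qed

lemma av_lim_add: "av_lim X L \<Longrightarrow> av_lim Y M \<Longrightarrow> av_lim (\<lambda>k. X k + Y k) (L + M)"
proof -
  assume a: "av_lim X L" "av_lim Y M"
  have "(\<lambda>k. max (av (X k - L)) (av (Y k - M))) \<longlonglongrightarrow> max 0 0"
    using a unfolding av_lim_def by (intro tendsto_max)
  hence m: "(\<lambda>k. max (av (X k - L)) (av (Y k - M))) \<longlonglongrightarrow> 0" by simp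
  show ?thesis unfolding av_lim_def
  proof (rule tendsto_sandwich[OF _ _ tendsto_const m])
    show "\<forall>\<^sub>F n in sequentially. av (X n + Y n - (L + M)) \<le> max (av (X n - L)) (av (Y n - M))"
      using av_add[of "X n - L" "Y n - M" for n] by (intro always_eventually allI) (simp add: algebra_simps)
  qed auto
qed

lemma av_lim_cmult: "av_lim X L \<Longrightarrow> av_lim (\<lambda>k. c * X k) (c * L)"
proof -
  assume a: "av_lim X L"
  have "(\<lambda>k. av c * av (X k - L)) \<longlonglongrightarrow> av c * 0"
    using a unfolding av_lim_def by (intro tendsto_mult) auto
  thus ?thesis unfolding av_lim_def by (simp add: av_mult[symmetric] right_diff_distrib)
qed

lemma av_lim_const [simp]: "av_lim (\<lambda>k. c) c"
  by (simp add: av_lim_def)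

lemma av_lim_sum: "(\<And>i. i \<in> A \<Longrightarrow> av_lim (\<lambda>k. X k i) (L i)) \<Longrightarrow> av_lim (\<lambda>k. \<Sum>i\<in>A. X k i) (\<Sum>i\<in>A. L i)"
  by (induction A rule: infinite_finite_induct) (auto intro: av_lim_add)

lemma av_lim_Suc: "av_lim X L \<Longrightarrow> av_lim (\<lambda>k. X (Suc k)) L"
  unfolding av_lim_def by (rule LIMSEQ_Suc)

lemma av_lim_bound:
  assumes "av_lim X L" "\<And>k. k \<ge> N \<Longrightarrow> av (X k) \<le> B"
  shows "av L \<le> B"
proof (rule ccontr)
  assume "\<not> av L \<le> B"
  hence "av L > 0" using assms(2)[of N] av_nonneg[of "X N"] by linarith
  then obtain M where M: "\<And>k. k \<ge> M \<Longrightarrow> av (X k - L) < av L"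
    using assms(1) unfolding av_lim_iff by blast
  let ?k = "max N M"
  have "av L \<le> max (av (X ?k)) (av (-(X ?k - L)))" using av_add[of "X ?k" "-(X ?k - L)"] by simp
  hence "av L \<le> av (X ?k)" using M[of ?k] by (auto simp: av_diff_commute)
  thus False using assms(2)[of ?k] \<open>\<not> av L \<le> B\<close> by simp
qed

text \<open>An additive power turns \<open>X k ^ m - L ^ m\<close> into
  \<open>(X k - L) ^ m\<close>; this carries the Frobenius through limits.\<close>

lemma av_lim_frob:
  assumes "av_lim X L" "m > 0" "\<And>x y::'c. (x - y) ^ m = x ^ m - y ^ (m::nat)"
  shows "av_lim (\<lambda>k. X k ^ m) (L ^ m)"
proof -
  have "(\<lambda>k. av (X k - L) ^ m) \<longlonglongrightarrow> 0 ^ m"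
    using assms(1) unfolding av_lim_def by (intro tendsto_power)
  moreover have "av (X k - L) ^ m = av (X k ^ m - L ^ m)" for k
    using assms(3)[of "X k" L] av_power[of "X k - L" m] by simp
  ultimately show ?thesis unfolding av_lim_def using assms(2) by (simp add: power_0_left)
qed

section \<open>Gauss norm bounds on a disc\<close>

definition bdd :: "'c fps \<Rightarrow> real \<Rightarrow> real \<Rightarrow> bool" where
  "bdd f \<rho> B \<longleftrightarrow> (\<forall>k. av (f $ k) * \<rho> ^ k \<le> B)"

lemma bddD: "bdd f \<rho> B \<Longrightarrow> \<rho> > 0 \<Longrightarrow> av (f $ k) \<le> B / \<rho> ^ k"
  by (simp add: bdd_def field_simps)

lemma bdd_nonneg: "bdd f \<rho> B \<Longrightarrow> \<rho> > 0 \<Longrightarrow> B \<ge> 0"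
  using bddD[of f \<rho> B 0] av_nonneg[of "f $ 0"] by (simp del: av_nonneg)

lemma bdd_mono: "bdd f \<rho> B \<Longrightarrow> B \<le> C \<Longrightarrow> bdd f \<rho> C"
  unfolding bdd_def using order_trans by blast

lemma bdd_add: "bdd f \<rho> B \<Longrightarrow> bdd g \<rho> B \<Longrightarrow> \<rho> > 0 \<Longrightarrow> bdd (f + g) \<rho> B"
  using av_add_le unfolding bdd_def by (simp add: pos_le_divide_eq[symmetric])

lemma bdd_minus: "bdd f \<rho> B \<Longrightarrow> bdd (- f) \<rho> B"
  unfolding bdd_def by simp

lemma bdd_0: "B \<ge> 0 \<Longrightarrow> bdd 0 \<rho> B"
  by (simp add: bdd_def)

lemma bdd_sum: "B \<ge> 0 \<Longrightarrow> \<rho> > 0 \<Longrightarrow> (\<And>i. i \<in> A \<Longrightarrow> bdd (f i) \<rho> B) \<Longrightarrow> bdd (sum f A) \<rho> B"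
  by (induction A rule: infinite_finite_induct) (auto intro: bdd_add bdd_0)

lemma bdd_mult:
  assumes f: "bdd f \<rho> B" and g: "bdd g \<rho> C" and \<rho>: "\<rho> > 0"
  shows "bdd (f * g) \<rho> (B * C)"
  unfolding bdd_def
proof
  fix k
  have B: "B \<ge> 0" and C: "C \<ge> 0" using bdd_nonneg assms by auto
  have "av ((f * g) $ k) \<le> B * C / \<rho> ^ k"
    unfolding fps_mult_nth
  proof (rule av_sum_le)
    fix i assume i: "i \<in> {0..k}"
    have "av (f $ i) * av (g $ (k - i)) \<le> (B / \<rho> ^ i) * (C / \<rho> ^ (k - i))"
      using bddD[OF f \<rho>] bddD[OF g \<rho>] B C \<rho> by (intro mult_mono) auto
    also have "\<dots> = B * C / (\<rho> ^ i * \<rho> ^ (k - i))" by simp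
    also have "\<rho> ^ i * \<rho> ^ (k - i) = \<rho> ^ k" using i by (simp add: power_add[symmetric])
    finally show "av (f $ i * g $ (k - i)) \<le> B * C / \<rho> ^ k" by (simp add: av_mult)
  qed (use B C \<rho> in auto)
  thus "av ((f * g) $ k) * \<rho> ^ k \<le> B * C" using \<rho> by (simp add: field_simps)
qed

lemma bdd_const: "bdd (fps_const c) \<rho> (av c)"
  unfolding bdd_def by (auto simp: fps_const_def)

lemma bdd_1: "bdd 1 \<rho> 1"
  using bdd_const[of 1] by simp

lemma bdd_power: "bdd f \<rho> B \<Longrightarrow> \<rho> > 0 \<Longrightarrow> bdd (f ^ n) \<rho> (B ^ n)"
  by (induction n) (auto intro: bdd_mult bdd_1)

lemma bdd_prod: "\<rho> > 0 \<Longrightarrow> (\<And>i. i \<in> A \<Longrightarrow> bdd (f i) \<rho> (B i)) \<Longrightarrow> bdd (prod f A) \<rho> (prod B A)"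
  by (induction A rule: infinite_finite_induct) (auto intro: bdd_mult bdd_1)

lemma bdd_poly:
  assumes "\<rho> \<ge> 1" "\<And>k. av (coeff P k) \<le> B" "degree P \<le> n" "B \<ge> 0"
  shows "bdd (fps_of_poly P) \<rho> (B * \<rho> ^ n)"
  unfolding bdd_def
proof
  fix k
  show "av (fps_of_poly P $ k) * \<rho> ^ k \<le> B * \<rho> ^ n"
  proof (cases "k \<le> n")
    case True
    thus ?thesis using assms by (auto intro!: mult_mono power_increasing)
  next
    case False
    hence "coeff P k = 0" using assms(3) by (intro coeff_eq_0) simp
    thus ?thesis using assms by simp
  qed
qed

definition fbd :: "real \<Rightarrow> 'c fps \<Rightarrow> bool" where
  "fbd \<rho> f \<longleftrightarrow> (\<exists>B. bdd f \<rho> B)"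

lemma fbd_add: "fbd \<rho> f \<Longrightarrow> fbd \<rho> g \<Longrightarrow> \<rho> > 0 \<Longrightarrow> fbd \<rho> (f + g)"
  unfolding fbd_def by (meson bdd_add bdd_mono max.cobounded1 max.cobounded2)

lemma fbd_minus: "fbd \<rho> f \<Longrightarrow> fbd \<rho> (- f)"
  unfolding fbd_def by (meson bdd_minus)

lemma fbd_diff: "fbd \<rho> f \<Longrightarrow> fbd \<rho> g \<Longrightarrow> \<rho> > 0 \<Longrightarrow> fbd \<rho> (f - g)"
  using fbd_add[of \<rho> f "-g"] fbd_minus by simp

lemma fbd_mult: "fbd \<rho> f \<Longrightarrow> fbd \<rho> g \<Longrightarrow> \<rho> > 0 \<Longrightarrow> fbd \<rho> (f * g)"
  unfolding fbd_def by (meson bdd_mult)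

lemma fbd_const [simp]: "fbd \<rho> (fps_const c)"
  unfolding fbd_def by (meson bdd_const)

lemma fbd_0 [simp]: "fbd \<rho> 0" and fbd_1 [simp]: "fbd \<rho> 1"
  using fbd_const[of \<rho> 0] fbd_const[of \<rho> 1] by simp_all

lemma fbd_X [simp]: "fbd \<rho> fps_X"
  unfolding fbd_def bdd_def by (rule exI[of _ "\<bar>\<rho>\<bar>"]) (auto simp: fps_X_nth)

lemma fbd_power: "fbd \<rho> f \<Longrightarrow> \<rho> > 0 \<Longrightarrow> fbd \<rho> (f ^ n)"
  by (induction n) (auto intro: fbd_mult)

lemma fbd_prod: "\<rho> > 0 \<Longrightarrow> (\<And>i. i \<in> A \<Longrightarrow> fbd \<rho> (f i)) \<Longrightarrow> fbd \<rho> (prod f A)"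
  by (induction A rule: infinite_finite_induct) (auto intro: fbd_mult)

lemma fbd_sum: "\<rho> > 0 \<Longrightarrow> (\<And>i. i \<in> A \<Longrightarrow> fbd \<rho> (f i)) \<Longrightarrow> fbd \<rho> (sum f A)"
  by (induction A rule: infinite_finite_induct) (auto intro: fbd_add)

lemma fbd_poly: "\<rho> > 0 \<Longrightarrow> fbd \<rho> (fps_of_poly P)"
  by (induction P) (auto simp: fps_of_poly_pCons intro!: fbd_add fbd_mult)

text \<open>The value of a series is characterised by divisibility of \<open>f - v\<close> by \<open>t - z\<close> with a quotient
  bounded on the disc of radius \<open>\<rho>\<close>; compatibility with products is then plain algebra.\<close>
definition has_val :: "real \<Rightarrow> 'c fps \<Rightarrow> 'c \<Rightarrow> 'c \<Rightarrow> bool" where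
  "has_val \<rho> f z v \<longleftrightarrow> (\<exists>G. fbd \<rho> G \<and> f = fps_const v + (fps_X - fps_const z) * G)"

lemma has_val_const: "has_val \<rho> (fps_const c) z c"
  unfolding has_val_def by (rule exI[of _ 0]) simp

lemma has_val_1: "has_val \<rho> 1 z 1"
  using has_val_const[of \<rho> 1] by simp

lemma has_val_0: "has_val \<rho> 0 z 0"
  using has_val_const[of \<rho> 0] by simp

lemma has_val_X: "has_val \<rho> fps_X z z"
  unfolding has_val_def by (rule exI[of _ 1]) simp

lemma has_val_add:
  assumes "has_val \<rho> f z v" "has_val \<rho> g z w" "\<rho> > 0"
  shows "has_val \<rho> (f + g) z (v + w)"
proof -
  obtain F G where "fbd \<rho> F" "f = fps_const v + (fps_X - fps_const z) * F"
    "fbd \<rho> G" "g = fps_const w + (fps_X - fps_const z) * G"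
    using assms unfolding has_val_def by blast
  thus ?thesis unfolding has_val_def using assms(3)
    by (intro exI[of _ "F + G"]) (simp add: fbd_add distrib_left flip: fps_const_add)
qed

lemma has_val_fbd: "has_val \<rho> f z v \<Longrightarrow> \<rho> > 0 \<Longrightarrow> fbd \<rho> f"
  unfolding has_val_def by (auto intro!: fbd_add fbd_mult fbd_diff)

lemma has_val_mult:
  assumes "has_val \<rho> f z v" "has_val \<rho> g z w" "\<rho> > 0"
  shows "has_val \<rho> (f * g) z (v * w)"
proof -
  obtain F G where FG: "fbd \<rho> F" "f = fps_const v + (fps_X - fps_const z) * F"
    "fbd \<rho> G" "g = fps_const w + (fps_X - fps_const z) * G"
    using assms unfolding has_val_def by blast
  have "f * g = fps_const (v * w) + (fps_X - fps_const z) * (F * g + fps_const v * G)"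
    unfolding FG(2,4) fps_const_mult[symmetric] by (simp only: algebra_simps)
  moreover have "fbd \<rho> (F * g + fps_const v * G)"
    using FG(1,3) assms has_val_fbd by (intro fbd_add fbd_mult) auto
  ultimately show ?thesis unfolding has_val_def by blast
qed

lemma has_val_minus: "has_val \<rho> f z v \<Longrightarrow> \<rho> > 0 \<Longrightarrow> has_val \<rho> (- f) z (- v)"
  using has_val_mult[OF has_val_const[of \<rho> "-1"], of f z v] by (simp flip: fps_const_neg)

lemma has_val_diff: "has_val \<rho> f z v \<Longrightarrow> has_val \<rho> g z w \<Longrightarrow> \<rho> > 0 \<Longrightarrow> has_val \<rho> (f - g) z (v - w)"
  using has_val_add[OF _ has_val_minus, of \<rho> f z v g w] by simp

lemma has_val_power: "has_val \<rho> f z v \<Longrightarrow> \<rho> > 0 \<Longrightarrow> has_val \<rho> (f ^ n) z (v ^ n)"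
  by (induction n) (auto intro: has_val_mult has_val_1)

lemma has_val_prod: "\<rho> > 0 \<Longrightarrow> (\<And>i. i \<in> A \<Longrightarrow> has_val \<rho> (f i) z (v i)) \<Longrightarrow> has_val \<rho> (prod f A) z (prod v A)"
  by (induction A rule: infinite_finite_induct) (auto intro: has_val_mult has_val_1)

lemma has_val_sum: "\<rho> > 0 \<Longrightarrow> (\<And>i. i \<in> A \<Longrightarrow> has_val \<rho> (f i) z (v i)) \<Longrightarrow> has_val \<rho> (sum f A) z (sum v A)"
  by (induction A rule: infinite_finite_induct) (auto intro: has_val_add has_val_0)

lemma has_val_poly: "\<rho> > 0 \<Longrightarrow> has_val \<rho> (fps_of_poly P) z (poly P z)"
proof (induction P)
  case (pCons a P)
  thus ?case unfolding fps_of_poly_pCons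
    by (subst mult.commute) (auto intro!: has_val_add has_val_mult has_val_const has_val_X)
qed (auto intro: has_val_0)

lemma linear_mult_nth:
  fixes z :: 'c
  shows "((fps_X - fps_const z) * G) $ k = (if k = 0 then 0 else G $ (k - 1)) - z * G $ k"
  by (cases k) (auto simp: left_diff_distrib)

lemma partial_sum_linear:
  fixes z :: 'c
  shows "(\<Sum>i<N. ((fps_X - fps_const z) * G) $ i * z ^ i) = - (if N = 0 then 0 else G $ (N - 1) * z ^ N)"
  by (induction N) (auto simp: linear_mult_nth algebra_simps)

text \<open>Ties the algebraic notion of value to convergence: by telescoping, the truncation error
  is the single term \<open>G $ N * z ^ Suc N\<close> up to sign, and boundedness of
  \<open>G\<close> at a radius larger than \<open>av z\<close> sends it to zero.\<close>

lemma has_val_sums: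
  assumes v: "has_val \<rho> f z v" and z: "av z < \<rho>"
  shows "av_sums av (\<lambda>k. f $ k * z ^ k) v"
proof -
  have \<rho>: "\<rho> > 0" using z av_nonneg[of z] by linarith
  obtain G B where G: "bdd G \<rho> B" "f = fps_const v + (fps_X - fps_const z) * G"
    using v unfolding has_val_def fbd_def by blast
  have S: "(\<Sum>i<Suc N. f $ i * z ^ i) - v = - (G $ N * z ^ Suc N)" for N
  proof -
    have "(\<Sum>i<Suc N. f $ i * z ^ i) = (\<Sum>i<Suc N. fps_const v $ i * z ^ i)
        + (\<Sum>i<Suc N. ((fps_X - fps_const z) * G) $ i * z ^ i)"
      unfolding G(2) fps_add_nth by (simp only: sum.distrib distrib_right)
    also have "(\<Sum>i<Suc N. fps_const v $ i * z ^ i) = v"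
      by (subst sum.lessThan_Suc_shift) (auto)
    finally show ?thesis using partial_sum_linear[of z G "Suc N"] by simp
  qed
  have "(\<lambda>N. B * \<rho> * (av z / \<rho>) ^ Suc N) \<longlonglongrightarrow> B * \<rho> * 0"
    using z \<rho> by (intro tendsto_mult tendsto_const LIMSEQ_Suc[OF LIMSEQ_realpow_zero]) auto
  hence lim: "(\<lambda>N. B * \<rho> * (av z / \<rho>) ^ Suc N) \<longlonglongrightarrow> 0" by simp
  have "(\<lambda>N. av ((\<Sum>i<Suc N. f $ i * z ^ i) - v)) \<longlonglongrightarrow> 0"
  proof (rule tendsto_sandwich[OF _ _ tendsto_const lim])
    have "av ((\<Sum>i<Suc N. f $ i * z ^ i) - v) \<le> B * \<rho> * (av z / \<rho>) ^ Suc N" for N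
    proof -
      have "av ((\<Sum>i<Suc N. f $ i * z ^ i) - v) = av (G $ N) * av z ^ Suc N"
        unfolding S by (simp only: av_minus av_mult av_power)
      also have "\<dots> \<le> B / \<rho> ^ N * av z ^ Suc N"
        using bddD[OF G(1) \<rho>] by (intro mult_right_mono) auto
      also have "\<dots> = B * \<rho> * (av z / \<rho>) ^ Suc N" using \<rho> by (simp add: field_simps)
      finally show ?thesis .
    qed
    thus "\<forall>\<^sub>F N in sequentially. av ((\<Sum>i<Suc N. f $ i * z ^ i) - v) \<le> B * \<rho> * (av z / \<rho>) ^ Suc N" by auto
  qed auto
  thus ?thesis unfolding av_sums_def by (rule LIMSEQ_imp_Suc)
qed

text \<open>Both values are limits of the same partial sums. The radii may differ, so a value found
  on one disc can be used on another, as happens for the zeros of the auxiliary function.\<close>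

lemma has_val_unique:
  assumes "has_val \<rho> f z v" "has_val \<rho>' f z w" "av z < \<rho>" "av z < \<rho>'"
  shows "v = w"
  using has_val_sums[OF assms(1,3)] has_val_sums[OF assms(2,4)]
  unfolding av_sums_def av_lim_def[symmetric] by (rule av_lim_unique)

lemma av_suminf_eqI: "av_sums av f s \<Longrightarrow> av_suminf av f = s"
  unfolding av_suminf_def
  by (rule the_equality) (use av_lim_unique in \<open>auto simp: av_sums_def av_lim_def\<close>)

end

section \<open>Division by linear factors and zeros over a complete field\<close>

locale complete_na_field = na_field +
  assumes compl: "av_complete av"
begin

text \<open>By the ultrametric inequality, consecutive differences tending to zero already make a
  sequence Cauchy.\<close>

lemma av_lim_exists:
  assumes "(\<lambda>k. av (X (Suc k) - X k)) \<longlonglongrightarrow> 0"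
  shows "\<exists>L. av_lim X L"
proof -
  have "\<exists>N. \<forall>m\<ge>N. \<forall>k\<ge>N. av (X m - X k) < e" if e: "e > 0" for e
  proof -
    obtain N where N: "\<And>k. k \<ge> N \<Longrightarrow> av (X (Suc k) - X k) < e"
      using assms e unfolding LIMSEQ_def dist_real_def by auto
    have N': "av (X k - X N) \<le> e / 2 \<or> av (X k - X N) < e" if "k \<ge> N" for k
      using that
    proof (induction k rule: dec_induct)
      case (step k)
      have "av (X (Suc k) - X N) \<le> max (av (X (Suc k) - X k)) (av (X k - X N))"
        using av_add[of "X (Suc k) - X k" "X k - X N"] by simp
      thus ?case using step.IH N[of k] step.hyps e by auto
    qed (use e in auto)
    have "av (X m - X k) < e" if "m \<ge> N" "k \<ge> N" for m k
    proof -
      have "av (X m - X k) \<le> max (av (X m - X N)) (av (X k - X N))"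
        using av_add[of "X m - X N" "-(X k - X N)"] av_minus[of "X k - X N"] by simp
      thus ?thesis using N'[OF that(1)] N'[OF that(2)] e by auto
    qed
    thus ?thesis by blast
  qed
  thus ?thesis using compl unfolding av_complete_def av_lim_def by blast
qed

text \<open>\<open>v\<close> is the sum of \<open>f\<close> at \<open>z\<close>, and
  \<open>z ^ Suc k * G $ k\<close> is the tail of that sum beyond index \<open>k\<close>, which is
  no larger than the bound for its first term. Division by \<open>t - z\<close> lowers the bound by
  the factor \<rho>; this gain is the source of the Schwarz lemma.\<close>

lemma division_by_linear:
  assumes f: "bdd f \<rho> B" and z: "z \<noteq> 0" "av z < \<rho>"
  shows "\<exists>v G. f = fps_const v + (fps_X - fps_const z) * G \<and> bdd G \<rho> (B / \<rho>)"
proof -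
  have \<rho>: "\<rho> > 0" using z av_nonneg[of z] by linarith
  have B: "B \<ge> 0" using bdd_nonneg[OF f \<rho>] .
  let ?S = "\<lambda>N. \<Sum>i<N. f $ i * z ^ i"
  have T: "av (f $ i * z ^ i) \<le> B * (av z / \<rho>) ^ i" for i
    using mult_right_mono[OF bddD[OF f \<rho>, of i], of "av z ^ i"] by (simp add: av_mult av_power power_divide)
  have "(\<lambda>k. av (?S (Suc k) - ?S k)) \<longlonglongrightarrow> 0"
  proof (rule tendsto_sandwich[OF _ _ tendsto_const])
    have "(\<lambda>i. B * (av z / \<rho>) ^ i) \<longlonglongrightarrow> B * 0"
      using z \<rho> by (intro tendsto_mult tendsto_const LIMSEQ_realpow_zero) auto
    thus "(\<lambda>i. B * (av z / \<rho>) ^ i) \<longlonglongrightarrow> 0" by simp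
  qed (use T in auto)
  from av_lim_exists[OF this] obtain v where v: "av_lim ?S v" by blast
  define G where "G = Abs_fps (\<lambda>k. (v - ?S (Suc k)) / z ^ Suc k)"
  have eq: "f = fps_const v + (fps_X - fps_const z) * G"
  proof (rule fps_ext)
    fix k show "f $ k = (fps_const v + (fps_X - fps_const z) * G) $ k"
      using z by (cases k) (auto simp: linear_mult_nth G_def field_simps)
  qed
  have "av (v - ?S N) \<le> B * (av z / \<rho>) ^ N" for N
  proof (rule av_lim_bound[where X = "\<lambda>M. ?S M - ?S N" and N = N])
    show "av_lim (\<lambda>M. ?S M - ?S N) (v - ?S N)"
      using av_lim_add[OF v av_lim_const[of "- ?S N"]] by simp
    fix M assume M: "M \<ge> N"
    have "?S M - ?S N = (\<Sum>i\<in>{..<M} - {..<N}. f $ i * z ^ i)"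
      using M by (subst sum_diff) auto
    also have "av \<dots> \<le> B * (av z / \<rho>) ^ N"
    proof (rule av_sum_le)
      fix i assume i: "i \<in> {..<M} - {..<N}"
      have "(av z / \<rho>) ^ i \<le> (av z / \<rho>) ^ N"
        using i z \<rho> by (intro power_decreasing) auto
      thus "av (f $ i * z ^ i) \<le> B * (av z / \<rho>) ^ N"
        using T[of i] B by (meson mult_left_mono order_trans)
    qed (use B \<rho> in auto)
    finally show "av (?S M - ?S N) \<le> B * (av z / \<rho>) ^ N" .
  qed
  note tail = this
  have "bdd G \<rho> (B / \<rho>)" unfolding bdd_def
  proof
    fix k
    have "av (G $ k) * \<rho> ^ k \<le> (B * (av z / \<rho>) ^ Suc k) / av z ^ Suc k * \<rho> ^ k"
      unfolding G_def fps_nth_Abs_fps av_divide av_power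
      using tail[of "Suc k"] \<rho> by (intro mult_right_mono divide_right_mono) auto
    also have "\<dots> = B / \<rho>" using z \<rho> av_pos[of z] by (simp add: field_simps)
    finally show "av (G $ k) * \<rho> ^ k \<le> B / \<rho>" .
  qed
  thus ?thesis using eq by blast
qed

text \<open>Nonarchimedean Schwarz lemma.\<close>
lemma bdd_zeros:
  assumes "finite Z" "\<rho> \<ge> 1" "bdd E \<rho> B" "\<And>z. z \<in> Z \<Longrightarrow> z \<noteq> 0 \<and> av z < \<rho>"
    and "\<And>z. z \<in> Z \<Longrightarrow> has_val \<rho> E z 0"
  shows "av (E $ k) \<le> B * (\<Prod>z\<in>Z. max 1 (av z) / \<rho>)"
  using assms(1,3-5)
proof (induction Z arbitrary: E B k rule: finite_induct)
  case empty
  have "av (E $ k) * 1 \<le> av (E $ k) * \<rho> ^ k" using assms(2) by (intro mult_left_mono) auto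
  thus ?case using empty(1) unfolding bdd_def by (simp add: order_trans)
next
  case (insert z Z)
  have \<rho>: "\<rho> > 0" using assms(2) by simp
  obtain v G where G: "E = fps_const v + (fps_X - fps_const z) * G" "bdd G \<rho> (B / \<rho>)"
    using division_by_linear[OF insert.prems(1), of z] insert.prems(2)[of z] by blast
  have "has_val \<rho> E z v" unfolding has_val_def fbd_def using G by blast
  hence "v = 0" using insert.prems(2,3)[of z] has_val_unique by blast
  hence E: "E = (fps_X - fps_const z) * G" using G(1) by simp
  \<comment> \<open>As \<open>z' \<noteq> z\<close>, the zero of \<open>E\<close> at
    \<open>z'\<close> passes to the quotient \<open>G\<close>.\<close>
  have "has_val \<rho> G z' 0" if z': "z' \<in> Z" for z'
  proof -
    have zz: "z' \<noteq> 0" "av z' < \<rho>" using insert.prems(2)[of z'] z' by auto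
    obtain w H where H: "G = fps_const w + (fps_X - fps_const z') * H" "bdd H \<rho> (B / \<rho> / \<rho>)"
      using division_by_linear[OF G(2) zz] by blast
    have w: "has_val \<rho> G z' w" unfolding has_val_def fbd_def using H by blast
    have "has_val \<rho> E z' ((z' - z) * w)"
      unfolding E using \<rho> by (intro has_val_mult has_val_diff has_val_X has_val_const w)
    hence "(z' - z) * w = 0" using insert.prems(3)[of z'] z' has_val_unique zz by blast
    moreover have "z' \<noteq> z" using insert.hyps z' by blast
    ultimately show ?thesis using w by simp
  qed
  hence IH: "av (G $ k) \<le> B / \<rho> * (\<Prod>z\<in>Z. max 1 (av z) / \<rho>)" for k
    using insert.IH[OF G(2)] insert.prems(2) by auto
  let ?M = "B / \<rho> * (\<Prod>z\<in>Z. max 1 (av z) / \<rho>)"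
  have M: "?M \<ge> 0" using IH[of 0] av_nonneg[of "G $ 0"] by linarith
  \<comment> \<open>Multiplying back by \<open>t - z\<close> costs at most
    \<open>max 1 (av z)\<close>, against the gain \<rho> from the division.\<close>
  have "av (E $ k) \<le> max 1 (av z) * ?M"
    unfolding E linear_mult_nth
  proof (rule av_diff_le)
    have M1: "?M \<le> max 1 (av z) * ?M" using mult_right_mono[OF max.cobounded1 M, of 1 "av z"] by (simp only: mult_1)
    show "av (if k = 0 then 0 else G $ (k - 1)) \<le> max 1 (av z) * ?M"
      using IH[of "k - 1"] M M1 by auto
    show "av (z * G $ k) \<le> max 1 (av z) * ?M"
      unfolding av_mult using IH[of k] M by (intro mult_mono) auto
  qed
  also have "\<dots> = B * (\<Prod>z\<in>insert z Z. max 1 (av z) / \<rho>)"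
    using insert.hyps by simp
  finally show ?case .
qed

lemma has_val_exists:
  assumes f: "bdd f \<rho> B" and z: "z \<noteq> 0" "av z < \<rho>"
  shows "\<exists>v. has_val \<rho> f z v \<and> av v \<le> B"
proof -
  have \<rho>: "\<rho> > 0" using z av_nonneg[of z] by linarith
  have B: "B \<ge> 0" using bdd_nonneg[OF f \<rho>] .
  obtain v G where G: "f = fps_const v + (fps_X - fps_const z) * G" "bdd G \<rho> (B / \<rho>)"
    using division_by_linear[OF assms] by blast
  hence v: "has_val \<rho> f z v" unfolding has_val_def fbd_def by blast
  have "v = f $ 0 + z * G $ 0" by (subst G(1)) (simp add: linear_mult_nth)
  also have "av \<dots> \<le> B"
  proof (rule av_add_le)
    show "av (f $ 0) \<le> B" using bddD[OF f \<rho>, of 0] by simp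
    have "av z * av (G $ 0) \<le> \<rho> * (B / \<rho>)"
      using bddD[OF G(2) \<rho>, of 0] z \<rho> by (intro mult_mono) auto
    thus "av (z * G $ 0) \<le> B" using \<rho> by (simp add: av_mult)
  qed
  finally show ?thesis using v by blast
qed

text \<open>Evaluation is bounded by the Gauss norm and so commutes with limits in that norm; this
  computes the values of infinite products and sums from the partial ones.\<close>

lemma has_val_lim:
  assumes "\<And>N. bdd (f - F N) \<rho> (\<epsilon> N)" "\<epsilon> \<longlonglongrightarrow> 0" "\<And>N. has_val \<rho> (F N) z (V N)"
    and z: "z \<noteq> 0" "av z < \<rho>"
  shows "\<exists>v. has_val \<rho> f z v \<and> av_lim V v"
proof -
  have \<rho>: "\<rho> > 0" using z av_nonneg[of z] by linarith
  obtain w where w: "has_val \<rho> (f - F 0) z w" using has_val_exists[OF assms(1) z] by blast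
  have v: "has_val \<rho> f z (w + V 0)" using has_val_add[OF w assms(3)[of 0] \<rho>] by simp
  have "av (V N - (w + V 0)) \<le> \<epsilon> N" for N
  proof -
    obtain w' where w': "has_val \<rho> (f - F N) z w'" "av w' \<le> \<epsilon> N" using has_val_exists[OF assms(1) z] by blast
    have "w' = (w + V 0) - V N"
      using has_val_unique[OF w'(1) has_val_diff[OF v assms(3)[of N] \<rho>]] z by blast
    thus ?thesis using w'(2) av_diff_commute by metis
  qed
  hence "av_lim V (w + V 0)" unfolding av_lim_def
    by (intro tendsto_sandwich[OF _ _ tendsto_const assms(2)]) auto
  thus ?thesis using v by blast
qed

end

section \<open>The period and the logarithm series\<close>

locale frob_field = complete_na_field av for av :: "'c::field \<Rightarrow> real" +
  fixes p e q :: nat and \<theta> :: 'c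
  assumes clo: "alg_closed TYPE('c)"
    and p: "prime p" "CHAR('c) = p" and q: "e \<ge> 1" "q = p ^ e"
    and \<theta>: "\<not> algebraic_over (Fq q) \<theta>" "av \<theta> > 1"
begin

lemma p_ge_2: "p \<ge> 2" using p(1) by (rule prime_ge_2_nat)

lemma q_ge_2: "q \<ge> 2"
proof -
  have "p ^ 1 \<le> p ^ e" using p_ge_2 q(1) by (intro power_increasing) auto
  thus ?thesis using q p_ge_2 by simp
qed

lemma q_pos [simp]: "q > 0" and q_ge_1 [simp]: "Suc 0 \<le> q" using q_ge_2 by simp_all

lemma \<theta>_nz [simp]: "\<theta> \<noteq> 0" using \<theta>(2) by auto

section \<open>Frobenius powers and twists\<close>

definition frobexp :: "nat \<Rightarrow> bool" where "frobexp m \<longleftrightarrow> (\<exists>k. m = p ^ k)"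

lemma frobexp_q: "frobexp q" and frobexp_qk: "frobexp (q ^ k)" and frobexp_pk: "frobexp (p ^ k)"
  unfolding frobexp_def q(2) by (auto simp flip: power_mult)

lemma frobexp_pos: "frobexp m \<Longrightarrow> m > 0"
  unfolding frobexp_def using p_ge_2 by auto

lemma frob_add: "frobexp m \<Longrightarrow> CHAR('r::comm_ring_1) = p \<Longrightarrow> ((x::'r) + y) ^ m = x ^ m + y ^ m"
  unfolding frobexp_def using freshmans_dream'[of _ _ x y] p by auto

lemma frob_sum: "frobexp m \<Longrightarrow> CHAR('r::comm_ring_1) = p \<Longrightarrow> (\<Sum>i\<in>A. f i :: 'r) ^ m = (\<Sum>i\<in>A. f i ^ m)"
  unfolding frobexp_def using freshmans_dream_sum'[where f = f and A = A] p by auto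

lemma frob_minus: "frobexp m \<Longrightarrow> CHAR('r::comm_ring_1) = p \<Longrightarrow> (- x :: 'r) ^ m = - (x ^ m)"
  using frob_add[of m x "-x"] frobexp_pos[of m] by (simp add: power_0_left add_eq_0_iff2)

lemma frob_diff: "frobexp m \<Longrightarrow> CHAR('r::comm_ring_1) = p \<Longrightarrow> ((x::'r) - y) ^ m = x ^ m - y ^ m"
  using frob_add[of m x "-y"] frob_minus[of m y] by simp

lemma frob_inj: "frobexp m \<Longrightarrow> x ^ m = y ^ m \<Longrightarrow> (x::'c) = y"
  using frob_diff[of m x y] p(2) by simp

lemma frob_surj: "frobexp m \<Longrightarrow> \<exists>y. y ^ m = (x::'c)"
proof -
  assume m: "frobexp m"
  have "degree (monom 1 m + [:-x:] :: 'c poly) = m"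
    using frobexp_pos[OF m] by (subst degree_add_eq_left) (auto simp: degree_monom_eq)
  then obtain y where "poly (monom 1 m + [:-x:]) y = 0"
    using clo frobexp_pos[OF m] unfolding alg_closed_def by metis
  thus ?thesis by (auto simp: poly_monom)
qed

text \<open>The Frobenius twist acts on coefficients and fixes \<open>t\<close>, unlike the power
  \<open>f ^ m\<close>, which also sends \<open>t\<close> to \<open>t ^ m\<close>.\<close>

definition tw :: "nat \<Rightarrow> 'c fps \<Rightarrow> 'c fps" where
  "tw m f = Abs_fps (\<lambda>n. (f $ n) ^ m)"

lemma tw_nth [simp]: "tw m f $ n = (f $ n) ^ m"
  by (simp add: tw_def)

lemma tw_add: "frobexp m \<Longrightarrow> tw m (f + g) = tw m f + tw m g"
  by (intro fps_ext) (simp add: frob_add p)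

lemma tw_diff: "frobexp m \<Longrightarrow> tw m (f - g) = tw m f - tw m g"
  by (intro fps_ext) (simp add: frob_diff p)

lemma tw_mult: "frobexp m \<Longrightarrow> tw m (f * g) = tw m f * tw m g"
  by (intro fps_ext) (simp add: fps_mult_nth frob_sum p power_mult_distrib)

lemma tw_0: "frobexp m \<Longrightarrow> tw m 0 = 0"
  using frobexp_pos by (intro fps_ext) simp

lemma tw_1: "frobexp m \<Longrightarrow> tw m 1 = 1"
  using frobexp_pos by (intro fps_ext) simp

lemma tw_const: "frobexp m \<Longrightarrow> tw m (fps_const c) = fps_const (c ^ m)"
  using frobexp_pos by (intro fps_ext) (simp add: fps_const_def)

lemma tw_X: "frobexp m \<Longrightarrow> tw m fps_X = fps_X"
  using frobexp_pos by (intro fps_ext) (simp add: fps_X_def)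

lemma tw_power: "frobexp m \<Longrightarrow> tw m (f ^ k) = tw m f ^ k"
  by (induction k) (auto simp: tw_1 tw_mult)

lemma tw_sum: "frobexp m \<Longrightarrow> tw m (sum f A) = (\<Sum>i\<in>A. tw m (f i))"
  by (induction A rule: infinite_finite_induct) (auto simp: tw_0 tw_add)

lemma tw_prod: "frobexp m \<Longrightarrow> tw m (prod f A) = (\<Prod>i\<in>A. tw m (f i))"
  by (induction A rule: infinite_finite_induct) (auto simp: tw_1 tw_mult)

lemma tw_tw: "tw m (tw m' f) = tw (m' * m) f"
  by (intro fps_ext) (simp add: power_mult)

lemma tw_eq_0: "frobexp m \<Longrightarrow> tw m f = 0 \<longleftrightarrow> f = 0"
  using frobexp_pos[of m] by (auto simp: fps_eq_iff)

definition twp :: "nat \<Rightarrow> 'c poly \<Rightarrow> 'c poly" where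
  "twp m P = map_poly (\<lambda>x. x ^ m) P"

lemma coeff_twp: "m > 0 \<Longrightarrow> coeff (twp m P) i = coeff P i ^ m"
  by (simp add: twp_def coeff_map_poly)

lemma tw_poly: "frobexp m \<Longrightarrow> tw m (fps_of_poly P) = fps_of_poly (twp m P)"
  using frobexp_pos[of m] by (intro fps_ext) (simp add: coeff_twp)

lemma degree_twp: "degree (twp m P) \<le> degree P"
  unfolding twp_def by (rule map_poly_degree_leq)

lemma bdd_tw: "bdd f \<rho> B \<Longrightarrow> \<rho> > 0 \<Longrightarrow> bdd (tw m f) (\<rho> ^ m) (B ^ m)"
  unfolding bdd_def
proof
  fix k assume a: "\<forall>k. av (f $ k) * \<rho> ^ k \<le> B" "\<rho> > 0"
  have "av (tw m f $ k) * (\<rho> ^ m) ^ k = (av (f $ k) * \<rho> ^ k) ^ m"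
    by (simp add: av_power power_mult_distrib mult.commute flip: power_mult)
  also have "\<dots> \<le> B ^ m" using a by (intro power_mono) auto
  finally show "av (tw m f $ k) * (\<rho> ^ m) ^ k \<le> B ^ m" .
qed

lemma fbd_tw: "fbd \<rho> f \<Longrightarrow> \<rho> > 0 \<Longrightarrow> fbd (\<rho> ^ m) (tw m f)"
  unfolding fbd_def using bdd_tw by blast

lemma has_val_tw:
  assumes "has_val \<rho> f z v" "\<rho> > 0" "frobexp m"
  shows "has_val (\<rho> ^ m) (tw m f) (z ^ m) (v ^ m)"
proof -
  obtain G where G: "fbd \<rho> G" "f = fps_const v + (fps_X - fps_const z) * G"
    using assms(1) unfolding has_val_def by blast
  have "tw m f = fps_const (v ^ m) + (fps_X - fps_const (z ^ m)) * tw m G"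
    by (subst G(2)) (simp only: tw_add tw_mult tw_diff tw_const tw_X assms(3))
  thus ?thesis unfolding has_val_def using fbd_tw[OF G(1) assms(2)] by blast
qed

text \<open>As \<epsilon> decreases, the bound for step \<open>i\<close> also bounds every later
  step, hence by the ultrametric inequality the whole tail. The limit is taken
  coefficientwise.\<close>

lemma fps_limit:
  assumes b: "\<And>i. bdd (S (Suc i) - S i) \<rho> (\<epsilon> i)" and \<epsilon>: "decseq \<epsilon>" "\<epsilon> \<longlonglongrightarrow> 0" and \<rho>: "\<rho> > 0"
  obtains f where "\<And>k. av_lim (\<lambda>i. S i $ k) (f $ k)" "\<And>i. bdd (f - S i) \<rho> (\<epsilon> i)"
proof -
  have tail: "av (S j $ k - S i $ k) \<le> \<epsilon> i / \<rho> ^ k" if "j \<ge> i" for i j k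
    using that
  proof (induction j rule: dec_induct)
    case base
    have "\<epsilon> i \<ge> 0" using bdd_nonneg[OF b \<rho>] .
    thus ?case using \<rho> by simp
  next
    case (step j)
    have "av (S (Suc j) $ k - S j $ k) \<le> \<epsilon> j / \<rho> ^ k" using bddD[OF b \<rho>, of j k] by simp
    also have "\<dots> \<le> \<epsilon> i / \<rho> ^ k" using \<epsilon>(1) step.hyps \<rho> by (intro divide_right_mono) (auto simp: decseq_def)
    finally have "av ((S (Suc j) $ k - S j $ k) + (S j $ k - S i $ k)) \<le> \<epsilon> i / \<rho> ^ k"
      using step.IH by (intro av_add_le)
    thus ?case by simp
  qed
  have "\<exists>L. av_lim (\<lambda>i. S i $ k) L" for k
  proof (rule av_lim_exists)
    have "(\<lambda>i. \<epsilon> i / \<rho> ^ k) \<longlonglongrightarrow> 0 / \<rho> ^ k" using \<epsilon>(2) by (intro tendsto_divide) (use \<rho> in auto)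
    hence l: "(\<lambda>i. \<epsilon> i / \<rho> ^ k) \<longlonglongrightarrow> 0" by simp
    show "(\<lambda>i. av (S (Suc i) $ k - S i $ k)) \<longlonglongrightarrow> 0"
      by (rule tendsto_sandwich[OF _ _ tendsto_const l]) (use tail in auto)
  qed
  then obtain F where F: "\<And>k. av_lim (\<lambda>i. S i $ k) (F k)" by metis
  define f where "f = Abs_fps F"
  have f: "av_lim (\<lambda>i. S i $ k) (f $ k)" for k using F by (simp add: f_def)
  have "bdd (f - S i) \<rho> (\<epsilon> i)" for i unfolding bdd_def
  proof
    fix k
    have "av (f $ k - S i $ k) \<le> \<epsilon> i / \<rho> ^ k"
    proof (rule av_lim_bound[where N = i])
      show "av_lim (\<lambda>j. S j $ k - S i $ k) (f $ k - S i $ k)"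
        using av_lim_add[OF f[of k] av_lim_const[of "- S i $ k"]] by simp
    qed (rule tail)
    thus "av ((f - S i) $ k) * \<rho> ^ k \<le> \<epsilon> i" using \<rho> by (simp add: field_simps)
  qed
  thus ?thesis using that f by blast
qed

definition fps_lim :: "(nat \<Rightarrow> 'c fps) \<Rightarrow> 'c fps \<Rightarrow> bool" where
  "fps_lim S f \<longleftrightarrow> (\<forall>k. av_lim (\<lambda>i. S i $ k) (f $ k))"

lemma fps_lim_unique: "fps_lim S f \<Longrightarrow> fps_lim S g \<Longrightarrow> f = g"
  unfolding fps_lim_def by (auto intro!: fps_ext av_lim_unique)

lemma fps_lim_tw: "frobexp m \<Longrightarrow> fps_lim S f \<Longrightarrow> fps_lim (\<lambda>i. tw m (S i)) (tw m f)"
  unfolding fps_lim_def using frobexp_pos[of m] by (auto intro!: av_lim_frob frob_diff p)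

lemma fps_lim_mult: "fps_lim S f \<Longrightarrow> fps_lim (\<lambda>i. g * S i) (g * f)"
  unfolding fps_lim_def fps_mult_nth by (auto intro!: av_lim_sum av_lim_cmult)

lemma fps_lim_diff_const: "fps_lim S f \<Longrightarrow> fps_lim (\<lambda>i. S i - g) (f - g)"
  unfolding fps_lim_def using av_lim_add[OF _ av_lim_const[of "- (g $ k)" for k]] by simp

lemma fps_lim_Suc: "fps_lim S f \<Longrightarrow> fps_lim (\<lambda>i. S (Suc i)) f"
  unfolding fps_lim_def by (auto intro: av_lim_Suc)

definition geo :: "'c \<Rightarrow> 'c fps" where "geo a = Abs_fps (\<lambda>n. a ^ n)"

lemma geo_inverse: "(1 - fps_const a * fps_X) * geo a = 1"
proof (rule fps_ext)
  fix n show "((1 - fps_const a * fps_X) * geo a) $ n = 1 $ n"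
    by (cases n) (simp_all add: left_diff_distrib mult.assoc geo_def)
qed

lemma bdd_geo: "av a * \<rho> \<le> 1 \<Longrightarrow> \<rho> > 0 \<Longrightarrow> bdd (geo a) \<rho> 1"
  unfolding bdd_def geo_def by (auto simp: av_power power_mult_distrib[symmetric] power_le_one)

lemma tw_geo: "tw m (geo a) = geo (a ^ m)"
  by (intro fps_ext) (simp add: geo_def mult.commute flip: power_mult)

text \<open>The absolute value of \<open>\<theta> ^ q\<close>, the nearest possible pole of the
  period series and of the logarithm series. Their coefficients are bounded with respect to exactly
  this radius.\<close>

definition rad :: real where "rad = av \<theta> ^ q"

lemma rad_gt: "av \<theta> < rad"
  using power_strict_increasing[of 1 q "av \<theta>"] \<theta>(2) q_ge_2 unfolding rad_def by simp

lemma rad_gt_1: "rad > 1" and rad_pos: "rad > 0"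
  using rad_gt \<theta>(2) by auto

lemma qk_mono: "k \<ge> 1 \<Longrightarrow> q \<le> q ^ k"
  using power_increasing[of 1 k q] by simp

lemma rad_le: "k \<ge> 1 \<Longrightarrow> rad \<le> av \<theta> ^ (q ^ k)"
  unfolding rad_def using qk_mono \<theta>(2) by (intro power_increasing) auto

text \<open>The expansion of \<open>1 / (t - \<theta> ^ (q ^ k))\<close> at zero.\<close>

definition lf :: "nat \<Rightarrow> 'c fps" where
  "lf k = fps_const (- inverse (\<theta> ^ (q ^ k))) * geo (inverse (\<theta> ^ (q ^ k)))"

lemma lf_inverse: "(fps_X - fps_const (\<theta> ^ (q ^ k))) * lf k = 1"
proof -
  let ?t = "\<theta> ^ (q ^ k)"
  have "(fps_X - fps_const ?t) * fps_const (- inverse ?t) = fps_const (?t * inverse ?t) - fps_const (inverse ?t) * fps_X"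
    unfolding left_diff_distrib fps_const_mult by (simp add: mult.commute)
  also have "?t * inverse ?t = 1" by simp
  finally have "(fps_X - fps_const ?t) * fps_const (- inverse ?t) = 1 - fps_const (inverse ?t) * fps_X" by simp
  thus ?thesis unfolding lf_def mult.assoc[symmetric] by (simp only: geo_inverse)
qed

lemma tw_lf: "tw q (lf k) = lf (Suc k)"
proof -
  have "inverse (\<theta> ^ q ^ k) ^ q = inverse (\<theta> ^ q ^ Suc k)"
    by (simp add: power_inverse mult.commute flip: power_mult)
  thus ?thesis unfolding lf_def tw_mult[OF frobexp_q] tw_const[OF frobexp_q] tw_geo
    using frob_minus[OF frobexp_q p(2)] by simp
qed

lemma bdd_geo_theta: "k \<ge> 1 \<Longrightarrow> bdd (geo (inverse (\<theta> ^ (q ^ k)))) rad 1"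
  using rad_le[of k] rad_pos \<theta>(2)
  by (intro bdd_geo) (simp_all add: av_inverse av_power divide_inverse[symmetric] mult.commute[of "inverse _"])

lemma bdd_lf: "k \<ge> 1 \<Longrightarrow> bdd (lf k) rad (1 / av \<theta> ^ (q ^ k))"
  unfolding lf_def using bdd_mult[OF bdd_const bdd_geo_theta rad_pos, of k "- inverse (\<theta> ^ (q ^ k))"]
  by (simp add: av_inverse av_power divide_inverse)

lemma av_theta_qk: "k \<ge> 1 \<Longrightarrow> av \<theta> < av (\<theta> ^ (q ^ k))"
  using rad_le[of k] rad_gt by (simp add: av_power)

lemma theta_qk_neq: "k \<ge> 1 \<Longrightarrow> \<theta> - \<theta> ^ (q ^ k) \<noteq> 0"
  using av_theta_qk[of k] by auto

lemma has_val_lf: "k \<ge> 1 \<Longrightarrow> has_val rad (lf k) \<theta> (1 / (\<theta> - \<theta> ^ (q ^ k)))"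
proof -
  assume k: "k \<ge> 1"
  obtain v where v: "has_val rad (lf k) \<theta> v"
    using has_val_exists[OF bdd_lf[OF k] \<theta>_nz rad_gt] by blast
  have "has_val rad 1 \<theta> ((\<theta> - \<theta> ^ (q ^ k)) * v)"
    unfolding lf_inverse[of k, symmetric] using rad_pos
    by (intro has_val_mult has_val_diff has_val_X has_val_const v)
  hence "(\<theta> - \<theta> ^ (q ^ k)) * v = 1" using has_val_1 has_val_unique rad_gt by blast
  hence "v = 1 / (\<theta> - \<theta> ^ (q ^ k))" using theta_qk_neq[OF k] by (metis nonzero_mult_div_cancel_left)
  thus ?thesis using v by simp
qed

lemma decreasing_qpow:
  fixes x C :: real
  assumes "0 \<le> x" "x < 1" "C \<ge> 0"
  shows "decseq (\<lambda>i. C * x ^ (q ^ i))" "(\<lambda>i. C * x ^ (q ^ i)) \<longlonglongrightarrow> 0"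
proof -
  have mono: "q ^ i \<le> q ^ j" if "i \<le> j" for i j using that by (intro power_increasing) auto
  show "decseq (\<lambda>i. C * x ^ (q ^ i))"
    unfolding decseq_def using mult_left_mono[OF power_decreasing[OF mono] assms(3)] assms(1,2) by simp
  have "strict_mono (\<lambda>i. q ^ i)" using q_ge_2 by (auto simp: strict_mono_def)
  hence "((\<lambda>i. x ^ i) \<circ> (\<lambda>i. q ^ i)) \<longlonglongrightarrow> 0"
    using assms by (intro LIMSEQ_subseq_LIMSEQ LIMSEQ_realpow_zero)
  thus "(\<lambda>i. C * x ^ (q ^ i)) \<longlonglongrightarrow> 0" using tendsto_mult[OF tendsto_const[of C]] by (force simp: o_def)
qed

text \<open>\<open>F\<close> is the limit of the partial products \<open>S N\<close>. The Frobenius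
  shifts the factors by one, which leaves the first factor over and gives the difference equation.
  The bound is stated with the constant \<open>av \<zeta> ^ q = av (F $ 0)\<close>, because this
  sharp form makes the reciprocal bounded as well.\<close>

lemma Pi_exists:
  assumes \<zeta>: "\<zeta> ^ (q - 1) = - \<theta>"
  obtains F where "bdd F rad (av \<zeta> ^ q)" "F $ 0 = \<zeta> ^ q"
    "tw q F = (fps_X - fps_const (\<theta> ^ q)) * F" "has_val rad F \<theta> (pi_tilde av q \<theta> \<zeta>)"
proof -
  let ?t = "\<lambda>k. \<theta> ^ (q ^ k)"
  define S where "S = (\<lambda>N. fps_const (\<zeta> ^ q) * (\<Prod>i\<in>{1..N}. geo (inverse (?t i))))"
  \<comment> \<open>The factor \<open>rad\<close> is the norm of \<open>t\<close> in
    \<open>geo a - 1 = a * t * geo a\<close>.\<close>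
  define C where "C = av \<zeta> ^ q * rad"
  have bS: "bdd (S N) rad (av \<zeta> ^ q)" for N
    unfolding S_def using bdd_mult[OF bdd_const bdd_prod[OF rad_pos, where B = "\<lambda>_. 1"] rad_pos, of "{1..N}" "\<lambda>i. geo (inverse (?t i))" "\<zeta> ^ q"]
      bdd_geo_theta by (simp add: av_power)
  have geo1: "geo a - 1 = fps_const a * fps_X * geo a" for a
    using geo_inverse[of a] by (simp add: algebra_simps)
  have diff: "bdd (S (Suc N) - S N) rad (C * (1 / av \<theta> ^ q) ^ (q ^ N))" for N
  proof -
    let ?a = "inverse (?t (Suc N))"
    have "S (Suc N) - S N = S N * (geo ?a - 1)" by (simp add: S_def algebra_simps)
    also have "\<dots> = fps_const ?a * fps_X * (S N * geo ?a)" unfolding geo1 by (simp add: algebra_simps)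
    finally have eq: "S (Suc N) - S N = fps_const ?a * fps_X * (S N * geo ?a)" .
    have "bdd fps_X rad rad" unfolding bdd_def using rad_pos by (auto simp: fps_X_def)
    hence "bdd (fps_const ?a * fps_X * (S N * geo ?a)) rad (av ?a * rad * (av \<zeta> ^ q * 1))"
      using rad_pos bdd_geo_theta[of "Suc N"] by (intro bdd_mult bdd_const bS) auto
    moreover have "av ?a * rad * (av \<zeta> ^ q * 1) = C * (1 / av \<theta> ^ q) ^ (q ^ N)"
      by (simp add: C_def av_inverse av_power divide_inverse power_inverse mult_ac flip: power_mult)
    ultimately show ?thesis unfolding eq by simp
  qed
  have th: "1 / av \<theta> ^ q < 1" using \<theta>(2) q_pos one_less_power[of "av \<theta>" q] by simp
  have th0: "0 \<le> 1 / av \<theta> ^ q" "C \<ge> 0" using rad_pos by (auto simp: C_def)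
  note d = decreasing_qpow[OF th0(1) th th0(2)]
  obtain F where F: "\<And>k. av_lim (\<lambda>i. S i $ k) (F $ k)" "\<And>i. bdd (F - S i) rad (C * (1 / av \<theta> ^ q) ^ (q ^ i))"
    using fps_limit[OF diff d rad_pos] by blast
  have lim: "fps_lim S F" using F(1) by (simp add: fps_lim_def)
  have b: "bdd F rad (av \<zeta> ^ q)" unfolding bdd_def
  proof
    fix k
    have "av (F $ k) \<le> av \<zeta> ^ q / rad ^ k"
      using av_lim_bound[OF F(1)[of k], of 0] bddD[OF bS rad_pos] by blast
    thus "av (F $ k) * rad ^ k \<le> av \<zeta> ^ q" using rad_pos by (simp add: field_simps)
  qed
  have p0: "(\<Prod>i\<in>A. geo (f i)) $ 0 = 1" for A :: "nat set" and f
    by (induction A rule: infinite_finite_induct) (auto simp: geo_def)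
  have S0: "S N $ 0 = \<zeta> ^ q" for N by (simp add: S_def p0)
  have F0: "F $ 0 = \<zeta> ^ q"
    using av_lim_unique[OF F(1)[of 0], of "\<zeta> ^ q"] unfolding S0 by simp
  have fe: "tw q (S N) = (fps_X - fps_const (\<theta> ^ q)) * S (Suc N)" for N
  proof -
    have "(fps_X - fps_const (\<theta> ^ q)) * geo (inverse (\<theta> ^ q)) = fps_const (- (\<theta> ^ q))"
    proof -
      have "fps_const (- (\<theta> ^ q)) * lf 1 = geo (inverse (\<theta> ^ q))"
        unfolding lf_def by (simp add: mult.assoc[symmetric])
      hence "(fps_X - fps_const (\<theta> ^ q)) * geo (inverse (\<theta> ^ q)) = fps_const (- (\<theta> ^ q)) * ((fps_X - fps_const (\<theta> ^ q ^ 1)) * lf 1)"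
        by (simp add: mult_ac)
      thus ?thesis by (simp only: lf_inverse mult_1_right)
    qed
    hence "(fps_X - fps_const (\<theta> ^ q)) * S (Suc N)
       = fps_const (\<zeta> ^ q * - (\<theta> ^ q)) * (\<Prod>i\<in>{2..Suc N}. geo (inverse (?t i)))"
      unfolding S_def by (subst prod.atLeast_Suc_atMost) (auto simp: mult_ac numeral_2_eq_2 fps_const_mult[symmetric] simp del: fps_const_mult fps_const_neg)
    also have "(\<Prod>i\<in>{2..Suc N}. geo (inverse (?t i))) = (\<Prod>i\<in>{1..N}. geo (inverse (?t (Suc i))))"
      using prod.shift_bounds_cl_Suc_ivl[of "\<lambda>i. geo (inverse (?t i))" 1 N] by (simp add: numeral_2_eq_2)
    also have "\<dots> = tw q (\<Prod>i\<in>{1..N}. geo (inverse (?t i)))"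
      by (simp add: tw_prod[OF frobexp_q] tw_geo power_inverse power_mult mult.commute[of q] flip: power_mult)
    \<comment> \<open>The normalisation of \<zeta> makes the constant reproduce itself:
      \<open>\<zeta> ^ q = \<zeta> * - \<theta>\<close>, now raised to the power
      \<open>q\<close>.\<close>
    also have "\<zeta> ^ q * - (\<theta> ^ q) = (\<zeta> ^ q) ^ q"
    proof -
      have "\<zeta> ^ q = \<zeta> ^ Suc (q - 1)" using q_pos by simp
      hence "\<zeta> ^ q = \<zeta> * - \<theta>" unfolding power_Suc \<zeta> .
      hence "(\<zeta> ^ q) ^ q = \<zeta> ^ q * (- \<theta>) ^ q" by (metis power_mult_distrib)
      thus ?thesis using frob_minus[OF frobexp_q p(2), of \<theta>] by simp
    qed
    finally show ?thesis by (simp add: S_def tw_mult tw_const frobexp_q)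
  qed
  have "fps_lim (\<lambda>i. tw q (S i)) (tw q F)" by (rule fps_lim_tw[OF frobexp_q lim])
  moreover have "fps_lim (\<lambda>i. tw q (S i)) ((fps_X - fps_const (\<theta> ^ q)) * F)"
    unfolding fe by (intro fps_lim_mult fps_lim_Suc lim)
  ultimately have FE: "tw q F = (fps_X - fps_const (\<theta> ^ q)) * F" using fps_lim_unique by blast
  have vg: "has_val rad (geo (inverse (?t k))) \<theta> (inverse (1 - inverse (\<theta> ^ (q ^ k - 1))))" if k: "k \<ge> 1" for k
  proof -
    have "geo (inverse (?t k)) = fps_const (- ?t k) * lf k" by (simp add: lf_def mult.assoc[symmetric])
    hence "has_val rad (geo (inverse (?t k))) \<theta> (- ?t k * (1 / (\<theta> - ?t k)))"
      using has_val_mult[OF has_val_const has_val_lf[OF k] rad_pos, of "- ?t k"] by simp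
    moreover have "- ?t k * (1 / (\<theta> - ?t k)) = inverse (1 - inverse (\<theta> ^ (q ^ k - 1)))"
    proof -
      have "q ^ k > 0" by simp
      hence t: "?t k = \<theta> * \<theta> ^ (q ^ k - 1)" by (metis power_minus_mult mult.commute)
      have "\<theta> - ?t k = - ?t k * (1 - inverse (\<theta> ^ (q ^ k - 1)))"
        unfolding t by (simp add: right_diff_distrib)
      moreover have "?t k \<noteq> 0" by simp
      ultimately show ?thesis by (simp add: inverse_eq_divide)
    qed
    ultimately show ?thesis by simp
  qed
  let ?Q = "\<lambda>N. \<Prod>i\<in>{1..N}. inverse (1 - inverse (\<theta> ^ (q ^ i - 1)))"
  have "has_val rad (S N) \<theta> (\<zeta> ^ q * ?Q N)" for N
    unfolding S_def using rad_pos vg by (intro has_val_mult has_val_const has_val_prod) auto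
  from has_val_lim[OF F(2) d(2) this \<theta>_nz rad_gt] obtain v where
    v: "has_val rad F \<theta> v" "av_lim (\<lambda>N. \<zeta> ^ q * ?Q N) v" by blast
  have \<zeta>0: "\<zeta> \<noteq> 0"
  proof
    assume "\<zeta> = 0"
    hence "q - 1 = 0" using \<zeta> \<theta>_nz by (cases "q - 1") auto
    thus False using q_ge_2 by simp
  qed
  have "av_lim ?Q (inverse (\<zeta> ^ q) * v)"
    using av_lim_cmult[OF v(2), of "inverse (\<zeta> ^ q)"] \<zeta>0 by (simp add: mult.assoc[symmetric])
  hence "av_prodinf av (\<lambda>i. inverse (1 - inverse (\<theta> ^ (q ^ i - 1)))) = inverse (\<zeta> ^ q) * v"
    unfolding av_prodinf_def by (intro the_equality) (auto simp: av_lim_def[symmetric] intro: av_lim_unique)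
  moreover have "- \<theta> * \<zeta> = \<zeta> ^ q"
  proof -
    have "\<zeta> ^ q = \<zeta> ^ Suc (q - 1)" using q_pos by simp
    also have "\<dots> = - \<theta> * \<zeta>" unfolding power_Suc2 \<zeta> ..
    finally show ?thesis ..
  qed
  ultimately have "pi_tilde av q \<theta> \<zeta> = v" unfolding pi_tilde_def using \<zeta>0 by simp
  thus ?thesis using that b F0 FE v(1) by blast
qed

lemma poly_norm_le: "av (coeff u j) \<le> poly_norm av u"
proof -
  have fin: "finite {av (coeff u j) | j. j \<le> degree u}" by (auto intro: finite_image_set)
  show ?thesis
  proof (cases "j \<le> degree u")
    case True
    thus ?thesis unfolding poly_norm_def using fin by (intro Max_ge) auto
  next
    case False
    hence "coeff u j = 0" by (simp add: coeff_eq_0)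
    moreover have "av (coeff u 0) \<le> poly_norm av u" unfolding poly_norm_def using fin by (intro Max_ge) auto
    ultimately show ?thesis using av_nonneg[of "coeff u 0"] by (simp del: av_nonneg)
  qed
qed

text \<open>\<open>M\<close> solves \<open>M ^ q = M * av \<theta> ^ (n * q)\<close>, so
  \<open>M ^ (q ^ i)\<close> is \<open>M\<close> times the size of the denominator of term
  \<open>i\<close>. Hence that term is at most \<open>C * x ^ (q ^ i)\<close> with
  \<open>x = poly_norm av u / M < 1\<close>; this is the origin of the exponent in the
  hypothesis.\<close>

lemma L_exists:
  assumes u: "poly_norm av u < av \<theta> powr (real n * real q / (real q - 1))"
  obtains L where "fbd rad L" "tw q L = (fps_X - fps_const (\<theta> ^ q)) ^ n * (L - fps_of_poly u)"
    "has_val rad L \<theta> (Lval av q \<theta> u n)"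
proof -
  let ?t = "\<lambda>k. \<theta> ^ (q ^ k)"
  define T where "T = (\<lambda>i. fps_of_poly (twp (q ^ i) u) * (\<Prod>k\<in>{1..i}. lf k) ^ n)"
  define S where "S = (\<lambda>N. \<Sum>i<N. T i)"
  define M where "M = av \<theta> powr (real n * real q / (real q - 1))"
  define x where "x = poly_norm av u / M"
  define C where "C = rad ^ degree u * M"
  have M: "M > 0" using \<theta>(2) by (simp add: M_def)
  have u0: "poly_norm av u \<ge> 0" using poly_norm_le[of u 0] av_nonneg by (meson order_trans)
  have x: "0 \<le> x" "x < 1" using u M u0 by (auto simp: x_def M_def)
  have C: "C \<ge> 0" using M rad_pos by (simp add: C_def)
  have Mq: "M ^ q = M * av \<theta> ^ (n * q)"
  proof -
    have pos: "0 < av \<theta>" using \<theta>(2) by linarith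
    have "M ^ q = av \<theta> powr (real n * real q / (real q - 1) * real q)"
      unfolding M_def using pos by (simp add: powr_realpow[symmetric] powr_powr)
    also have "real n * real q / (real q - 1) * real q = real n * real q / (real q - 1) + real (n * q)"
    proof -
      have "real n * real q / (real q - 1) * (real q - 1) = real n * real q" using q_ge_2 by simp
      thus ?thesis by (simp add: right_diff_distrib)
    qed
    also have "av \<theta> powr \<dots> = M * av \<theta> ^ (n * q)" using pos by (simp add: powr_add powr_realpow M_def del: of_nat_mult)
    finally show ?thesis .
  qed
  have Mi: "M ^ (q ^ i) = M * (\<Prod>k\<in>{1..i}. av \<theta> ^ (q ^ k)) ^ n" for i
  proof (induction i)
    case (Suc i)
    have "M ^ (q ^ Suc i) = (M * av \<theta> ^ (n * q)) ^ (q ^ i)" by (simp add: power_mult Mq)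
    also have "\<dots> = M ^ (q ^ i) * (av \<theta> ^ (q ^ Suc i)) ^ n"
      by (simp add: power_mult_distrib mult_ac flip: power_mult)
    finally show ?case unfolding Suc.IH by (simp add: power_mult_distrib mult_ac)
  qed simp
  have bT: "bdd (T i) rad (C * x ^ (q ^ i))" for i
  proof -
    have "bdd (fps_of_poly (twp (q ^ i) u)) rad (poly_norm av u ^ (q ^ i) * rad ^ degree u)"
    proof (rule bdd_poly)
      show "av (coeff (twp (q ^ i) u) k) \<le> poly_norm av u ^ (q ^ i)" for k
        by (simp add: coeff_twp av_power power_mono poly_norm_le)
    qed (use rad_gt_1 degree_twp u0 in auto)
    moreover have "bdd ((\<Prod>k\<in>{1..i}. lf k) ^ n) rad ((\<Prod>k\<in>{1..i}. 1 / av \<theta> ^ (q ^ k)) ^ n)"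
      using rad_pos bdd_lf by (intro bdd_power bdd_prod) auto
    ultimately have "bdd (T i) rad (poly_norm av u ^ (q ^ i) * rad ^ degree u * (\<Prod>k\<in>{1..i}. 1 / av \<theta> ^ (q ^ k)) ^ n)"
      unfolding T_def using rad_pos by (intro bdd_mult)
    moreover have "poly_norm av u ^ (q ^ i) * rad ^ degree u * (\<Prod>k\<in>{1..i}. 1 / av \<theta> ^ (q ^ k)) ^ n = C * x ^ (q ^ i)"
    proof -
      have "(\<Prod>k\<in>{1..i}. 1 / av \<theta> ^ (q ^ k)) ^ n = M / M ^ (q ^ i)"
        unfolding Mi using M by (simp add: prod_dividef power_divide)
      thus ?thesis by (simp add: C_def x_def power_divide)
    qed
    ultimately show ?thesis by simp
  qed
  have diff: "bdd (S (Suc i) - S i) rad (C * x ^ (q ^ i))" for i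
    using bT by (simp add: S_def)
  note d = decreasing_qpow[OF x C]
  obtain F where F: "\<And>k. av_lim (\<lambda>i. S i $ k) (F $ k)" "\<And>i. bdd (F - S i) rad (C * x ^ (q ^ i))"
    using fps_limit[OF diff d rad_pos] by blast
  have lim: "fps_lim S F" using F(1) by (simp add: fps_lim_def)
  have b: "fbd rad F" using F(2)[of 0] unfolding S_def fbd_def by auto
  \<comment> \<open>The Frobenius sends term \<open>i\<close> to term \<open>Suc i\<close> times a
    power of the first denominator. The term \<open>T 0\<close>, which is \<open>u\<close>, is not
    reached, and this yields \<open>L - u\<close>.\<close>
  have feT: "tw q (T i) = (fps_X - fps_const (\<theta> ^ q)) ^ n * T (Suc i)" for i
  proof -
    have "tw q (fps_of_poly (twp (q ^ i) u)) = fps_of_poly (twp (q ^ Suc i) u)"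
      by (simp only: tw_poly[OF frobexp_qk, symmetric] tw_tw flip: power_Suc2)
    hence "tw q (T i) = fps_of_poly (twp (q ^ Suc i) u) * (\<Prod>k\<in>{1..i}. lf (Suc k)) ^ n"
      unfolding T_def using frobexp_q by (simp add: tw_mult tw_power tw_prod tw_lf)
    also have "(\<Prod>k\<in>{1..i}. lf (Suc k)) = (fps_X - fps_const (\<theta> ^ q)) * (\<Prod>k\<in>{1..Suc i}. lf k)"
      using lf_inverse[of 1] prod.shift_bounds_cl_Suc_ivl[of lf 1 i]
      by (subst prod.atLeast_Suc_atMost) (auto simp: mult.assoc[symmetric])
    finally show ?thesis unfolding T_def by (simp add: power_mult_distrib mult_ac)
  qed
  have T0: "T 0 = fps_of_poly u" by (simp add: T_def twp_def map_poly_id')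
  have fe: "tw q (S i) = (fps_X - fps_const (\<theta> ^ q)) ^ n * (S (Suc i) - fps_of_poly u)" for i
    unfolding S_def tw_sum[OF frobexp_q] feT sum.lessThan_Suc_shift T0 by (simp add: sum_distrib_left)
  have "fps_lim (\<lambda>i. tw q (S i)) (tw q F)" by (rule fps_lim_tw[OF frobexp_q lim])
  moreover have "fps_lim (\<lambda>i. tw q (S i)) ((fps_X - fps_const (\<theta> ^ q)) ^ n * (F - fps_of_poly u))"
    unfolding fe by (intro fps_lim_mult fps_lim_diff_const fps_lim_Suc lim)
  ultimately have FE: "tw q F = (fps_X - fps_const (\<theta> ^ q)) ^ n * (F - fps_of_poly u)"
    using fps_lim_unique by blast
  define V where "V = (\<lambda>i. frob_eval q i u \<theta> / ((\<Prod>k\<in>{1..i}. \<theta> - \<theta> ^ (q ^ k)) ^ n))"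
  have fr: "poly (twp (q ^ i) u) z = frob_eval q i u z" for i z
    unfolding frob_eval_def poly_altdef using degree_twp[of "q ^ i" u]
    by (intro sum.mono_neutral_cong_left) (auto simp: coeff_twp intro!: le_degree)
  have "has_val rad (T i) \<theta> (V i)" for i
  proof -
    have "has_val rad (T i) \<theta> (poly (twp (q ^ i) u) \<theta> * (\<Prod>k\<in>{1..i}. 1 / (\<theta> - \<theta> ^ (q ^ k))) ^ n)"
      unfolding T_def using rad_pos has_val_lf
      by (intro has_val_mult has_val_power has_val_prod has_val_poly) auto
    thus ?thesis by (simp add: V_def fr prod_dividef power_divide)
  qed
  hence "has_val rad (S N) \<theta> (\<Sum>i<N. V i)" for N
    unfolding S_def using rad_pos by (intro has_val_sum) auto
  from has_val_lim[OF F(2) d(2) this \<theta>_nz rad_gt] obtain v where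
    v: "has_val rad F \<theta> v" "av_lim (\<lambda>N. \<Sum>i<N. V i) v" by blast
  have "Lval av q \<theta> u n = v"
    unfolding Lval_def V_def[symmetric] using v(2) by (intro av_suminf_eqI) (simp add: av_sums_def av_lim_def)
  thus ?thesis using that b FE v(1) by blast
qed

end

section \<open>Finite extensions of the rational function field\<close>

context frob_field
begin

section \<open>The constants, the ring \<open>F_q[\<theta>]\<close> and its finite pieces\<close>

abbreviation "F \<equiv> (Fq q :: 'c set)"

lemma F_0 [simp]: "0 \<in> F" and F_1 [simp]: "1 \<in> F"
  by (auto simp: Fq_def power_0_left)

lemma F_add: "x \<in> F \<Longrightarrow> y \<in> F \<Longrightarrow> x + y \<in> F"
  and F_minus: "x \<in> F \<Longrightarrow> - x \<in> F"
  and F_diff: "x \<in> F \<Longrightarrow> y \<in> F \<Longrightarrow> x - y \<in> F"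
  and F_mult: "x \<in> F \<Longrightarrow> y \<in> F \<Longrightarrow> x * y \<in> F"
  by (auto simp: Fq_def frob_add frob_minus frob_diff frobexp_q p power_mult_distrib)

lemma F_sum: "(\<And>i. i \<in> A \<Longrightarrow> f i \<in> F) \<Longrightarrow> sum f A \<in> F"
  by (induction A rule: infinite_finite_induct) (auto intro: F_add)

lemma F_finite: "finite F"
proof -
  have "monom 1 q - [:0, 1:] \<noteq> (0 :: 'c poly)"
  proof
    assume "monom 1 q - [:0, 1:] = (0 :: 'c poly)"
    hence "coeff (monom 1 q - [:0, 1 :: 'c:]) q = 0" by simp
    thus False using q_ge_2 by (auto simp: coeff_pCons split: nat.splits)
  qed
  hence "finite {x. poly (monom 1 q - [:0, 1 :: 'c:]) x = 0}" by (rule poly_roots_finite)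
  thus ?thesis by (simp add: Fq_def poly_monom)
qed

text \<open>The base of all cardinalities in the pigeonhole arguments, which then compare exponents
  of \<kappa>.\<close>

definition \<kappa> :: nat where "\<kappa> = card F"

lemma \<kappa>_ge_2: "\<kappa> \<ge> 2"
proof -
  have "card {0, 1 :: 'c} \<le> card F" by (intro card_mono F_finite) auto
  thus ?thesis by (simp add: \<kappa>_def)
qed

lemma av_F: "x \<in> F \<Longrightarrow> x \<noteq> 0 \<Longrightarrow> av x = 1"
proof -
  assume x: "x \<in> F" "x \<noteq> 0"
  have "x ^ Suc (q - 1) = x" using x(1) by (simp add: Fq_def)
  hence "x * x ^ (q - 1) = x * 1" by (simp only: power_Suc mult_1_right)
  hence "x ^ (q - 1) = 1" using x(2) by (simp only: mult_cancel_left) simp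
  hence "av x ^ (q - 1) = 1" by (metis av_1 av_power)
  thus ?thesis using q_ge_2 power_eq_imp_eq_base[of "av x" "q - 1" 1] by simp
qed

lemma av_F_le: "x \<in> F \<Longrightarrow> av x \<le> 1"
  using av_F[of x] by (cases "x = 0") auto

definition PF :: "'c poly set" where "PF = {f. \<forall>i. coeff f i \<in> F}"

lemma PF_pCons [simp]: "pCons a f \<in> PF \<longleftrightarrow> a \<in> F \<and> f \<in> PF"
proof
  assume *: "pCons a f \<in> PF"
  hence "coeff (pCons a f) 0 \<in> F" "coeff (pCons a f) (Suc i) \<in> F" for i
    unfolding PF_def by blast+
  thus "a \<in> F \<and> f \<in> PF" by (simp add: PF_def)
qed (auto simp: PF_def coeff_pCons split: nat.splits)

lemma PF_0 [simp]: "0 \<in> PF" and PF_1 [simp]: "1 \<in> PF"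
  by (auto simp: PF_def)

lemma PF_add: "f \<in> PF \<Longrightarrow> g \<in> PF \<Longrightarrow> f + g \<in> PF"
  and PF_minus: "f \<in> PF \<Longrightarrow> - f \<in> PF"
  and PF_mult: "f \<in> PF \<Longrightarrow> g \<in> PF \<Longrightarrow> f * g \<in> PF"
  by (auto simp: PF_def coeff_mult intro: F_add F_minus F_diff F_mult F_sum)

lemma PF_monom: "c \<in> F \<Longrightarrow> monom c n \<in> PF"
  by (auto simp: PF_def)

lemma PF_sum: "(\<And>i. i \<in> A \<Longrightarrow> f i \<in> PF) \<Longrightarrow> sum f A \<in> PF"
  by (induction A rule: infinite_finite_induct) (auto intro: PF_add)

lemma PF_eval_nz: "f \<in> PF \<Longrightarrow> f \<noteq> 0 \<Longrightarrow> poly f \<theta> \<noteq> 0"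
  using \<theta>(1) unfolding algebraic_over_def PF_def by blast

text \<open>The top term dominates, since constants have absolute value at most one. This
  discreteness is the seed of the Liouville inequality.\<close>

lemma PF_eval_ge_1: "f \<in> PF \<Longrightarrow> f \<noteq> 0 \<Longrightarrow> av (poly f \<theta>) \<ge> 1"
proof (induction f)
  case (pCons a g)
  show ?case
  proof (cases "g = 0")
    case True
    thus ?thesis using pCons av_F[of a] by auto
  next
    case False
    hence "av (poly g \<theta>) \<ge> 1" using pCons by auto
    hence "1 * 1 < av \<theta> * av (poly g \<theta>)" using \<theta>(2) by (intro mult_less_le_imp_less) auto
    hence *: "1 < av (\<theta> * poly g \<theta>)" by (simp add: av_mult)
    moreover have "av a \<le> 1" using pCons.prems av_F_le by auto
    ultimately have "av (a + \<theta> * poly g \<theta>) = av (\<theta> * poly g \<theta>)" by (intro av_add_eq) linarith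
    thus ?thesis using * by simp
  qed
qed auto

definition A :: "nat \<Rightarrow> 'c set" where "A S = {poly f \<theta> | f. f \<in> PF \<and> degree f \<le> S}"

lemma A_I: "f \<in> PF \<Longrightarrow> degree f \<le> S \<Longrightarrow> poly f \<theta> \<in> A S"
  by (auto simp: A_def)

lemma A_E: "x \<in> A S \<Longrightarrow> (\<And>f. f \<in> PF \<Longrightarrow> degree f \<le> S \<Longrightarrow> x = poly f \<theta> \<Longrightarrow> P) \<Longrightarrow> P"
  by (auto simp: A_def)

lemma A_0 [simp]: "0 \<in> A S" and A_1 [simp]: "1 \<in> A S"
  using A_I[of 0 S] A_I[of 1 S] by auto

lemma A_mono: "x \<in> A S \<Longrightarrow> S \<le> T \<Longrightarrow> x \<in> A T"
  by (auto simp: A_def)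

lemma A_add: "x \<in> A S \<Longrightarrow> y \<in> A S \<Longrightarrow> x + y \<in> A S"
  by (elim A_E) (auto simp flip: poly_add intro!: A_I PF_add degree_add_le)

lemma A_minus: "x \<in> A S \<Longrightarrow> - x \<in> A S"
  by (elim A_E) (auto simp flip: poly_minus intro!: A_I PF_minus)

lemma A_diff: "x \<in> A S \<Longrightarrow> y \<in> A S \<Longrightarrow> x - y \<in> A S"
  using A_add[of x S "-y"] A_minus by simp

lemma A_mult: "x \<in> A S \<Longrightarrow> y \<in> A T \<Longrightarrow> x * y \<in> A (S + T)"
  by (elim A_E) (auto simp flip: poly_mult intro!: A_I PF_mult order_trans[OF degree_mult_le])

lemma A_theta: "x \<in> A S \<Longrightarrow> \<theta> ^ k * x \<in> A (S + k)"
proof -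
  assume x: "x \<in> A S"
  have "poly (monom 1 k) \<theta> \<in> A k" by (intro A_I PF_monom) (auto simp: degree_monom_eq)
  hence "\<theta> ^ k \<in> A k" by (simp add: poly_monom)
  thus ?thesis using A_mult[OF _ x, of "\<theta> ^ k" k] by (simp add: add.commute)
qed

lemma A_ge_1: "x \<in> A S \<Longrightarrow> x \<noteq> 0 \<Longrightarrow> av x \<ge> 1"
  by (elim A_E) (use PF_eval_ge_1 in force)

lemma A_le: "x \<in> A S \<Longrightarrow> av x \<le> av \<theta> ^ S"
proof (elim A_E)
  fix f assume f: "f \<in> PF" "degree f \<le> S" "x = poly f \<theta>"
  show "av x \<le> av \<theta> ^ S" unfolding f(3) poly_altdef
  proof (rule av_sum_le)
    fix i assume "i \<in> {..degree f}"
    hence "av \<theta> ^ i \<le> av \<theta> ^ S" using f(2) \<theta>(2) by (intro power_increasing) auto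
    moreover have "av (coeff f i) \<le> 1" using f(1) by (auto simp: PF_def intro: av_F_le)
    ultimately have "av (coeff f i) * av \<theta> ^ i \<le> 1 * av \<theta> ^ S"
      by (intro mult_mono) auto
    thus "av (coeff f i * \<theta> ^ i) \<le> av \<theta> ^ S" by (simp add: av_mult av_power)
  qed simp
qed

text \<open>Injective because \<theta> is transcendental over \<open>F_q\<close>; gives the exact
  number of elements of bounded degree.\<close>

lemma A_coeffs: "bij_betw (\<lambda>c. \<Sum>i\<le>S. c i * \<theta> ^ i) (PiE {..S} (\<lambda>_. F)) (A S)"
proof -
  have ev: "(\<Sum>i\<le>S. c i * \<theta> ^ i) = poly (\<Sum>i\<le>S. monom (c i) i) \<theta>" for c
    by (simp add: poly_sum poly_monom)
  have pf: "(\<Sum>i\<le>S. monom (c i) i) \<in> PF" if "\<And>i. i \<le> S \<Longrightarrow> c i \<in> F" for c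
    using that by (intro PF_sum PF_monom) auto
  have co: "coeff (\<Sum>i\<le>S. monom (c i) i) j = c j" if "j \<le> S" for c :: "nat \<Rightarrow> 'c" and j
    using that by (simp add: coeff_sum)
  show ?thesis unfolding bij_betw_def
  proof
    show "inj_on (\<lambda>c. \<Sum>i\<le>S. c i * \<theta> ^ i) (PiE {..S} (\<lambda>_. F))"
    proof (rule inj_onI)
      fix c c' assume c: "c \<in> PiE {..S} (\<lambda>_. F)" "c' \<in> PiE {..S} (\<lambda>_. F)"
        and eq: "(\<Sum>i\<le>S. c i * \<theta> ^ i) = (\<Sum>i\<le>S. c' i * \<theta> ^ i)"
      have "poly (\<Sum>i\<le>S. monom (c i - c' i) i) \<theta> = 0"
        using eq by (simp add: ev[symmetric] left_diff_distrib sum_subtractf)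
      moreover have "(\<Sum>i\<le>S. monom (c i - c' i) i) \<in> PF"
        using c by (intro pf F_diff) auto
      ultimately have z: "(\<Sum>i\<le>S. monom (c i - c' i) i) = 0" using PF_eval_nz by blast
      show "c = c'"
      proof (rule PiE_ext[OF c])
        fix j assume "j \<in> {..S}"
        thus "c j = c' j" using co[of j "\<lambda>i. c i - c' i"] z by simp
      qed
    qed
    show "(\<lambda>c. \<Sum>i\<le>S. c i * \<theta> ^ i) ` (PiE {..S} (\<lambda>_. F)) = A S"
    proof (intro equalityI subsetI)
      fix x assume "x \<in> (\<lambda>c. \<Sum>i\<le>S. c i * \<theta> ^ i) ` (PiE {..S} (\<lambda>_. F))"
      thus "x \<in> A S" unfolding ev
        by (auto intro!: A_I pf degree_sum_le order_trans[OF degree_monom_le])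
    next
      fix x assume "x \<in> A S"
      then obtain f where f: "f \<in> PF" "degree f \<le> S" "x = poly f \<theta>" by (elim A_E)
      have "x = (\<Sum>i\<le>S. restrict (coeff f) {..S} i * \<theta> ^ i)"
        unfolding f(3) poly_altdef using f(2) by (intro sum.mono_neutral_cong_left) (auto simp: coeff_eq_0)
      moreover have "restrict (coeff f) {..S} \<in> PiE {..S} (\<lambda>_. F)"
        using f(1) by (auto simp: PF_def)
      ultimately show "x \<in> (\<lambda>c. \<Sum>i\<le>S. c i * \<theta> ^ i) ` (PiE {..S} (\<lambda>_. F))" by blast
    qed
  qed
qed

lemma A_finite: "finite (A S)"
proof -
  have "finite (PiE {..S} (\<lambda>_. F))" using F_finite by (intro finite_PiE) auto
  thus ?thesis using bij_betw_finite[OF A_coeffs[of S]] by simp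
qed

lemma A_card: "card (A S) = \<kappa> ^ (S + 1)"
proof -
  have "card (A S) = card (PiE {..S} (\<lambda>_. F))" using bij_betw_same_card[OF A_coeffs[of S]] by simp
  also have "\<dots> = \<kappa> ^ (S + 1)" by (subst card_PiE) (auto simp: \<kappa>_def)
  finally show ?thesis .
qed

definition Ainf :: "'c set" where "Ainf = (\<Union>S. A S)"

lemma Ainf_iff: "x \<in> Ainf \<longleftrightarrow> (\<exists>f\<in>PF. x = poly f \<theta>)"
  unfolding Ainf_def A_def by blast

lemma Ainf_0 [simp]: "0 \<in> Ainf" and Ainf_1 [simp]: "1 \<in> Ainf"
  unfolding Ainf_def by auto

lemma Ainf_add: "x \<in> Ainf \<Longrightarrow> y \<in> Ainf \<Longrightarrow> x + y \<in> Ainf"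
  and Ainf_mult: "x \<in> Ainf \<Longrightarrow> y \<in> Ainf \<Longrightarrow> x * y \<in> Ainf"
  and Ainf_minus: "x \<in> Ainf \<Longrightarrow> - x \<in> Ainf"
  unfolding Ainf_iff by (auto simp flip: poly_add poly_mult poly_minus intro: PF_add PF_mult PF_minus)

lemma Ainf_finite_bound:
  assumes "finite Y" "Y \<subseteq> Ainf" obtains S where "Y \<subseteq> A S"
proof -
  from assms have "\<exists>S. Y \<subseteq> A S"
  proof (induction Y rule: finite_induct)
    case (insert y Y)
    then obtain S T where "Y \<subseteq> A S" "y \<in> A T" unfolding Ainf_def by auto
    hence "insert y Y \<subseteq> A (max S T)" using A_mono by (auto intro: max.cobounded1 max.cobounded2)
    thus ?case by blast
  qed auto
  thus ?thesis using that by blast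
qed

abbreviation "K \<equiv> Kfield q \<theta>"

lemma K_iff: "x \<in> K \<longleftrightarrow> (\<exists>a\<in>Ainf. \<exists>b\<in>Ainf. b \<noteq> 0 \<and> x = a / b)"
proof
  assume "x \<in> K"
  then obtain f g where "f \<in> PF" "g \<in> PF" "g \<noteq> 0" "x = poly f \<theta> / poly g \<theta>"
    unfolding Kfield_def PF_def by blast
  thus "\<exists>a\<in>Ainf. \<exists>b\<in>Ainf. b \<noteq> 0 \<and> x = a / b"
    using PF_eval_nz Ainf_iff by blast
next
  assume "\<exists>a\<in>Ainf. \<exists>b\<in>Ainf. b \<noteq> 0 \<and> x = a / b"
  then obtain a b where "a \<in> Ainf" "b \<in> Ainf" and ab: "b \<noteq> 0" "x = a / b" by blast
  then obtain f g where *: "f \<in> PF" "g \<in> PF" "a = poly f \<theta>" "b = poly g \<theta>"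
    unfolding Ainf_iff by blast
  hence "g \<noteq> 0" using ab by auto
  thus "x \<in> K" using * ab unfolding Kfield_def PF_def by blast
qed

lemma K_Ainf: "x \<in> Ainf \<Longrightarrow> x \<in> K"
  unfolding K_iff by (rule bexI[of _ x]) (auto intro!: bexI[of _ 1])

lemma K_0 [simp]: "0 \<in> K" and K_1 [simp]: "1 \<in> K"
  by (auto intro: K_Ainf)

lemma K_mult: "x \<in> K \<Longrightarrow> y \<in> K \<Longrightarrow> x * y \<in> K"
  unfolding K_iff by (metis Ainf_mult no_zero_divisors times_divide_times_eq)

lemma K_add: "x \<in> K \<Longrightarrow> y \<in> K \<Longrightarrow> x + y \<in> K"
  unfolding K_iff by (metis Ainf_add Ainf_mult no_zero_divisors add_frac_eq)

lemma K_minus: "x \<in> K \<Longrightarrow> - x \<in> K"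
  unfolding K_iff by (metis Ainf_minus minus_divide_left)

lemma K_divide: "x \<in> K \<Longrightarrow> y \<in> K \<Longrightarrow> x / y \<in> K"
proof -
  assume x: "x \<in> K" and y: "y \<in> K"
  have "inverse y \<in> K"
  proof (cases "y = 0")
    case False
    then obtain a b where "a \<in> Ainf" "b \<in> Ainf" "b \<noteq> 0" "y = a / b" using y K_iff by blast
    moreover from this False have "a \<noteq> 0" by auto
    ultimately show ?thesis unfolding K_iff by (auto simp: inverse_eq_divide)
  qed auto
  thus ?thesis using K_mult[OF x] by (simp add: divide_inverse)
qed

lemma common_denominator:
  assumes "finite C" "C \<subseteq> K"
  obtains b where "b \<in> Ainf" "b \<noteq> 0" "\<And>c. c \<in> C \<Longrightarrow> b * c \<in> Ainf"
proof -
  from assms have "\<exists>b\<in>Ainf. b \<noteq> 0 \<and> (\<forall>c\<in>C. b * c \<in> Ainf)"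
  proof (induction C rule: finite_induct)
    case (insert x C)
    then obtain b where b: "b \<in> Ainf" "b \<noteq> 0" "\<forall>c\<in>C. b * c \<in> Ainf" by auto
    obtain a d where ad: "a \<in> Ainf" "d \<in> Ainf" "d \<noteq> 0" "x = a / d" using insert.prems K_iff by auto
    have "(b * d) * x \<in> Ainf" using ad b Ainf_mult by simp
    moreover have "(b * d) * c \<in> Ainf" if "c \<in> C" for c
      using Ainf_mult[OF ad(2), of "b * c"] b(3) that by (simp add: mult_ac)
    ultimately show ?case using b ad by (intro bexI[of _ "b * d"]) (auto intro: Ainf_mult)
  qed (auto intro: bexI[of _ 1])
  thus ?thesis using that by blast
qed

section \<open>Finite-dimensional algebras over \<open>K\<close>\<close>

definition kspan :: "'c set \<Rightarrow> 'c set" where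
  "kspan G = {\<Sum>g\<in>G. c g * g | c. \<forall>g\<in>G. c g \<in> K}"

lemma kspan_I: "(\<And>g. g \<in> G \<Longrightarrow> c g \<in> K) \<Longrightarrow> (\<Sum>g\<in>G. c g * g) \<in> kspan G"
  unfolding kspan_def by blast

lemma kspan_0: "0 \<in> kspan G"
  using kspan_I[of G "\<lambda>_. 0"] by simp

lemma kspan_add: "x \<in> kspan G \<Longrightarrow> y \<in> kspan G \<Longrightarrow> x + y \<in> kspan G"
  unfolding kspan_def
proof safe
  fix c c' assume "\<forall>g\<in>G. c g \<in> K" "\<forall>g\<in>G. c' g \<in> K"
  thus "\<exists>d. (\<Sum>g\<in>G. c g * g) + (\<Sum>g\<in>G. c' g * g) = (\<Sum>g\<in>G. d g * g) \<and> (\<forall>g\<in>G. d g \<in> K)"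
    by (intro exI[of _ "\<lambda>g. c g + c' g"]) (auto simp: distrib_right sum.distrib intro: K_add)
qed

lemma kspan_scale: "a \<in> K \<Longrightarrow> x \<in> kspan G \<Longrightarrow> a * x \<in> kspan G"
  unfolding kspan_def
proof safe
  fix c assume "a \<in> K" "\<forall>g\<in>G. c g \<in> K"
  thus "\<exists>d. a * (\<Sum>g\<in>G. c g * g) = (\<Sum>g\<in>G. d g * g) \<and> (\<forall>g\<in>G. d g \<in> K)"
    by (intro exI[of _ "\<lambda>g. a * c g"]) (auto simp: sum_distrib_left mult_ac intro: K_mult)
qed

lemma kspan_sum: "(\<And>i. i \<in> I \<Longrightarrow> f i \<in> kspan G) \<Longrightarrow> sum f I \<in> kspan G"
  by (induction I rule: infinite_finite_induct) (auto intro: kspan_add kspan_0)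

lemma kspan_base: "finite G \<Longrightarrow> g \<in> G \<Longrightarrow> g \<in> kspan G"
proof -
  assume g: "finite G" "g \<in> G"
  have "(\<Sum>h\<in>G. (if h = g then 1 else 0) * h) \<in> kspan G" by (intro kspan_I) auto
  also have "(\<Sum>h\<in>G. (if h = g then 1 else 0) * h) = (\<Sum>h\<in>G. if h = g then h else 0)"
    by (intro sum.cong) auto
  also have "\<dots> = g" using g by simp
  finally show ?thesis .
qed

lemma kspan_subset:
  assumes "\<And>g. g \<in> G \<Longrightarrow> g \<in> kspan H" "x \<in> kspan G" shows "x \<in> kspan H"
proof -
  obtain c where "x = (\<Sum>g\<in>G. c g * g)" "\<forall>g\<in>G. c g \<in> K" using assms(2) unfolding kspan_def by blast
  thus ?thesis using assms(1) by (auto intro!: kspan_sum kspan_scale)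
qed

lemma kspan_mult_left:
  assumes "\<And>g. g \<in> G \<Longrightarrow> y * g \<in> kspan H" "x \<in> kspan G" shows "y * x \<in> kspan H"
proof -
  obtain c where "x = (\<Sum>g\<in>G. c g * g)" "\<forall>g\<in>G. c g \<in> K" using assms(2) unfolding kspan_def by blast
  hence c: "y * x = (\<Sum>g\<in>G. c g * (y * g))" "\<forall>g\<in>G. c g \<in> K" by (auto simp: sum_distrib_left mult_ac)
  show ?thesis unfolding c(1) by (rule kspan_sum, rule kspan_scale) (use assms(1) c(2) in auto)
qed

text \<open>The span of \<open>G\<close> is then a finite-dimensional \<open>K\<close>-algebra
  containing \<open>Z\<close>.\<close>

definition kring :: "'c set \<Rightarrow> 'c set \<Rightarrow> bool" where
  "kring G Z \<longleftrightarrow> finite G \<and> 1 \<in> kspan G \<and> Z \<subseteq> kspan G \<and> (\<forall>g\<in>G. \<forall>h\<in>G. g * h \<in> kspan G)"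

text \<open>One element is adjoined at a time: if \<open>P\<close> of degree \<open>d\<close> kills
  \<open>x\<close>, the products \<open>g * x ^ i\<close> with \<open>i < d\<close> suffice, because
  \<open>P\<close> rewrites \<open>x ^ d\<close>.\<close>

lemma kring_exists:
  assumes "finite Z" "Z \<subseteq> Kbar q \<theta>"
  shows "\<exists>G. kring G Z"
  using assms
proof (induction Z rule: finite_induct)
  case empty
  have "kring {1} {}" unfolding kring_def using kspan_base[of "{1}" 1] by simp
  thus ?case by blast
next
  case (insert x Z)
  then obtain G where G: "finite G" "1 \<in> kspan G" "Z \<subseteq> kspan G" "\<forall>g\<in>G. \<forall>h\<in>G. g * h \<in> kspan G"
    unfolding kring_def by auto
  obtain P where P: "P \<noteq> 0" "\<forall>i. coeff P i \<in> K" "poly P x = 0"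
    using insert.prems unfolding Kbar_def algebraic_over_def by auto
  define d where "d = degree P"
  have lc: "coeff P d \<noteq> 0" using P(1) by (simp add: d_def)
  have d0: "d > 0"
  proof (rule ccontr)
    assume "\<not> d > 0"
    hence "d = 0" by simp
    then obtain a where "P = [:a:]" unfolding d_def by (elim degree_eq_zeroE)
    thus False using P by simp
  qed
  define G' where "G' = (\<lambda>(g, i). g * x ^ i) ` (G \<times> {..<d})"
  have fin: "finite G'" using G(1) by (simp add: G'_def)
  have up: "x ^ i * v \<in> kspan G'" if "v \<in> kspan G" "i < d" for v i
  proof (rule kspan_mult_left[OF _ that(1)])
    fix g assume "g \<in> G"
    thus "x ^ i * g \<in> kspan G'" using that(2) by (intro kspan_base fin) (auto simp: G'_def mult.commute)
  qed
  have "(\<Sum>i\<le>d. coeff P i * x ^ i) = 0" using P(3) by (simp add: poly_altdef d_def)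
  hence "coeff P d * x ^ d = - (\<Sum>i<d. coeff P i * x ^ i)"
    unfolding lessThan_Suc_atMost[symmetric] by (simp add: eq_neg_iff_add_eq_0 add.commute)
  hence xd: "x ^ d = (\<Sum>i<d. - (coeff P i / coeff P d) * x ^ i)"
    using lc by (simp add: field_simps sum_divide_distrib[symmetric] sum_negf)
  have mx: "x * v \<in> kspan G'" if v: "v \<in> kspan G'" for v
  proof (rule kspan_mult_left[OF _ v])
    fix h assume "h \<in> G'"
    then obtain g i where h: "g \<in> G" "i < d" "h = g * x ^ i" unfolding G'_def by auto
    show "x * h \<in> kspan G'"
    proof (cases "Suc i < d")
      case True
      thus ?thesis using up[of g "Suc i"] kspan_base[OF G(1) h(1)] h(3) by (simp add: mult_ac)
    next
      case False
      hence "Suc i = d" using h(2) by simp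
      hence "x * h = g * x ^ d" using h(3) by (auto simp: mult_ac)
      also have "\<dots> = (\<Sum>i<d. - (coeff P i / coeff P d) * (x ^ i * g))"
        unfolding xd by (simp add: sum_distrib_left mult_ac)
      also have "\<dots> \<in> kspan G'"
        using P(2) kspan_base[OF G(1) h(1)] by (intro kspan_sum kspan_scale up K_minus K_divide) auto
      finally show ?thesis .
    qed
  qed
  have mxn: "x ^ n * v \<in> kspan G'" if v: "v \<in> kspan G'" for n v
    by (induction n) (use v mx in \<open>auto simp: mult.assoc\<close>)
  have base: "v \<in> kspan G'" if "v \<in> kspan G" for v using up[OF that d0] by simp
  have "kring G' (insert x Z)" unfolding kring_def
  proof (intro conjI ballI)
    show "insert x Z \<subseteq> kspan G'" using G(3) base mx[OF base[OF G(2)]] by auto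
    fix h h' assume "h \<in> G'" "h' \<in> G'"
    then obtain g i g' i' where "g \<in> G" "h = g * x ^ i" "g' \<in> G" "h' = g' * x ^ i'" unfolding G'_def by auto
    thus "h * h' \<in> kspan G'" using mxn[OF base, of "g * g'" "i + i'"] G(4) by (simp add: power_add mult_ac)
  qed (use fin base G in auto)
  thus ?case by blast
qed

text \<open>A set of least cardinality is independent, since a relation would express one of its
  elements through the others.\<close>

lemma kring_basis:
  assumes "finite Z" "Z \<subseteq> Kbar q \<theta>"
  obtains G where "kring G Z" "\<And>a. (\<forall>g\<in>G. a g \<in> K) \<Longrightarrow> (\<Sum>g\<in>G. a g * g) = 0 \<Longrightarrow> \<forall>g\<in>G. a g = 0"
proof -
  obtain G where G: "kring G Z" and least: "\<And>H. kring H Z \<Longrightarrow> card G \<le> card H"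
    using kring_exists[OF assms] ex_has_least_nat[of "\<lambda>G. kring G Z" _ card] by blast
  have fin: "finite G" using G by (simp add: kring_def)
  have "\<forall>g\<in>G. a g = 0" if a: "\<forall>g\<in>G. a g \<in> K" "(\<Sum>g\<in>G. a g * g) = 0" for a
  proof (rule ccontr)
    assume "\<not> (\<forall>g\<in>G. a g = 0)"
    then obtain g0 where g0: "g0 \<in> G" "a g0 \<noteq> 0" by blast
    let ?H = "G - {g0}"
    have "a g0 * g0 = - (\<Sum>g\<in>?H. a g * g)"
      using a(2) sum.remove[OF fin g0(1), of "\<lambda>g. a g * g"] by (simp add: eq_neg_iff_add_eq_0)
    hence "g0 = (\<Sum>g\<in>?H. - (a g / a g0) * g)"
      using g0(2) by (simp add: field_simps sum_divide_distrib[symmetric] sum_negf)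
    also have "\<dots> \<in> kspan ?H" using a(1) g0 by (intro kspan_I K_minus K_divide) auto
    finally have g0s: "g0 \<in> kspan ?H" .
    have sub: "g \<in> kspan ?H" if "g \<in> G" for g
      using that g0s kspan_base[of ?H g] fin by (cases "g = g0") auto
    have "kring ?H Z" using G kspan_subset[OF sub] unfolding kring_def by auto
    hence "card G \<le> card ?H" by (rule least)
    thus False using card_Diff1_less[OF fin g0(1)] by linarith
  qed
  thus ?thesis using that G by blast
qed

text \<open>The index \<open>S\<close> plays the role of a logarithmic height.\<close>

definition OG :: "'c set \<Rightarrow> nat \<Rightarrow> 'c set" where
  "OG G S = {\<Sum>g\<in>G. a g * g | a. \<forall>g\<in>G. a g \<in> A S}"

lemma OG_I: "(\<And>g. g \<in> G \<Longrightarrow> a g \<in> A S) \<Longrightarrow> (\<Sum>g\<in>G. a g * g) \<in> OG G S"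
  unfolding OG_def by blast

lemma OG_E: "x \<in> OG G S \<Longrightarrow> (\<And>a. (\<And>g. g \<in> G \<Longrightarrow> a g \<in> A S) \<Longrightarrow> x = (\<Sum>g\<in>G. a g * g) \<Longrightarrow> P) \<Longrightarrow> P"
  unfolding OG_def by blast

lemma OG_0 [simp]: "0 \<in> OG G S" using OG_I[of G "\<lambda>_. 0"] by simp

lemma OG_mono: "x \<in> OG G S \<Longrightarrow> S \<le> T \<Longrightarrow> x \<in> OG G T"
  unfolding OG_def using A_mono by blast

lemma OG_add: "x \<in> OG G S \<Longrightarrow> y \<in> OG G S \<Longrightarrow> x + y \<in> OG G S"
  unfolding OG_def
proof safe
  fix c c' assume "\<forall>g\<in>G. c g \<in> A S" "\<forall>g\<in>G. c' g \<in> A S"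
  thus "\<exists>d. (\<Sum>g\<in>G. c g * g) + (\<Sum>g\<in>G. c' g * g) = (\<Sum>g\<in>G. d g * g) \<and> (\<forall>g\<in>G. d g \<in> A S)"
    by (intro exI[of _ "\<lambda>g. c g + c' g"]) (auto simp: distrib_right sum.distrib intro: A_add)
qed

lemma OG_scale: "a \<in> A S \<Longrightarrow> x \<in> OG G T \<Longrightarrow> a * x \<in> OG G (S + T)"
  unfolding OG_def
proof safe
  fix c assume "a \<in> A S" "\<forall>g\<in>G. c g \<in> A T"
  thus "\<exists>d. a * (\<Sum>g\<in>G. c g * g) = (\<Sum>g\<in>G. d g * g) \<and> (\<forall>g\<in>G. d g \<in> A (S + T))"
    by (intro exI[of _ "\<lambda>g. a * c g"]) (auto simp: sum_distrib_left mult_ac intro: A_mult)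
qed

lemma OG_minus: "x \<in> OG G S \<Longrightarrow> - x \<in> OG G S"
  using OG_scale[OF A_minus[OF A_1], of x G S 0] by simp

lemma OG_sum: "(\<And>i. i \<in> I \<Longrightarrow> f i \<in> OG G S) \<Longrightarrow> sum f I \<in> OG G S"
  by (induction I rule: infinite_finite_induct) (auto intro: OG_add)

text \<open>Scaling a basis by a common denominator \<delta> of its structure constants makes them
  integral, because the product of \<open>\<delta> * g\<close> and \<open>\<delta> * h\<close> has
  \<delta> times the old structure constants as coordinates in the scaled basis.\<close>

lemma integral_basis:
  assumes "finite Z" "Z \<subseteq> Kbar q \<theta>"
  obtains G c where "finite G" "G \<noteq> {}" "0 \<notin> G" "\<And>g h. g \<in> G \<Longrightarrow> h \<in> G \<Longrightarrow> g * h \<in> OG G c"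
    "\<And>a. (\<forall>g\<in>G. a g \<in> Ainf) \<Longrightarrow> (\<Sum>g\<in>G. a g * g) = 0 \<Longrightarrow> \<forall>g\<in>G. a g = 0"
    "\<And>z. z \<in> insert 1 Z \<Longrightarrow> \<exists>b\<in>Ainf. b \<noteq> 0 \<and> (\<exists>S. b * z \<in> OG G S)"
proof -
  obtain G where G: "kring G Z" and ind: "\<And>a. (\<forall>g\<in>G. a g \<in> K) \<Longrightarrow> (\<Sum>g\<in>G. a g * g) = 0 \<Longrightarrow> \<forall>g\<in>G. a g = 0"
    using kring_basis[OF assms] by blast
  have fin: "finite G" and mult: "\<And>g h. g \<in> G \<Longrightarrow> h \<in> G \<Longrightarrow> g * h \<in> kspan G"
    using G by (auto simp: kring_def)
  have "\<forall>gh\<in>G \<times> G. \<exists>c. (\<forall>k\<in>G. c k \<in> K) \<and> fst gh * snd gh = (\<Sum>k\<in>G. c k * k)"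
    using mult unfolding kspan_def by force
  from bchoice[OF this] obtain c where
    c': "\<forall>gh\<in>G \<times> G. (\<forall>k\<in>G. c gh k \<in> K) \<and> fst gh * snd gh = (\<Sum>k\<in>G. c gh k * k)" by blast
  have c: "\<And>g h k. g \<in> G \<Longrightarrow> h \<in> G \<Longrightarrow> k \<in> G \<Longrightarrow> c (g, h) k \<in> K"
    "\<And>g h. g \<in> G \<Longrightarrow> h \<in> G \<Longrightarrow> g * h = (\<Sum>k\<in>G. c (g, h) k * k)"
    using c' by force+
  define C where "C = (\<lambda>(gh, k). c gh k) ` ((G \<times> G) \<times> G)"
  have "finite C" "C \<subseteq> K" unfolding C_def using fin c(1) by auto
  then obtain \<delta> where \<delta>: "\<delta> \<in> Ainf" "\<delta> \<noteq> 0" "\<And>x. x \<in> C \<Longrightarrow> \<delta> * x \<in> Ainf"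
    using common_denominator by blast
  have "finite ((*) \<delta> ` C)" "(*) \<delta> ` C \<subseteq> Ainf" using \<open>finite C\<close> \<delta>(3) by auto
  then obtain S where S: "(*) \<delta> ` C \<subseteq> A S" using Ainf_finite_bound by blast
  define H where "H = (*) \<delta> ` G"
  have inj: "inj_on ((*) \<delta>) G" using \<delta>(2) by (auto simp: inj_on_def)
  have sumH: "(\<Sum>h\<in>H. f h) = (\<Sum>g\<in>G. f (\<delta> * g))" for f :: "'c \<Rightarrow> 'c"
    unfolding H_def using sum.reindex[OF inj, of f] by (simp add: o_def)
  have HI: "(\<Sum>g\<in>G. a g * (\<delta> * g)) \<in> OG H T" if "\<And>g. g \<in> G \<Longrightarrow> a g \<in> A T" for a T
  proof -
    have "(\<Sum>g\<in>G. a g * (\<delta> * g)) = (\<Sum>h\<in>H. a (h / \<delta>) * h)" unfolding sumH using \<delta>(2) by simp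
    thus ?thesis using that \<delta>(2) by (auto simp: H_def intro!: OG_I)
  qed
  have Hmult: "h * h' \<in> OG H S" if hh: "h \<in> H" "h' \<in> H" for h h'
  proof -
    obtain g g' where g: "g \<in> G" "g' \<in> G" "h = \<delta> * g" "h' = \<delta> * g'" using hh H_def by auto
    have "h * h' = \<delta> * \<delta> * (g * g')" using g by simp
    also have "\<dots> = (\<Sum>k\<in>G. (\<delta> * c (g, g') k) * (\<delta> * k))"
      unfolding c(2)[OF g(1,2)] by (simp add: sum_distrib_left mult_ac)
    also have "\<dots> \<in> OG H S"
    proof (rule HI)
      fix k assume "k \<in> G"
      hence "c (g, g') k \<in> C" unfolding C_def using g by force
      thus "\<delta> * c (g, g') k \<in> A S" using S by blast
    qed
    finally show ?thesis .
  qed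
  have Hind: "\<forall>h\<in>H. a h = 0" if a: "\<forall>h\<in>H. a h \<in> Ainf" "(\<Sum>h\<in>H. a h * h) = 0" for a
  proof -
    have "\<delta> * (\<Sum>g\<in>G. a (\<delta> * g) * g) = 0" using a(2) unfolding sumH by (simp add: sum_distrib_left mult_ac)
    hence "(\<Sum>g\<in>G. a (\<delta> * g) * g) = 0" using \<delta>(2) by simp
    moreover have "\<forall>g\<in>G. a (\<delta> * g) \<in> K" using a(1) by (auto simp: H_def intro: K_Ainf)
    ultimately show ?thesis using ind[of "\<lambda>g. a (\<delta> * g)"] by (auto simp: H_def)
  qed
  have "0 \<notin> H"
  proof
    assume 0: "0 \<in> H"
    have "\<forall>h\<in>H. (if h = 0 then 1 else (0::'c)) = 0" by (rule Hind) (auto intro!: sum.neutral)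
    from bspec[OF this 0] show False by simp
  qed
  moreover have "H \<noteq> {}"
  proof
    assume "H = {}"
    hence "G = {}" by (simp add: H_def)
    thus False using G unfolding kring_def kspan_def by auto
  qed
  moreover have "\<exists>b\<in>Ainf. b \<noteq> 0 \<and> (\<exists>S. b * z \<in> OG H S)" if z: "z \<in> insert 1 Z" for z
  proof -
    have "z \<in> kspan G" using z G by (auto simp: kring_def)
    then obtain d where d: "\<forall>g\<in>G. d g \<in> K" "z = (\<Sum>g\<in>G. d g * g)" unfolding kspan_def by blast
    have "finite (d ` G)" "d ` G \<subseteq> K" using fin d by auto
    then obtain b where b: "b \<in> Ainf" "b \<noteq> 0" "\<And>x. x \<in> d ` G \<Longrightarrow> b * x \<in> Ainf"
      using common_denominator by blast
    have "finite ((*) b ` d ` G)" "(*) b ` d ` G \<subseteq> Ainf" using fin b(3) by auto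
    then obtain T where T: "(*) b ` d ` G \<subseteq> A T" using Ainf_finite_bound by blast
    have "(b * \<delta>) * z = (\<Sum>g\<in>G. (b * d g) * (\<delta> * g))"
      unfolding d(2) by (simp add: sum_distrib_left mult_ac)
    also have "\<dots> \<in> OG H T" using T by (intro HI) auto
    finally show ?thesis using b(1,2) \<delta>(1,2) by (intro bexI[of _ "b * \<delta>"]) (auto intro: Ainf_mult)
  qed
  moreover have "finite H" using fin by (simp add: H_def)
  ultimately show ?thesis using that[of H S] Hmult Hind by blast
qed

end

section \<open>Counting and size estimates in an integral basis\<close>

locale frob_basis = frob_field +
  fixes G :: "'a set" and c0 :: nat
  assumes G_fin: "finite G" and G_ne: "G \<noteq> {}" and G_0: "0 \<notin> G"
    and G_mult: "\<And>g h. g \<in> G \<Longrightarrow> h \<in> G \<Longrightarrow> g * h \<in> OG G c0"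
    and G_ind: "\<And>a. (\<forall>g\<in>G. a g \<in> Ainf) \<Longrightarrow> (\<Sum>g\<in>G. a g * g) = 0 \<Longrightarrow> \<forall>g\<in>G. a g = 0"
begin

definition D :: nat where "D = card G"

lemma D_pos: "D > 0" using G_fin G_ne by (simp add: D_def card_gt_0_iff)

lemma OG_mult: "x \<in> OG G S \<Longrightarrow> y \<in> OG G T \<Longrightarrow> x * y \<in> OG G (S + T + c0)"
proof (elim OG_E)
  fix a b assume a: "\<And>g. g \<in> G \<Longrightarrow> a g \<in> A S" "x = (\<Sum>g\<in>G. a g * g)"
    and b: "\<And>g. g \<in> G \<Longrightarrow> b g \<in> A T" "y = (\<Sum>g\<in>G. b g * g)"
  have "x * y = (\<Sum>g\<in>G. \<Sum>h\<in>G. (a g * b h) * (g * h))"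
    unfolding a(2) b(2) sum_product by (simp add: mult_ac)
  thus "x * y \<in> OG G (S + T + c0)" using a b G_mult by (auto intro!: OG_sum OG_scale A_mult)
qed

lemma A_sub_Ainf: "x \<in> A S \<Longrightarrow> x \<in> Ainf" by (auto simp: Ainf_def)

lemma OG_coeffs: "bij_betw (\<lambda>a. \<Sum>g\<in>G. a g * g) (PiE G (\<lambda>_. A S)) (OG G S)"
  unfolding bij_betw_def
proof
  show "inj_on (\<lambda>a. \<Sum>g\<in>G. a g * g) (PiE G (\<lambda>_. A S))"
  proof (rule inj_onI)
    fix a b assume ab: "a \<in> PiE G (\<lambda>_. A S)" "b \<in> PiE G (\<lambda>_. A S)"
      and eq: "(\<Sum>g\<in>G. a g * g) = (\<Sum>g\<in>G. b g * g)"
    have "(\<Sum>g\<in>G. (a g - b g) * g) = 0" using eq by (simp add: left_diff_distrib sum_subtractf)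
    moreover have "\<forall>g\<in>G. a g - b g \<in> Ainf" using ab A_diff A_sub_Ainf by (metis PiE_mem)
    ultimately have "\<forall>g\<in>G. a g - b g = 0" using G_ind[of "\<lambda>g. a g - b g"] by blast
    thus "a = b" by (intro PiE_ext[OF ab]) auto
  qed
  show "(\<lambda>a. \<Sum>g\<in>G. a g * g) ` (PiE G (\<lambda>_. A S)) = OG G S"
  proof (intro equalityI subsetI)
    fix x assume "x \<in> OG G S"
    then obtain a where a: "\<And>g. g \<in> G \<Longrightarrow> a g \<in> A S" "x = (\<Sum>g\<in>G. a g * g)" by (elim OG_E) blast
    hence "x = (\<Sum>g\<in>G. restrict a G g * g)" "restrict a G \<in> PiE G (\<lambda>_. A S)" by auto
    thus "x \<in> (\<lambda>a. \<Sum>g\<in>G. a g * g) ` (PiE G (\<lambda>_. A S))" by blast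
  qed (auto intro!: OG_I)
qed

lemma OG_finite: "finite (OG G S)"
  using bij_betw_finite[OF OG_coeffs[of S]] finite_PiE[OF G_fin, of "\<lambda>_. A S"] A_finite by simp

lemma OG_card: "card (OG G S) = \<kappa> ^ (D * (S + 1))"
proof -
  have "card (OG G S) = card (PiE G (\<lambda>_. A S))" using bij_betw_same_card[OF OG_coeffs[of S]] by simp
  also have "\<dots> = (\<kappa> ^ (S + 1)) ^ D" by (simp only: card_PiE[OF G_fin] A_card prod_constant D_def)
  finally show ?thesis by (simp only: power_mult[symmetric] mult.commute)
qed

lemma OG_le: obtains C where "C \<ge> 1" "\<And>x S. x \<in> OG G S \<Longrightarrow> av x \<le> C * av \<theta> ^ S"
proof -
  define C where "C = Max (insert 1 (av ` G))"
  have C1: "C \<ge> 1" and Cg: "\<And>g. g \<in> G \<Longrightarrow> av g \<le> C" using G_fin by (auto simp: C_def)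
  have "av x \<le> C * av \<theta> ^ S" if x: "x \<in> OG G S" for x S
  proof -
    obtain a where a: "\<And>g. g \<in> G \<Longrightarrow> a g \<in> A S" "x = (\<Sum>g\<in>G. a g * g)" using x by (elim OG_E) blast
    show ?thesis unfolding a(2)
    proof (rule av_sum_le)
      fix g assume g: "g \<in> G"
      have "av (a g) * av g \<le> av \<theta> ^ S * C" using A_le[OF a(1)[OF g]] Cg[OF g] by (intro mult_mono) auto
      thus "av (a g * g) \<le> C * av \<theta> ^ S" by (simp add: av_mult mult.commute)
    qed (use C1 in auto)
  qed
  thus ?thesis using that C1 by blast
qed

text \<open>By pigeonhole some nonzero multiple of \<open>x\<close> lies in \<open>A g\<close> for a basis element \<open>g\<close>,
  which replaces the norm in the usual Liouville argument.\<close>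
lemma OG_liouville:
  obtains C where "C > 0" "\<And>x S. x \<in> OG G S \<Longrightarrow> x \<noteq> 0 \<Longrightarrow> C / av \<theta> ^ (D * (S + c0)) \<le> av x"
proof -
  obtain B where B: "B \<ge> 1" "\<And>x S. x \<in> OG G S \<Longrightarrow> av x \<le> B * av \<theta> ^ S" using OG_le by blast
  obtain g0 where g0: "g0 \<in> G" using G_ne by blast
  have g00: "g0 \<noteq> 0" using g0 G_0 by auto
  have "av g0 / B / av \<theta> ^ (D * (S + c0)) \<le> av x" if x: "x \<in> OG G S" "x \<noteq> 0" for x S
  proof -
    \<comment> \<open>This choice gives \<open>(D - 1) * (R + 1) < D * (T + 1)\<close>, where
      \<open>R\<close> is the size of the products \<open>x * y\<close>.\<close>
    define T where "T = D * (S + c0)"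
    define R where "R = T + (S + c0)"
    let ?f = "\<lambda>a. \<Sum>g\<in>G. a g * g"
    define co where "co = inv_into (PiE G (\<lambda>_. A R)) ?f"
    have prod: "x * y \<in> OG G R" if "y \<in> OG G T" for y
      using OG_mult[OF x(1) that] by (simp add: R_def add_ac)
    have co: "co z \<in> PiE G (\<lambda>_. A R)" "(\<Sum>g\<in>G. co z g * g) = z" if "z \<in> OG G R" for z
    proof -
      have "?f ` (PiE G (\<lambda>_. A R)) = OG G R" using OG_coeffs[of R] by (simp add: bij_betw_def)
      hence z: "z \<in> ?f ` (PiE G (\<lambda>_. A R))" using that by simp
      show "co z \<in> PiE G (\<lambda>_. A R)" unfolding co_def by (rule inv_into_into[OF z])
      show "(\<Sum>g\<in>G. co z g * g) = z" unfolding co_def by (rule f_inv_into_f[OF z])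
    qed
    \<comment> \<open>Forgets the coordinate at \<open>g0\<close>: two \<open>y\<close> with equal
      images differ by some \<open>w\<close> for which \<open>x * w\<close> is a multiple of
      \<open>g0\<close>.\<close>
    define \<phi> where "\<phi> = (\<lambda>y. restrict (co (x * y)) (G - {g0}))"
    have sub: "\<phi> ` OG G T \<subseteq> PiE (G - {g0}) (\<lambda>_. A R)"
      proof (rule image_subsetI)
      fix y assume "y \<in> OG G T"
      from PiE_mem[OF co(1)[OF prod[OF this]]] show "\<phi> y \<in> PiE (G - {g0}) (\<lambda>_. A R)"
        unfolding \<phi>_def restrict_PiE_iff by blast
    qed
    have "card (\<phi> ` OG G T) \<le> card (PiE (G - {g0}) (\<lambda>_. A R))"
      using G_fin A_finite by (intro card_mono sub finite_PiE) auto
    also have "\<dots> = \<kappa> ^ ((D - 1) * (R + 1))"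
    proof -
      have "card (PiE (G - {g0}) (\<lambda>_. A R)) = (\<kappa> ^ (R + 1)) ^ card (G - {g0})"
        using G_fin by (simp only: card_PiE[OF finite_Diff] A_card prod_constant)
      also have "card (G - {g0}) = D - 1" using G_fin g0 by (simp add: D_def)
      finally show ?thesis by (simp only: power_mult[symmetric] mult.commute)
    qed
    also have "\<dots> < \<kappa> ^ (D * (T + 1))"
    proof (rule power_strict_increasing)
      obtain d where d: "D = Suc d" using D_pos gr0_conv_Suc by blast
      show "(D - 1) * (R + 1) < D * (T + 1)" unfolding R_def T_def d by (simp add: algebra_simps)
    qed (use \<kappa>_ge_2 in auto)
    also have "\<dots> = card (OG G T)" by (simp add: OG_card)
    finally have "\<not> inj_on \<phi> (OG G T)" by (metis card_image less_irrefl)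
    then obtain y y' where y: "y \<in> OG G T" "y' \<in> OG G T" "y \<noteq> y'" "\<phi> y = \<phi> y'"
      unfolding inj_on_def by blast
    define w where "w = y - y'"
    have w: "w \<in> OG G T" "w \<noteq> 0" using y OG_add[OF y(1) OG_minus[OF y(2)]] by (auto simp: w_def)
    have "x * w = (\<Sum>g\<in>G. (co (x * y) g - co (x * y') g) * g)"
      unfolding w_def using co(2)[OF prod[OF y(1)]] co(2)[OF prod[OF y(2)]]
      by (simp add: left_diff_distrib right_diff_distrib sum_subtractf)
    also have "\<dots> = (\<Sum>g\<in>{g0}. (co (x * y) g - co (x * y') g) * g)"
    proof (rule sum.mono_neutral_right[OF G_fin])
      show "\<forall>g\<in>G - {g0}. (co (x * y) g - co (x * y') g) * g = 0"
      proof
        fix g assume "g \<in> G - {g0}"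
        hence "co (x * y) g = co (x * y') g"
          using fun_cong[OF y(4)[unfolded \<phi>_def], of g] by simp
        thus "(co (x * y) g - co (x * y') g) * g = 0" by simp
      qed
    qed (use g0 in auto)
    finally have xw: "x * w = (co (x * y) g0 - co (x * y') g0) * g0" by simp
    have "co (x * y) g0 - co (x * y') g0 \<in> A R"
      using co(1)[OF prod[OF y(1)]] co(1)[OF prod[OF y(2)]] g0 by (auto intro!: A_diff)
    moreover have "co (x * y) g0 - co (x * y') g0 \<noteq> 0" using xw x(2) w(2) by auto
    ultimately have "1 \<le> av (co (x * y) g0 - co (x * y') g0)" by (rule A_ge_1)
    hence "1 * av g0 \<le> av (x * w)" unfolding xw av_mult by (intro mult_right_mono) auto
    also have "\<dots> \<le> av x * (B * av \<theta> ^ T)" unfolding av_mult using B(2)[OF w(1)] by (intro mult_left_mono) auto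
    finally show ?thesis using B(1) \<theta>(2) by (simp add: T_def field_simps)
  qed
  moreover have "av g0 / B > 0" using B(1) av_pos[OF g00] by simp
  ultimately show ?thesis using that by blast
qed

text \<open>The shift by \<open>c0\<close> makes sizes additive under multiplication: \<open>W S * W T \<subseteq> W (S + T)\<close>.\<close>
definition W :: "nat \<Rightarrow> 'a set" where
  "W S = (if c0 \<le> S then OG G (S - c0) else {0})"

lemma W_0 [simp]: "0 \<in> W S" by (simp add: W_def)

lemma W_mono: "x \<in> W S \<Longrightarrow> S \<le> T \<Longrightarrow> x \<in> W T"
  unfolding W_def by (auto split: if_splits intro: OG_mono)

lemma W_add: "x \<in> W S \<Longrightarrow> y \<in> W S \<Longrightarrow> x + y \<in> W S"
  unfolding W_def by (auto split: if_splits intro: OG_add)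

lemma W_minus: "x \<in> W S \<Longrightarrow> - x \<in> W S"
  unfolding W_def by (auto split: if_splits intro: OG_minus)

lemma W_diff: "x \<in> W S \<Longrightarrow> y \<in> W S \<Longrightarrow> x - y \<in> W S"
  using W_add[of x S "-y"] W_minus by simp

lemma W_sum: "(\<And>i. i \<in> I \<Longrightarrow> f i \<in> W S) \<Longrightarrow> sum f I \<in> W S"
  by (induction I rule: infinite_finite_induct) (auto intro: W_add)

lemma W_mult: "x \<in> W S \<Longrightarrow> y \<in> W T \<Longrightarrow> x * y \<in> W (S + T)"
proof -
  assume a: "x \<in> W S" "y \<in> W T"
  show ?thesis
  proof (cases "c0 \<le> S \<and> c0 \<le> T")
    case True
    hence "x * y \<in> OG G ((S - c0) + (T - c0) + c0)" using a by (intro OG_mult) (auto simp: W_def)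
    also have "(S - c0) + (T - c0) + c0 = S + T - c0" using True by simp
    finally show ?thesis using True by (simp add: W_def)
  next
    case False
    hence "x * y = 0" using a by (auto simp: W_def split: if_splits)
    thus ?thesis by (simp only: W_0)
  qed
qed

text \<open>Restricted to positive exponents because \<open>1\<close> need not lie in
  \<open>W 0\<close>.\<close>

lemma W_power: "x \<in> W S \<Longrightarrow> k > 0 \<Longrightarrow> x ^ k \<in> W (k * S)"
proof (induction k)
  case (Suc k)
  thus ?case using W_mult[of x S "x ^ k" "k * S"] by (cases "k = 0") auto
qed simp

lemma W_theta: "x \<in> W S \<Longrightarrow> x * \<theta> ^ k \<in> W (S + k)"
proof -
  assume a: "x \<in> W S"
  show ?thesis
  proof (cases "c0 \<le> S")
    case True
    have "\<theta> ^ k \<in> A k" using A_theta[of 1 0 k] by simp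
    hence "\<theta> ^ k * x \<in> OG G (k + (S - c0))" using a True by (intro OG_scale) (auto simp: W_def)
    thus ?thesis using True by (simp add: W_def mult.commute add.commute)
  qed (use a in \<open>auto simp: W_def\<close>)
qed

lemma W_finite: "finite (W S)"
  using OG_finite by (simp add: W_def)

text \<open>For \<open>S < c0\<close> the truncated difference is zero, in agreement with
  \<open>W S = {0}\<close>.\<close>

lemma W_card: "card (W S) = \<kappa> ^ (D * (S + 1 - c0))"
  using OG_card by (simp add: W_def Suc_diff_le)

lemma W_le: obtains C where "C \<ge> 1" "\<And>x S. x \<in> W S \<Longrightarrow> av x \<le> C * av \<theta> ^ S"
proof -
  obtain C where C: "C \<ge> 1" "\<And>x S. x \<in> OG G S \<Longrightarrow> av x \<le> C * av \<theta> ^ S" using OG_le by blast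
  have "av x \<le> C * av \<theta> ^ S" if "x \<in> W S" for x S
  proof (cases "c0 \<le> S")
    case True
    hence "av x \<le> C * av \<theta> ^ (S - c0)" using that C(2) by (auto simp: W_def)
    also have "\<dots> \<le> C * av \<theta> ^ S" using C(1) \<theta>(2) by (intro mult_left_mono power_increasing) auto
    finally show ?thesis .
  qed (use that C(1) in \<open>auto simp: W_def\<close>)
  thus ?thesis using that C(1) by blast
qed

lemma W_liouville:
  obtains C where "C > 0" "\<And>x S. x \<in> W S \<Longrightarrow> x \<noteq> 0 \<Longrightarrow> C / av \<theta> ^ (D * S) \<le> av x"
proof -
  obtain C where C: "C > 0" "\<And>x S. x \<in> OG G S \<Longrightarrow> x \<noteq> 0 \<Longrightarrow> C / av \<theta> ^ (D * (S + c0)) \<le> av x"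
    using OG_liouville by blast
  have "C / av \<theta> ^ (D * S) \<le> av x" if "x \<in> W S" "x \<noteq> 0" for x S
  proof (cases "c0 \<le> S")
    case True
    hence "x \<in> OG G (S - c0)" using that by (simp add: W_def)
    thus ?thesis using C(2)[of x "S - c0"] that True by simp
  qed (use that in \<open>auto simp: W_def\<close>)
  thus ?thesis using that C(1) by blast
qed

end

section \<open>Lifting relations between values to relations between functions\<close>

lemma pigeonhole_collision:
  assumes "finite Y" "\<phi> ` X \<subseteq> Y" "card Y < card X"
  obtains x y where "x \<in> X" "y \<in> X" "x \<noteq> y" "\<phi> x = \<phi> y"
proof -
  have "card (\<phi> ` X) < card X" using card_mono[OF assms(1,2)] assms(3) by simp
  hence "\<not> inj_on \<phi> X" by (metis card_image less_irrefl)
  thus ?thesis using that unfolding inj_on_def by blast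
qed

lemma geometric_sum_le: "2 \<le> q \<Longrightarrow> (\<Sum>j<N. q ^ j) \<le> (q :: nat) ^ N"
proof (induction N)
  case (Suc N)
  hence "(\<Sum>j<Suc N. q ^ j) \<le> 2 * q ^ N" by simp
  also have "\<dots> \<le> q ^ Suc N" using Suc.prems by simp
  finally show ?case .
qed simp

context frob_basis
begin

section \<open>Polynomials of bounded degree with coefficients of bounded size\<close>

definition PW :: "nat \<Rightarrow> nat \<Rightarrow> 'a poly set" where
  "PW S n = {P. (\<forall>k. coeff P k \<in> W S) \<and> (\<forall>k\<ge>n. coeff P k = 0)}"

lemma PW_mono: "P \<in> PW S n \<Longrightarrow> S \<le> S' \<Longrightarrow> n \<le> n' \<Longrightarrow> P \<in> PW S' n'"
  by (auto simp: PW_def intro: W_mono)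

lemma PW_0 [simp]: "0 \<in> PW S n" by (simp add: PW_def)

lemma PW_add: "P \<in> PW S n \<Longrightarrow> Q \<in> PW S n \<Longrightarrow> P + Q \<in> PW S n"
  by (auto simp: PW_def intro: W_add)

lemma PW_diff: "P \<in> PW S n \<Longrightarrow> Q \<in> PW S n \<Longrightarrow> P - Q \<in> PW S n"
  by (auto simp: PW_def intro: W_diff)

lemma PW_sum: "(\<And>i. i \<in> I \<Longrightarrow> f i \<in> PW S n) \<Longrightarrow> sum f I \<in> PW S n"
  by (induction I rule: infinite_finite_induct) (auto intro: PW_add)

lemma PW_mult: "P \<in> PW S n \<Longrightarrow> Q \<in> PW T m \<Longrightarrow> P * Q \<in> PW (S + T) (n + m)"
  unfolding PW_def
proof safe
  fix k assume a: "\<forall>k. coeff P k \<in> W S" "\<forall>k\<ge>n. coeff P k = 0" "\<forall>k. coeff Q k \<in> W T" "\<forall>k\<ge>m. coeff Q k = 0"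
  show "coeff (P * Q) k \<in> W (S + T)" unfolding coeff_mult using a by (intro W_sum W_mult) auto
  assume k: "n + m \<le> k"
  have "coeff P i * coeff Q (k - i) = 0" for i using a k by (cases "i < n") auto
  thus "coeff (P * Q) k = 0" unfolding coeff_mult by (intro sum.neutral) simp
qed

lemma PW_twp: "P \<in> PW S n \<Longrightarrow> twp (q ^ k) P \<in> PW (q ^ k * S) n"
  unfolding PW_def by (auto simp: coeff_twp intro: W_power)

lemma poly_eq_sum: "(\<forall>k\<ge>n. coeff P k = 0) \<Longrightarrow> poly P x = (\<Sum>k<n. coeff P k * (x::'a) ^ k)"
proof -
  assume a: "\<forall>k\<ge>n. coeff P k = 0"
  have "(\<Sum>k\<le>degree P. coeff P k * x ^ k) = (\<Sum>k<n. coeff P k * x ^ k)"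
  proof (cases "P = 0")
    case False
    hence "degree P < n" using a by (metis leading_coeff_0_iff not_le)
    thus ?thesis by (intro sum.mono_neutral_left) (auto simp: coeff_eq_0)
  qed auto
  thus ?thesis by (simp add: poly_altdef)
qed

text \<open>At a power of \<theta>, evaluation only raises degrees in \<theta>: the term of degree
  \<open>k < n\<close> gains \<open>j * k\<close>.\<close>

lemma PW_eval: "P \<in> PW S n \<Longrightarrow> poly P (\<theta> ^ j) \<in> W (S + j * n)"
proof -
  assume P: "P \<in> PW S n"
  have "coeff P k * (\<theta> ^ j) ^ k \<in> W (S + j * n)" if "k < n" for k
  proof -
    have "coeff P k * \<theta> ^ (j * k) \<in> W (S + j * k)" using P by (intro W_theta) (auto simp: PW_def)
    thus ?thesis using that by (auto simp: power_mult intro: W_mono)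
  qed
  thus ?thesis using P poly_eq_sum[of n P] by (auto simp: PW_def intro!: W_sum)
qed

lemma PW_coeffs: "bij_betw (\<lambda>P. restrict (coeff P) {..<n}) (PW S n) (PiE {..<n} (\<lambda>_. W S))"
  unfolding bij_betw_def
proof
  show "inj_on (\<lambda>P. restrict (coeff P) {..<n}) (PW S n)"
  proof (rule inj_onI, rule poly_eqI)
    fix P Q k assume *: "P \<in> PW S n" "Q \<in> PW S n" "restrict (coeff P) {..<n} = restrict (coeff Q) {..<n}"
    show "coeff P k = coeff Q k"
    proof (cases "k < n")
      case True
      thus ?thesis using fun_cong[OF *(3), of k] by (simp only: restrict_apply lessThan_iff if_True)
    qed (use * in \<open>auto simp: PW_def\<close>)
  qed
  show "(\<lambda>P. restrict (coeff P) {..<n}) ` PW S n = PiE {..<n} (\<lambda>_. W S)"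
  proof (intro equalityI subsetI)
    fix c assume c: "c \<in> PiE {..<n} (\<lambda>_. W S)"
    define P where "P = (\<Sum>i<n. monom (c i) i)"
    have co: "coeff P k = (if k < n then c k else 0)" for k
      by (simp add: P_def coeff_sum)
    have "P \<in> PW S n" using c by (auto simp: PW_def co)
    moreover have "restrict (coeff P) {..<n} = c" using c by (auto simp: co fun_eq_iff PiE_def extensional_def)
    ultimately show "c \<in> (\<lambda>P. restrict (coeff P) {..<n}) ` PW S n" by blast
  next
    fix c assume "c \<in> (\<lambda>P. restrict (coeff P) {..<n}) ` PW S n"
    then obtain P where "P \<in> PW S n" "c = restrict (coeff P) {..<n}" by blast
    thus "c \<in> PiE {..<n} (\<lambda>_. W S)" by (simp add: PW_def restrict_PiE_iff)
  qed
qed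

lemma PW_finite: "finite (PW S n)"
  using bij_betw_finite[OF PW_coeffs[of n S]] finite_PiE[of "{..<n}" "\<lambda>_. W S"] W_finite by simp

lemma PW_card: "card (PW S n) = \<kappa> ^ (D * (S + 1 - c0) * n)"
  using bij_betw_same_card[OF PW_coeffs[of n S]]
  by (simp add: card_PiE W_card power_mult)

end

text \<open>A linear Frobenius system with cleared denominator \<open>a\<close>, together with a
  linear relation \<rho> between the values \<open>v\<close> at \<theta>. The single constant
  \<open>s0\<close> bounds the size of \<open>a\<close>, \<open>B\<close> and \<rho>.\<close>

locale frob_system = frob_basis +
  fixes J :: "'j set" and \<psi> :: "'j \<Rightarrow> 'a fps" and B :: "'j \<Rightarrow> 'j \<Rightarrow> 'a poly"
    and a :: 'a and \<rho> v :: "'j \<Rightarrow> 'a" and m0 :: 'j and s0 \<delta> :: nat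
  assumes J_fin: "finite J" and m0: "m0 \<in> J" "\<rho> m0 \<noteq> 0"
    and \<psi>: "\<And>m. m \<in> J \<Longrightarrow> fbd rad (\<psi> m)"
    and fe: "\<And>m. m \<in> J \<Longrightarrow> fps_const a * tw q (\<psi> m) = (\<Sum>m'\<in>J. fps_of_poly (B m m') * \<psi> m')"
    and a: "a \<in> W s0" "a \<noteq> 0"
    and B: "\<And>m m'. m \<in> J \<Longrightarrow> m' \<in> J \<Longrightarrow> B m m' \<in> PW s0 \<delta>"
    and v: "\<And>m. m \<in> J \<Longrightarrow> has_val rad (\<psi> m) \<theta> (v m)"
    and \<rho>: "\<And>m. m \<in> J \<Longrightarrow> \<rho> m \<in> W s0" "(\<Sum>m\<in>J. \<rho> m * v m) = 0"
begin

definition l :: nat where "l = card J"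

lemma l_pos: "l > 0" using J_fin m0 by (auto simp: l_def card_gt_0_iff)

text \<open>\<open>iter_mat i\<close> and \<open>iter_den i\<close> describe the iterate of order \<open>i + 1\<close> of the system.\<close>
fun iter_den :: "nat \<Rightarrow> 'a" where
  "iter_den 0 = a"
| "iter_den (Suc i) = a * iter_den i ^ q"

fun iter_mat :: "nat \<Rightarrow> 'j \<Rightarrow> 'j \<Rightarrow> 'a poly" where
  "iter_mat 0 m m' = B m m'"
| "iter_mat (Suc i) m m' = (\<Sum>k\<in>J. twp q (iter_mat i m k) * B k m')"

lemma iter_den_nz: "iter_den i \<noteq> 0"
  by (induction i) (auto simp: a)

lemma iterate: "m \<in> J \<Longrightarrow> fps_const (iter_den i) * tw (q ^ Suc i) (\<psi> m) = (\<Sum>m'\<in>J. fps_of_poly (iter_mat i m m') * \<psi> m')"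
proof (induction i)
  case 0
  thus ?case using fe by simp
next
  case (Suc i)
  have "fps_const (iter_den (Suc i)) * tw (q ^ Suc (Suc i)) (\<psi> m)
      = fps_const a * tw q (fps_const (iter_den i) * tw (q ^ Suc i) (\<psi> m))"
    unfolding tw_mult[OF frobexp_q] tw_const[OF frobexp_q] tw_tw power_Suc2[of q "Suc i"] iter_den.simps
    by (simp only: fps_const_mult[symmetric] mult.assoc)
  also have "\<dots> = (\<Sum>k\<in>J. fps_of_poly (twp q (iter_mat i m k)) * (fps_const a * tw q (\<psi> k)))"
    unfolding Suc.IH[OF Suc.prems] tw_sum[OF frobexp_q] tw_mult[OF frobexp_q] tw_poly[OF frobexp_q]
    by (simp add: sum_distrib_left mult_ac)
  also have "\<dots> = (\<Sum>k\<in>J. \<Sum>m'\<in>J. fps_of_poly (twp q (iter_mat i m k) * B k m') * \<psi> m')"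
    by (intro sum.cong refl) (simp add: fe sum_distrib_left fps_of_poly_mult mult.assoc)
  also have "\<dots> = (\<Sum>m'\<in>J. fps_of_poly (iter_mat (Suc i) m m') * \<psi> m')"
    by (subst sum.swap) (simp add: fps_of_poly_sum sum_distrib_right)
  finally show ?case .
qed

lemma geometric_bound: "(\<Sum>k\<le>i. q ^ k) \<le> q ^ Suc i"
  using geometric_sum_le[OF q_ge_2, of "Suc i"] by (simp only: lessThan_Suc_atMost)

lemma geometric_Suc: "(\<Sum>k\<le>Suc i. q ^ k) = q * (\<Sum>k\<le>i. q ^ k) + 1"
  by (simp only: sum.atMost_Suc_shift power_Suc sum_distrib_left[symmetric]) simp

text \<open>The size obeys the recursion \<open>s \<mapsto> s0 + q * s\<close>, whose solution is
  \<open>s0\<close> times a geometric sum.\<close>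

lemma iter_den_W: "iter_den i \<in> W (s0 * q ^ Suc i)"
proof -
  have "iter_den i \<in> W (s0 * (\<Sum>k\<le>i. q ^ k))"
  proof (induction i)
    case (Suc i)
    have "a * iter_den i ^ q \<in> W (s0 + q * (s0 * (\<Sum>k\<le>i. q ^ k)))" by (intro W_mult W_power a Suc) simp
    moreover have "s0 + q * (s0 * (\<Sum>k\<le>i. q ^ k)) = s0 * (\<Sum>k\<le>Suc i. q ^ k)"
      unfolding geometric_Suc by (simp add: algebra_simps)
    ultimately show ?case by (simp only: iter_den.simps)
  qed (use a in auto)
  thus ?thesis by (rule W_mono) (use geometric_bound in simp)
qed

lemma iter_mat_PW: "m \<in> J \<Longrightarrow> m' \<in> J \<Longrightarrow> iter_mat i m m' \<in> PW (s0 * q ^ Suc i) (\<delta> * Suc i)"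
proof -
  have "m \<in> J \<Longrightarrow> m' \<in> J \<Longrightarrow> iter_mat i m m' \<in> PW (s0 * (\<Sum>k\<le>i. q ^ k)) (\<delta> * Suc i)" for m'
  proof (induction i arbitrary: m')
    case (Suc i)
    have "iter_mat (Suc i) m m' \<in> PW (q * (s0 * (\<Sum>k\<le>i. q ^ k)) + s0) (\<delta> * Suc i + \<delta>)"
      unfolding iter_mat.simps using PW_twp[OF Suc.IH[OF Suc.prems(1)], of _ 1] B Suc.prems
      by (intro PW_sum PW_mult) auto
    moreover have "q * (s0 * (\<Sum>k\<le>i. q ^ k)) + s0 = s0 * (\<Sum>k\<le>Suc i. q ^ k)"
      unfolding geometric_Suc by (simp add: algebra_simps)
    moreover have "\<delta> * Suc i + \<delta> = \<delta> * Suc (Suc i)" by simp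
    ultimately show ?case by (simp only:)
  qed (use B in auto)
  thus "m \<in> J \<Longrightarrow> m' \<in> J \<Longrightarrow> ?thesis" by (rule PW_mono) (use geometric_bound in simp_all)
qed

text \<open>Size of a vanishing condition beyond that of the unknowns, in units of
  \<open>q ^ N\<close>: \<open>s0 + \<delta>\<close> from the iterated matrix and \<open>s0\<close>
  from the powers of \<rho>.\<close>

definition s1 :: nat where "s1 = 2 * s0 + \<delta>"
text \<open>Chosen so that \<open>aux_size * q ^ N + 1 - c0\<close> exceeds
  \<open>2 * l * (s1 + 1) * q ^ N\<close>, which pays for the error terms in the count.\<close>

definition aux_size :: nat where "aux_size = 2 * l * (s1 + 1) + c0 + 1"

text \<open>Vanishing at \<open>N\<close> points costs \<open>(l - 1) * N\<close> conditions, as the coefficient vectors only need to be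
  proportional to \<open>\<rho>\<close>. So degree \<open>n < N\<close> is enough, and the gain \<open>N - n = \<nu>\<close> drives the Schwarz estimate.\<close>
lemma auxiliary_form_count:
  assumes "\<nu> > 0" "N = 2 * l * \<nu>" "n = (2 * l - 1) * \<nu>"
  shows "(l - 1) * (\<Sum>j<N. aux_size * q ^ N + q ^ j * n + s1 * q ^ N + 1 - c0) < l * n * (aux_size * q ^ N + 1 - c0)"
proof -
  define X where "X = aux_size * q ^ N + 1 - c0"
  have qN: "q ^ N \<ge> 1" by simp
  have "c0 * 1 \<le> c0 * q ^ N" using qN by (intro mult_le_mono) auto
  moreover have "aux_size * q ^ N = 2 * l * (s1 + 1) * q ^ N + c0 * q ^ N + q ^ N"
    unfolding aux_size_def by (simp only: distrib_right mult_1)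
  ultimately have c: "c0 \<le> aux_size * q ^ N" and X: "X > 2 * l * (s1 + 1) * q ^ N"
    using qN unfolding X_def by linarith+
  have "(\<Sum>j<N. aux_size * q ^ N + q ^ j * n + s1 * q ^ N + 1 - c0) = (\<Sum>j<N. (X + s1 * q ^ N) + q ^ j * n)"
    using c by (intro sum.cong) (auto simp: X_def)
  also have "\<dots> = N * (X + s1 * q ^ N) + (\<Sum>j<N. q ^ j) * n" by (simp add: sum.distrib sum_distrib_right)
  also have "\<dots> \<le> N * (X + s1 * q ^ N) + q ^ N * n"
    using geometric_sum_le[OF q_ge_2, of N] by (intro add_left_mono mult_right_mono) auto
  finally have *: "(l - 1) * (\<Sum>j<N. aux_size * q ^ N + q ^ j * n + s1 * q ^ N + 1 - c0) \<le> (l - 1) * (N * (X + s1 * q ^ N) + q ^ N * n)"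
    by (intro mult_left_mono) auto
  obtain k where k: "l = Suc k" using l_pos gr0_conv_Suc by blast
  have "(l - 1) * (N * (X + s1 * q ^ N) + q ^ N * n) < l * n * X"
  proof -
    have n: "n = (2 * k + 1) * \<nu>" and N: "N = 2 * (k + 1) * \<nu>" using assms k by auto
    have "k * n \<le> (k + 1) * (2 * (k + 1) * \<nu>)" unfolding n by (intro mult_mono) auto
    moreover have "k * (N * s1) \<le> (k + 1) * (2 * (k + 1) * \<nu> * s1)" unfolding N by (intro mult_mono) auto
    ultimately have "(k * (N * s1) + k * n) * q ^ N \<le> ((k + 1) * (2 * (k + 1) * \<nu> * s1) + (k + 1) * (2 * (k + 1) * \<nu>)) * q ^ N"
      by (intro mult_right_mono add_mono) auto
    also have "\<dots> = (k + 1) * \<nu> * (2 * l * (s1 + 1) * q ^ N)" unfolding k by (simp add: algebra_simps)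
    also have "\<dots> < (k + 1) * \<nu> * X" using X assms(1) by simp
    finally have 1: "k * (N * s1) * q ^ N + k * n * q ^ N < (k + 1) * \<nu> * X" by (simp add: algebra_simps)
    \<comment> \<open>The main terms leave the surplus
      \<open>l * n - (l - 1) * N = l * \<nu>\<close> in favour of the unknowns; it has to beat the
      error terms bounded in \<open>1\<close>.\<close>
    have 2: "l * n * X = k * N * X + (k + 1) * \<nu> * X" unfolding k n N by (simp add: algebra_simps)
    have "(l - 1) * (N * (X + s1 * q ^ N) + q ^ N * n) = k * N * X + (k * (N * s1) * q ^ N + k * n * q ^ N)"
      unfolding k by (simp add: algebra_simps)
    thus ?thesis unfolding 2 using 1 by linarith
  qed
  thus ?thesis using * unfolding X_def by linarith
qed

text \<open>At \<open>\<theta> ^ (q ^ j)\<close> the function \<open>tw (q ^ N) (\<psi> m)\<close>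
  takes the \<open>q ^ j\<close>-th power of the value at \<theta> of the twist by
  \<open>q ^ (N - j)\<close>, which the iterated system expresses through the \<open>v m'\<close>.
  So the form takes there a multiple of the sum of the \<open>y Q j m' * v m' ^ (q ^ j)\<close>, and
  this vanishes once the vector \<open>y Q j\<close> is proportional to the \<open>q ^ j\<close>-th
  power of \<rho>.\<close>

lemma auxiliary_form_exists:
  assumes \<nu>: "\<nu> > 0" "N = 2 * l * \<nu>" "n = (2 * l - 1) * \<nu>"
  obtains Q where "\<And>m. m \<in> J \<Longrightarrow> Q m \<in> PW (aux_size * q ^ N) n" "\<exists>m\<in>J. Q m \<noteq> 0"
    "\<And>j. j < N \<Longrightarrow> \<exists>\<rho>'. has_val \<rho>' (\<Sum>m\<in>J. fps_of_poly (Q m) * tw (q ^ N) (\<psi> m)) (\<theta> ^ (q ^ j)) 0 \<and> av (\<theta> ^ (q ^ j)) < \<rho>'"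
proof -
  let ?T = "aux_size * q ^ N"
  \<comment> \<open>The index is \<open>N - j - 1\<close> because \<open>iter_mat i\<close> belongs
    to the iterate of order \<open>i + 1\<close>.\<close>
  let ?c = "\<lambda>j m m'. poly (iter_mat (N - j - 1) m m') \<theta> ^ (q ^ j)"
  define y where "y = (\<lambda>Q j m'. \<Sum>m\<in>J. poly (Q m) (\<theta> ^ (q ^ j)) * ?c j m m')"
  \<comment> \<open>The minors of \<open>y Q j\<close> against the power of \<rho> that involve the
    column \<open>m0\<close>; as \<open>\<rho> m0 \<noteq> 0\<close>, they detect
    proportionality.\<close>
  define \<phi> where "\<phi> = (\<lambda>Q. restrict (\<lambda>(j, m). y Q j m * \<rho> m0 ^ (q ^ j) - \<rho> m ^ (q ^ j) * y Q j m0) ({..<N} \<times> (J - {m0})))"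
  define X where "X = PiE J (\<lambda>_. PW ?T n)"
  define Y where "Y = PiE ({..<N} \<times> (J - {m0})) (\<lambda>(j, m). W (?T + q ^ j * n + s1 * q ^ N))"
  have yW: "y Q j m' \<in> W (?T + q ^ j * n + (s0 + \<delta>) * q ^ N)" if Q: "Q \<in> X" and j: "j < N" and m': "m' \<in> J" for Q j m'
    unfolding y_def
  proof (rule W_sum)
    fix m assume m: "m \<in> J"
    define i where "i = N - j - 1"
    have i: "Suc i = N - j" "j + Suc i = N" using j by (auto simp: i_def)
    have "poly (iter_mat i m m') (\<theta> ^ 1) \<in> W (s0 * q ^ Suc i + 1 * (\<delta> * Suc i))" by (rule PW_eval[OF iter_mat_PW[OF m m']])
    hence "poly (iter_mat i m m') \<theta> ^ (q ^ j) \<in> W (q ^ j * (s0 * q ^ Suc i + \<delta> * Suc i))" by (intro W_power) auto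
    moreover have "q ^ j * (s0 * q ^ Suc i + \<delta> * Suc i) \<le> (s0 + \<delta>) * q ^ N"
    proof -
      have "Suc i \<le> q ^ Suc i" using q_ge_2 less_exp[of "Suc i"] power_mono[of 2 q "Suc i"] by linarith
      hence "q ^ j * (s0 * q ^ Suc i + \<delta> * Suc i) \<le> q ^ j * (s0 * q ^ Suc i + \<delta> * q ^ Suc i)"
        by (intro mult_left_mono add_left_mono) auto
      also have "\<dots> = (s0 + \<delta>) * (q ^ j * q ^ Suc i)" by (simp add: algebra_simps)
      also have "q ^ j * q ^ Suc i = q ^ N" unfolding power_add[symmetric] i(2) ..
      finally show ?thesis .
    qed
    ultimately have "?c j m m' \<in> W ((s0 + \<delta>) * q ^ N)" unfolding i_def by (rule W_mono)
    moreover have "poly (Q m) (\<theta> ^ (q ^ j)) \<in> W (?T + q ^ j * n)" using Q m by (intro PW_eval) (auto simp: X_def)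
    ultimately show "poly (Q m) (\<theta> ^ (q ^ j)) * ?c j m m' \<in> W (?T + q ^ j * n + (s0 + \<delta>) * q ^ N)" by (intro W_mult)
  qed
  have \<rho>W: "\<rho> m ^ (q ^ j) \<in> W (s0 * q ^ N)" if "m \<in> J" "j < N" for m j
  proof (rule W_mono[OF W_power[OF \<rho>(1)[OF that(1)]]])
    show "q ^ j * s0 \<le> s0 * q ^ N" using power_increasing[of j N q] that by simp
  qed simp
  have sub: "\<phi> ` X \<subseteq> Y"
  proof (rule image_subsetI)
    fix Q assume Q: "Q \<in> X"
    have "y Q j m * \<rho> m0 ^ (q ^ j) - \<rho> m ^ (q ^ j) * y Q j m0 \<in> W (?T + q ^ j * n + s1 * q ^ N)"
      if "j < N" "m \<in> J" for j m
    proof (rule W_diff)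
      have eq: "?T + q ^ j * n + s1 * q ^ N = ?T + q ^ j * n + (s0 + \<delta>) * q ^ N + s0 * q ^ N"
        by (simp add: s1_def algebra_simps)
      show "y Q j m * \<rho> m0 ^ (q ^ j) \<in> W (?T + q ^ j * n + s1 * q ^ N)"
        unfolding eq using that m0 by (intro W_mult yW \<rho>W Q)
      show "\<rho> m ^ (q ^ j) * y Q j m0 \<in> W (?T + q ^ j * n + s1 * q ^ N)"
        unfolding eq mult.commute[of "\<rho> m ^ (q ^ j)"] using that m0 by (intro W_mult yW \<rho>W Q)
    qed
    thus "\<phi> Q \<in> Y" unfolding \<phi>_def Y_def by auto
  qed
  have finY: "finite Y" unfolding Y_def using J_fin W_finite by (intro finite_PiE) auto
  have cardX: "card X = \<kappa> ^ (D * (l * n * (?T + 1 - c0)))"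
    unfolding X_def by (simp only: card_PiE[OF J_fin] PW_card prod_constant l_def power_mult[symmetric]) (simp add: mult_ac)
  have "card Y = (\<Prod>x\<in>{..<N} \<times> (J - {m0}). card (case x of (j, m) \<Rightarrow> W (?T + q ^ j * n + s1 * q ^ N)))"
    unfolding Y_def using J_fin by (intro card_PiE) auto
  also have "\<dots> = (\<Prod>x\<in>{..<N} \<times> (J - {m0}). \<kappa> ^ (D * (?T + q ^ fst x * n + s1 * q ^ N + 1 - c0)))"
    by (intro prod.cong) (auto simp: W_card)
  also have "\<dots> = \<kappa> ^ (\<Sum>x\<in>{..<N} \<times> (J - {m0}). D * (?T + q ^ fst x * n + s1 * q ^ N + 1 - c0))"
    by (simp only: power_sum)
  also have "(\<Sum>x\<in>{..<N} \<times> (J - {m0}). D * (?T + q ^ fst x * n + s1 * q ^ N + 1 - c0))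
      = (\<Sum>j<N. \<Sum>m\<in>J - {m0}. D * (?T + q ^ j * n + s1 * q ^ N + 1 - c0))"
    by (subst sum.cartesian_product) (simp add: case_prod_unfold)
  also have "\<dots> = D * ((l - 1) * (\<Sum>j<N. ?T + q ^ j * n + s1 * q ^ N + 1 - c0))"
    using J_fin m0 by (simp add: l_def sum_distrib_left mult_ac)
  finally have "card Y < card X" unfolding cardX
    using auxiliary_form_count[OF \<nu>] D_pos \<kappa>_ge_2 by (auto intro!: power_strict_increasing)
  then obtain Q1 Q2 where Q12: "Q1 \<in> X" "Q2 \<in> X" "Q1 \<noteq> Q2" "\<phi> Q1 = \<phi> Q2"
    using pigeonhole_collision[OF finY sub] by metis
  define Q where "Q = (\<lambda>m. Q1 m - Q2 m)"
  have QX: "Q m \<in> PW ?T n" if "m \<in> J" for m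
    using Q12(1,2) that unfolding Q_def X_def by (auto intro!: PW_diff)
  have "\<exists>m\<in>J. Q m \<noteq> 0"
  proof (rule ccontr)
    assume "\<not> (\<exists>m\<in>J. Q m \<noteq> 0)"
    hence "Q1 = Q2" using Q12(1,2) unfolding X_def Q_def by (intro PiE_ext) auto
    thus False using Q12(3) by simp
  qed
  have yd: "y Q j m = y Q1 j m - y Q2 j m" for j m
    unfolding y_def Q_def by (simp add: left_diff_distrib sum_subtractf)
  have prp: "y Q j m * \<rho> m0 ^ (q ^ j) = \<rho> m ^ (q ^ j) * y Q j m0" if "j < N" "m \<in> J" for j m
  proof (cases "m = m0")
    case False
    hence "y Q1 j m * \<rho> m0 ^ (q ^ j) - \<rho> m ^ (q ^ j) * y Q1 j m0 = y Q2 j m * \<rho> m0 ^ (q ^ j) - \<rho> m ^ (q ^ j) * y Q2 j m0"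
      using fun_cong[OF Q12(4), of "(j, m)"] that unfolding \<phi>_def by simp
    thus ?thesis unfolding yd by (simp add: algebra_simps)
  qed simp
  have "\<exists>\<rho>'. has_val \<rho>' (\<Sum>m\<in>J. fps_of_poly (Q m) * tw (q ^ N) (\<psi> m)) (\<theta> ^ (q ^ j)) 0 \<and> av (\<theta> ^ (q ^ j)) < \<rho>'"
    if j: "j < N" for j
  proof -
    define i where "i = N - j - 1"
    have i: "Suc i + j = N" using j by (auto simp: i_def)
    have val1: "has_val rad (tw (q ^ Suc i) (\<psi> m)) \<theta> (inverse (iter_den i) * (\<Sum>m'\<in>J. poly (iter_mat i m m') \<theta> * v m'))"
      if m: "m \<in> J" for m
    proof -
      have "tw (q ^ Suc i) (\<psi> m) = fps_const (inverse (iter_den i)) * (fps_const (iter_den i) * tw (q ^ Suc i) (\<psi> m))"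
        using iter_den_nz[of i] by (simp add: mult.assoc[symmetric])
      also have "\<dots> = fps_const (inverse (iter_den i)) * (\<Sum>m'\<in>J. fps_of_poly (iter_mat i m m') * \<psi> m')"
        by (simp only: iterate[OF m])
      finally show ?thesis using v rad_pos
        by (auto intro!: has_val_mult has_val_const has_val_sum has_val_poly)
    qed
    have val2: "has_val (rad ^ (q ^ j)) (tw (q ^ N) (\<psi> m)) (\<theta> ^ (q ^ j))
      (inverse (iter_den i) ^ (q ^ j) * (\<Sum>m'\<in>J. ?c j m m' * v m' ^ (q ^ j)))" if m: "m \<in> J" for m
    proof -
      have "tw (q ^ j) (tw (q ^ Suc i) (\<psi> m)) = tw (q ^ N) (\<psi> m)"
        unfolding tw_tw power_add[symmetric] i ..
      moreover have "(inverse (iter_den i) * (\<Sum>m'\<in>J. poly (iter_mat i m m') \<theta> * v m')) ^ (q ^ j)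
        = inverse (iter_den i) ^ (q ^ j) * (\<Sum>m'\<in>J. ?c j m m' * v m' ^ (q ^ j))"
        unfolding i_def by (simp add: power_mult_distrib frob_sum[OF frobexp_qk p(2)])
      ultimately show ?thesis using has_val_tw[OF val1[OF m] rad_pos frobexp_qk, of j] by simp
    qed
    have "has_val (rad ^ (q ^ j)) (\<Sum>m\<in>J. fps_of_poly (Q m) * tw (q ^ N) (\<psi> m)) (\<theta> ^ (q ^ j))
      (\<Sum>m\<in>J. poly (Q m) (\<theta> ^ (q ^ j)) * (inverse (iter_den i) ^ (q ^ j) * (\<Sum>m'\<in>J. ?c j m m' * v m' ^ (q ^ j))))"
      using rad_pos by (intro has_val_sum has_val_mult has_val_poly val2) auto
    moreover have "(\<Sum>m\<in>J. poly (Q m) (\<theta> ^ (q ^ j)) * (inverse (iter_den i) ^ (q ^ j) * (\<Sum>m'\<in>J. ?c j m m' * v m' ^ (q ^ j))))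
      = inverse (iter_den i) ^ (q ^ j) * (\<Sum>m'\<in>J. y Q j m' * v m' ^ (q ^ j))"
    proof -
      have "(\<Sum>m'\<in>J. y Q j m' * v m' ^ (q ^ j)) = (\<Sum>m\<in>J. \<Sum>m'\<in>J. poly (Q m) (\<theta> ^ (q ^ j)) * ?c j m m' * v m' ^ (q ^ j))"
        unfolding y_def sum_distrib_right by (rule sum.swap)
      thus ?thesis by (simp add: sum_distrib_left mult_ac)
    qed
    moreover have "(\<Sum>m'\<in>J. y Q j m' * v m' ^ (q ^ j)) = 0"
    proof -
      have "\<rho> m0 ^ (q ^ j) * (\<Sum>m'\<in>J. y Q j m' * v m' ^ (q ^ j)) = (\<Sum>m'\<in>J. (y Q j m' * \<rho> m0 ^ (q ^ j)) * v m' ^ (q ^ j))"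
        by (simp add: sum_distrib_left mult_ac)
      also have "\<dots> = (\<Sum>m'\<in>J. (\<rho> m' ^ (q ^ j) * y Q j m0) * v m' ^ (q ^ j))"
        by (intro sum.cong refl) (simp only: prp[OF j])
      also have "\<dots> = y Q j m0 * (\<Sum>m'\<in>J. (\<rho> m' * v m') ^ (q ^ j))"
        by (simp add: sum_distrib_left power_mult_distrib mult_ac)
      also have "\<dots> = 0" unfolding frob_sum[OF frobexp_qk p(2), symmetric] \<rho>(2) by simp
      finally show ?thesis using m0(2) by simp
    qed
    ultimately have "has_val (rad ^ (q ^ j)) (\<Sum>m\<in>J. fps_of_poly (Q m) * tw (q ^ N) (\<psi> m)) (\<theta> ^ (q ^ j)) 0"
      by simp
    moreover have "av (\<theta> ^ (q ^ j)) < rad ^ (q ^ j)"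
      unfolding av_power using rad_gt by (intro power_strict_mono) auto
    ultimately show ?thesis by blast
  qed
  thus ?thesis using that QX \<open>\<exists>m\<in>J. Q m \<noteq> 0\<close> by blast
qed

text \<open>In units of \<open>q ^ N\<close>, \<open>s2\<close> bounds the coefficients of the
  matrix \<open>V\<close> below, \<open>s3\<close> the unknowns \<open>A'\<close>, and
  \<open>s4\<close> the unknowns times their denominators. None of them depends on \<nu>, so they
  stay fixed while \<nu> grows.\<close>

definition s2 :: nat where "s2 = q ^ (l + 1) * (aux_size + s0)"
definition s3 :: nat where "s3 = (2 * l + 1) * s2 + c0"
definition s4 :: nat where "s4 = s3 + s0 * q ^ (l + 1)"

text \<open>After clearing denominators, the \<open>l + 1\<close> twists of the form are
  combinations of only \<open>l\<close> functions \<open>tw (q ^ N) (\<psi> m)\<close>, so they are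
  dependent. Pigeonhole supplies a dependency of controlled size.\<close>

lemma frobenius_relation_exists:
  assumes Q: "\<And>m. m \<in> J \<Longrightarrow> Q m \<in> PW (aux_size * q ^ N) n" and n: "n > 0"
  obtains A' where "\<And>i k. i \<in> {1..l+1} \<Longrightarrow> coeff (A' i) k * iter_den (i - 1) ^ (q ^ N) \<in> W (s4 * q ^ N)"
    "\<exists>i\<in>{1..l+1}. A' i \<noteq> 0"
    "(\<Sum>i\<in>{1..l+1}. fps_of_poly (A' i) * fps_const (iter_den (i - 1) ^ (q ^ N)) *
        tw (q ^ i) (\<Sum>m\<in>J. fps_of_poly (Q m) * tw (q ^ N) (\<psi> m))) = 0"
proof -
  define V where "V = (\<lambda>i m. \<Sum>k\<in>J. twp (q ^ i) (Q k) * twp (q ^ N) (iter_mat (i - 1) k m))"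
  define \<mu> where "\<mu> = n + \<delta> * (l + 1)"
  define T where "T = (2 * l + 1) * s2 * q ^ N + c0"
  define X where "X = PiE {1..l+1} (\<lambda>_. PW T (2 * l * \<mu>))"
  define Y where "Y = PiE J (\<lambda>_. PW (T + s2 * q ^ N) (2 * l * \<mu> + \<mu>))"
  define \<phi> where "\<phi> = (\<lambda>A'. restrict (\<lambda>m. \<Sum>i\<in>{1..l+1}. A' i * V i m) J)"
  have qi: "q ^ i \<le> q ^ (l + 1)" if "i \<in> {1..l+1}" for i
    using that by (intro power_increasing) auto
  have V: "V i m \<in> PW (s2 * q ^ N) \<mu>" if "i \<in> {1..l+1}" "m \<in> J" for i m
    unfolding V_def
  proof (rule PW_sum)
    fix k assume k: "k \<in> J"
    have i: "Suc (i - 1) = i" using that by auto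
    have c: "iter_mat (i - 1) k m \<in> PW (s0 * q ^ i) (\<delta> * i)" using iter_mat_PW[OF k that(2), of "i - 1"] unfolding i .
    have "twp (q ^ i) (Q k) * twp (q ^ N) (iter_mat (i - 1) k m) \<in> PW (q ^ i * (aux_size * q ^ N) + q ^ N * (s0 * q ^ i)) (n + \<delta> * i)"
      by (intro PW_mult PW_twp Q k c)
    moreover have "q ^ i * (aux_size * q ^ N) + q ^ N * (s0 * q ^ i) = q ^ i * (aux_size + s0) * q ^ N" by (simp add: algebra_simps)
    moreover have "\<dots> \<le> s2 * q ^ N" unfolding s2_def using qi[OF that(1)] by (intro mult_right_mono) auto
    moreover have "n + \<delta> * i \<le> \<mu>" using that unfolding \<mu>_def by (intro add_left_mono mult_left_mono) auto
    ultimately show "twp (q ^ i) (Q k) * twp (q ^ N) (iter_mat (i - 1) k m) \<in> PW (s2 * q ^ N) \<mu>"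
      using PW_mono by metis
  qed
  have sub: "\<phi> ` X \<subseteq> Y"
  proof (rule image_subsetI)
    fix A' assume A': "A' \<in> X"
    have "(\<Sum>i\<in>{1..l+1}. A' i * V i m) \<in> PW (T + s2 * q ^ N) (2 * l * \<mu> + \<mu>)" if "m \<in> J" for m
      using A' by (intro PW_sum PW_mult V that) (auto simp: X_def)
    thus "\<phi> A' \<in> Y" unfolding \<phi>_def Y_def by auto
  qed
  have finY: "finite Y" unfolding Y_def using J_fin PW_finite by (intro finite_PiE) auto
  have cardX: "card X = \<kappa> ^ (D * ((l + 1) * (2 * l * \<mu>) * (T + 1 - c0)))"
  proof -
    have "card X = (\<kappa> ^ (D * (T + 1 - c0) * (2 * l * \<mu>))) ^ card {1..l+1}"
      unfolding X_def by (simp only: card_PiE[OF finite_atLeastAtMost] PW_card prod_constant)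
    moreover have "card {1..l+1} = l + 1" by simp
    ultimately show ?thesis by (simp only: power_mult[symmetric] mult_ac)
  qed
  have cardY: "card Y = \<kappa> ^ (D * (l * (2 * l * \<mu> + \<mu>) * (T + s2 * q ^ N + 1 - c0)))"
  proof -
    have "card Y = (\<kappa> ^ (D * (T + s2 * q ^ N + 1 - c0) * (2 * l * \<mu> + \<mu>))) ^ l"
      unfolding Y_def l_def by (simp only: card_PiE[OF J_fin] PW_card prod_constant)
    thus ?thesis by (simp only: power_mult[symmetric]) (simp add: mult_ac)
  qed
  have "l * (2 * l * \<mu> + \<mu>) * (T + s2 * q ^ N + 1 - c0) < (l + 1) * (2 * l * \<mu>) * (T + 1 - c0)"
  proof -
    define Z where "Z = s2 * q ^ N"
    have 1: "T + s2 * q ^ N + 1 - c0 = (2 * l + 2) * Z + 1" "T + 1 - c0 = (2 * l + 1) * Z + 1"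
      unfolding T_def Z_def by (simp_all add: algebra_simps)
    have "\<mu> > 0" using n by (simp add: \<mu>_def)
    hence "l * \<mu> > 0" using l_pos by simp
    \<comment> \<open>The size \<open>T\<close> and the degree bound \<open>2 * l * \<mu>\<close>
      are chosen to make the terms in \<open>Z\<close> cancel, with exactly \<open>l * \<mu>\<close>
      to spare.\<close>
    moreover have "(l + 1) * (2 * l * \<mu>) * ((2 * l + 1) * Z + 1) = l * (2 * l * \<mu> + \<mu>) * ((2 * l + 2) * Z + 1) + l * \<mu>"
      by (simp add: algebra_simps)
    ultimately show ?thesis unfolding 1 by linarith
  qed
  hence "card Y < card X" unfolding cardX cardY
    using D_pos \<kappa>_ge_2 by (auto intro!: power_strict_increasing)
  then obtain A1 A2 where A12: "A1 \<in> X" "A2 \<in> X" "A1 \<noteq> A2" "\<phi> A1 = \<phi> A2"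
    using pigeonhole_collision[OF finY sub] by metis
  define A' where "A' = (\<lambda>i. A1 i - A2 i)"
  have AX: "A' i \<in> PW T (2 * l * \<mu>)" if "i \<in> {1..l+1}" for i
    using A12(1,2) that unfolding A'_def X_def by (auto intro!: PW_diff)
  have nz: "\<exists>i\<in>{1..l+1}. A' i \<noteq> 0"
  proof (rule ccontr)
    assume "\<not> (\<exists>i\<in>{1..l+1}. A' i \<noteq> 0)"
    hence "A1 = A2" using A12(1,2) unfolding X_def A'_def by (intro PiE_ext) auto
    thus False using A12(3) by simp
  qed
  have AV: "(\<Sum>i\<in>{1..l+1}. A' i * V i m) = 0" if "m \<in> J" for m
    using fun_cong[OF A12(4), of m] that unfolding \<phi>_def A'_def by (simp add: left_diff_distrib sum_subtractf)
  have "coeff (A' i) k * iter_den (i - 1) ^ (q ^ N) \<in> W (s4 * q ^ N)" if i: "i \<in> {1..l+1}" for i k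
  proof -
    have 1: "coeff (A' i) k \<in> W (s3 * q ^ N)"
    proof (rule W_mono)
      show "coeff (A' i) k \<in> W T" using AX[OF i] by (auto simp: PW_def)
      show "T \<le> s3 * q ^ N" unfolding T_def s3_def by (simp add: algebra_simps)
    qed
    have "Suc (i - 1) = i" using i by auto
    hence "iter_den (i - 1) \<in> W (s0 * q ^ i)" using iter_den_W[of "i - 1"] by simp
    hence "iter_den (i - 1) ^ (q ^ N) \<in> W (q ^ N * (s0 * q ^ i))" by (intro W_power) auto
    hence 2: "iter_den (i - 1) ^ (q ^ N) \<in> W (s0 * q ^ (l + 1) * q ^ N)"
      by (rule W_mono) (use qi[OF i] in \<open>simp add: mult_ac\<close>)
    show ?thesis using W_mult[OF 1 2] by (simp add: s4_def distrib_right)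
  qed
  moreover have "(\<Sum>i\<in>{1..l+1}. fps_of_poly (A' i) * fps_const (iter_den (i - 1) ^ (q ^ N)) *
        tw (q ^ i) (\<Sum>m\<in>J. fps_of_poly (Q m) * tw (q ^ N) (\<psi> m))) = 0"
  proof -
    have "fps_const (iter_den (i - 1) ^ (q ^ N)) * tw (q ^ i) (\<Sum>m\<in>J. fps_of_poly (Q m) * tw (q ^ N) (\<psi> m))
      = (\<Sum>m\<in>J. fps_of_poly (V i m) * tw (q ^ N) (\<psi> m))" if i: "i \<in> {1..l+1}" for i
    proof -
      have Si: "Suc (i - 1) = i" using i by auto
      have it: "fps_const (iter_den (i - 1) ^ (q ^ N)) * tw (q ^ i) (tw (q ^ N) (\<psi> k))
         = (\<Sum>m\<in>J. fps_of_poly (twp (q ^ N) (iter_mat (i - 1) k m)) * tw (q ^ N) (\<psi> m))" if k: "k \<in> J" for k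
      proof -
        have "tw (q ^ N) (fps_const (iter_den (i - 1)) * tw (q ^ i) (\<psi> k)) = tw (q ^ N) (\<Sum>m\<in>J. fps_of_poly (iter_mat (i - 1) k m) * \<psi> m)"
          using iterate[OF k, of "i - 1"] unfolding Si by simp
        thus ?thesis
          unfolding tw_mult[OF frobexp_qk] tw_const[OF frobexp_qk] tw_sum[OF frobexp_qk] tw_poly[OF frobexp_qk] tw_tw
          by (simp add: mult.commute)
      qed
      have "fps_const (iter_den (i - 1) ^ (q ^ N)) * tw (q ^ i) (\<Sum>m\<in>J. fps_of_poly (Q m) * tw (q ^ N) (\<psi> m))
        = (\<Sum>k\<in>J. fps_of_poly (twp (q ^ i) (Q k)) * (fps_const (iter_den (i - 1) ^ (q ^ N)) * tw (q ^ i) (tw (q ^ N) (\<psi> k))))"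
        unfolding tw_sum[OF frobexp_qk] tw_mult[OF frobexp_qk] tw_poly[OF frobexp_qk]
        by (simp add: sum_distrib_left mult_ac)
      also have "\<dots> = (\<Sum>k\<in>J. \<Sum>m\<in>J. fps_of_poly (twp (q ^ i) (Q k) * twp (q ^ N) (iter_mat (i - 1) k m)) * tw (q ^ N) (\<psi> m))"
        by (intro sum.cong refl) (simp only: it sum_distrib_left fps_of_poly_mult mult.assoc)
      also have "\<dots> = (\<Sum>m\<in>J. fps_of_poly (V i m) * tw (q ^ N) (\<psi> m))"
        by (subst sum.swap) (simp add: V_def fps_of_poly_sum sum_distrib_right)
      finally show ?thesis .
    qed
    hence "(\<Sum>i\<in>{1..l+1}. fps_of_poly (A' i) * fps_const (iter_den (i - 1) ^ (q ^ N)) *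
        tw (q ^ i) (\<Sum>m\<in>J. fps_of_poly (Q m) * tw (q ^ N) (\<psi> m)))
      = (\<Sum>i\<in>{1..l+1}. \<Sum>m\<in>J. fps_of_poly (A' i * V i m) * tw (q ^ N) (\<psi> m))"
      by (intro sum.cong refl) (simp only: mult.assoc sum_distrib_left fps_of_poly_mult)
    also have "\<dots> = (\<Sum>m\<in>J. fps_of_poly (\<Sum>i\<in>{1..l+1}. A' i * V i m) * tw (q ^ N) (\<psi> m))"
      by (subst sum.swap) (simp only: fps_of_poly_sum sum_distrib_right)
    also have "\<dots> = 0" by (intro sum.neutral ballI) (simp only: AV fps_of_poly_0 mult_zero_left)
    finally show ?thesis .
  qed
  ultimately show ?thesis using that nz by blast
qed

text \<open>Compare the lowest nonzero term with the others: their exponents exceed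
  \<open>q ^ i0\<close>, so they carry at least one further factor \<open>w\<close>.\<close>

lemma additive_root_lower_bound:
  assumes eq: "(\<Sum>i\<in>I. \<beta> i * w ^ (q ^ i)) = 0" and I: "finite I" and w: "w \<noteq> 0" "av w \<le> 1"
    and \<beta>: "\<exists>i\<in>I. \<beta> i \<noteq> 0" "\<And>i. i \<in> I \<Longrightarrow> av (\<beta> i) \<le> M" "\<And>i. i \<in> I \<Longrightarrow> \<beta> i \<noteq> 0 \<Longrightarrow> c \<le> av (\<beta> i)"
  shows "c \<le> M * av w"
proof -
  define i0 where "i0 = (LEAST i. i \<in> I \<and> \<beta> i \<noteq> 0)"
  have i0: "i0 \<in> I" "\<beta> i0 \<noteq> 0" using LeastI_ex[of "\<lambda>i. i \<in> I \<and> \<beta> i \<noteq> 0"] \<beta>(1) by (auto simp: i0_def)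
  have least: "\<beta> i = 0" if "i \<in> I" "i < i0" for i using not_less_Least[of i "\<lambda>i. i \<in> I \<and> \<beta> i \<noteq> 0"] that by (auto simp: i0_def)
  have M: "M \<ge> 0" using \<beta>(2)[OF i0(1)] av_nonneg[of "\<beta> i0"] by linarith
  have "av (\<beta> i0 * w ^ (q ^ i0)) = av (\<Sum>i\<in>I - {i0}. \<beta> i * w ^ (q ^ i))"
    using eq sum.remove[OF I i0(1), of "\<lambda>i. \<beta> i * w ^ (q ^ i)"]
    by (metis add_eq_0_iff av_minus)
  also have "\<dots> \<le> M * av w ^ (q ^ i0 + 1)"
  proof (rule av_sum_le)
    fix i assume i: "i \<in> I - {i0}"
    show "av (\<beta> i * w ^ (q ^ i)) \<le> M * av w ^ (q ^ i0 + 1)"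
    proof (cases "i < i0")
      case False
      hence "i0 < i" using i by auto
      hence "q ^ i0 < q ^ i" using q_ge_2 by (intro power_strict_increasing) auto
      hence "q ^ i0 + 1 \<le> q ^ i" by linarith
      hence "av w ^ (q ^ i) \<le> av w ^ (q ^ i0 + 1)" using w by (intro power_decreasing) auto
      thus ?thesis unfolding av_mult av_power using \<beta>(2)[of i] i M by (intro mult_mono) auto
    qed (use least i M in auto)
  qed (use M in auto)
  finally have "av (\<beta> i0) * av w ^ (q ^ i0) \<le> (M * av w) * av w ^ (q ^ i0)"
    by (simp add: av_mult av_power mult_ac)
  hence "av (\<beta> i0) \<le> M * av w" using av_pos[OF w(1)] by simp
  thus ?thesis using \<beta>(3)[OF i0] by linarith
qed

text \<open>The leading coefficient of the auxiliary function \<open>E\<close> would be a root of an additive polynomial with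
  coefficients of bounded size, hence not too small; the zeros of \<open>E\<close> make it too small.\<close>
theorem functional_relation:
  "\<exists>N Q. (\<exists>m\<in>J. Q m \<noteq> 0) \<and> (\<Sum>m\<in>J. fps_of_poly (Q m) * tw (q ^ N) (\<psi> m)) = 0"
proof -
  obtain C1 where C1: "C1 \<ge> 1" "\<And>x S. x \<in> W S \<Longrightarrow> av x \<le> C1 * av \<theta> ^ S" using W_le by blast
  obtain C2 where C2: "C2 > 0" "\<And>x S. x \<in> W S \<Longrightarrow> x \<noteq> 0 \<Longrightarrow> C2 / av \<theta> ^ (D * S) \<le> av x" using W_liouville by blast
  obtain B\<psi> where B\<psi>: "B\<psi> \<ge> 1" "\<And>m. m \<in> J \<Longrightarrow> bdd (\<psi> m) rad B\<psi>"
  proof -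
    obtain b where b: "\<And>m. m \<in> J \<Longrightarrow> bdd (\<psi> m) rad (b m)" using \<psi> unfolding fbd_def by metis
    have "bdd (\<psi> m) rad (Max (insert 1 (b ` J)))" if "m \<in> J" for m
      using J_fin that by (intro bdd_mono[OF b[OF that]] Max_ge) auto
    thus ?thesis using that[of "Max (insert 1 (b ` J))"] J_fin by auto
  qed
  \<comment> \<open>\<Gamma> is the base of the growth of \<open>E\<close>: \<open>aux_size\<close>
    comes from the coefficients, the extra \<open>1\<close> from the zeros and
    \<open>B\<psi>\<close> from the functions. \<open>h\<close> is the base of the Liouville bound,
    and \<open>\<Gamma>3\<close> absorbs \<open>C1\<close> and \<open>C2\<close>. All are
    independent of \<nu>.\<close>
  define \<Gamma> where "\<Gamma> = av \<theta> ^ (aux_size + 1) * B\<psi>"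
  define h where "h = av \<theta> ^ ((D + 1) * s4)"
  define \<Gamma>3 where "\<Gamma>3 = C1 ^ 2 * max 1 (1 / C2)"
  have th: "av \<theta> ^ k \<ge> 1" for k using \<theta>(2) by simp
  have \<Gamma>: "\<Gamma> \<ge> 1" using th[of "aux_size + 1"] B\<psi>(1) mult_mono[of 1 "av \<theta> ^ (aux_size + 1)" 1 B\<psi>] by (simp add: \<Gamma>_def)
  have h: "h \<ge> 1" using th by (simp add: h_def)
  have \<Gamma>3: "\<Gamma>3 \<ge> 1" using one_le_power[OF C1(1), of 2] mult_mono[of 1 "C1 ^ 2" 1 "max 1 (1 / C2)"] by (simp add: \<Gamma>3_def)
  obtain \<nu>' where \<nu>': "\<Gamma> * h * \<Gamma>3 < rad ^ \<nu>'" using real_arch_pow[OF rad_gt_1] by blast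
  define \<nu> where "\<nu> = Suc \<nu>'"
  have \<nu>: "\<nu> > 0" "\<Gamma> * h * \<Gamma>3 < rad ^ \<nu>"
    using \<nu>' power_strict_increasing[OF _ rad_gt_1, of \<nu>' "Suc \<nu>'"] by (auto simp: \<nu>_def simp del: power_Suc)
  define N where "N = 2 * l * \<nu>"
  define n where "n = (2 * l - 1) * \<nu>"
  have n0: "n > 0" using l_pos \<nu> by (simp add: n_def)
  have Nn: "N = n + \<nu>" using l_pos unfolding N_def n_def by (cases l) (auto simp: algebra_simps)
  obtain Q where Q: "\<And>m. m \<in> J \<Longrightarrow> Q m \<in> PW (aux_size * q ^ N) n" "\<exists>m\<in>J. Q m \<noteq> 0"
    and zeros: "\<And>j. j < N \<Longrightarrow> \<exists>\<rho>'. has_val \<rho>' (\<Sum>m\<in>J. fps_of_poly (Q m) * tw (q ^ N) (\<psi> m)) (\<theta> ^ (q ^ j)) 0 \<and> av (\<theta> ^ (q ^ j)) < \<rho>'"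
    using auxiliary_form_exists[OF \<nu>(1) N_def n_def] by blast
  define E where "E = (\<Sum>m\<in>J. fps_of_poly (Q m) * tw (q ^ N) (\<psi> m))"
  define R where "R = rad ^ (q ^ N)"
  have R: "R > 1" unfolding R_def using rad_gt_1 by (intro one_less_power) auto
  define BE where "BE = C1 * av \<theta> ^ (aux_size * q ^ N) * R ^ n * B\<psi> ^ (q ^ N)"
  have bE: "bdd E R BE" unfolding E_def
  proof (rule bdd_sum)
    fix m assume m: "m \<in> J"
    have "bdd (fps_of_poly (Q m)) R (C1 * av \<theta> ^ (aux_size * q ^ N) * R ^ n)"
    proof (rule bdd_poly)
      show "av (coeff (Q m) k) \<le> C1 * av \<theta> ^ (aux_size * q ^ N)" for k
        using Q(1)[OF m] by (intro C1(2)) (auto simp: PW_def)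
      show "degree (Q m) \<le> n" using Q(1)[OF m] by (intro degree_le) (auto simp: PW_def)
    qed (use R C1(1) in auto)
    moreover have "bdd (tw (q ^ N) (\<psi> m)) R (B\<psi> ^ (q ^ N))"
      unfolding R_def using B\<psi>(2)[OF m] rad_pos by (intro bdd_tw)
    ultimately show "bdd (fps_of_poly (Q m) * tw (q ^ N) (\<psi> m)) R BE"
      unfolding BE_def using R by (intro bdd_mult) auto
  qed (use R C1(1) B\<psi>(1) in \<open>auto simp: BE_def\<close>)
  have "E = 0"
  proof (rule ccontr)
    assume E0: "E \<noteq> 0"
    define Z where "Z = (\<lambda>j. \<theta> ^ (q ^ j)) ` {..<N}"
    have inj: "inj_on (\<lambda>j. \<theta> ^ (q ^ j)) {..<N}"
    proof (rule inj_onI)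
      fix i j assume "\<theta> ^ (q ^ i) = \<theta> ^ (q ^ j)"
      hence "av \<theta> ^ (q ^ i) = av \<theta> ^ (q ^ j)" by (metis av_power)
      hence "q ^ i = q ^ j" using power_inject_exp[OF \<theta>(2)] by simp
      thus "i = j" using q_ge_2 by (simp add: power_inject_exp)
    qed
    have lt: "av (\<theta> ^ (q ^ j)) < R" if "j < N" for j
    proof -
      have "av \<theta> ^ (q ^ j) \<le> av \<theta> ^ (q ^ N)"
        using that \<theta>(2) by (intro power_increasing) auto
      also have "\<dots> < R" unfolding R_def using rad_gt by (intro power_strict_mono) auto
      finally show ?thesis by (simp add: av_power)
    qed
    have small: "av (E $ k) \<le> BE * (\<Prod>z\<in>Z. max 1 (av z) / R)" for k
    proof (rule bdd_zeros)
      fix z assume "z \<in> Z"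
      then obtain j where j: "j < N" "z = \<theta> ^ (q ^ j)" unfolding Z_def by auto
      show z: "z \<noteq> 0 \<and> av z < R" using lt[OF j(1)] j(2) by auto
      obtain w where w: "has_val R E z w" using has_val_exists[OF bE] z by blast
      \<comment> \<open>The zeros come with their own radii; uniqueness of values carries them to
        the radius \<open>R\<close>.\<close>
      obtain \<rho>' where "has_val \<rho>' E z 0" "av z < \<rho>'" using zeros[OF j(1)] j(2) unfolding E_def by blast
      hence "w = 0" using has_val_unique[OF w, of \<rho>' 0] z by blast
      thus "has_val R E z 0" using w by simp
    qed (use bE R in \<open>auto simp: Z_def\<close>)
    have "(\<Prod>z\<in>Z. max 1 (av z) / R) = (\<Prod>j<N. av \<theta> ^ (q ^ j) / R)"
      unfolding Z_def using th by (subst prod.reindex[OF inj]) (auto simp: av_power max_def intro!: prod.cong)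
    also have "\<dots> = av \<theta> ^ (\<Sum>j<N. q ^ j) / R ^ N" by (simp add: prod_dividef power_sum)
    also have "\<dots> \<le> av \<theta> ^ (q ^ N) / R ^ N"
      using geometric_sum_le[OF q_ge_2, of N] \<theta>(2) R by (intro divide_right_mono power_increasing) auto
    finally have pr: "(\<Prod>z\<in>Z. max 1 (av z) / R) \<le> av \<theta> ^ (q ^ N) / R ^ N" .
    have "BE * (\<Prod>z\<in>Z. max 1 (av z) / R) \<le> BE * (av \<theta> ^ (q ^ N) / R ^ N)"
      using pr R C1(1) B\<psi>(1) by (intro mult_left_mono) (auto simp: BE_def)
    also have "\<dots> = C1 * (\<Gamma> / rad ^ \<nu>) ^ (q ^ N)"
    proof -
      have "av \<theta> ^ (aux_size * q ^ N) * av \<theta> ^ (q ^ N) * B\<psi> ^ (q ^ N) = \<Gamma> ^ (q ^ N)"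
        by (simp add: \<Gamma>_def power_mult_distrib power_add power_mult[symmetric])
      \<comment> \<open>The \<nu> zeros in excess of the degree bound \<open>n\<close> leave
        \<open>rad ^ \<nu>\<close> in the denominator.\<close>
      moreover have "R ^ n / R ^ N = 1 / (rad ^ \<nu>) ^ (q ^ N)"
      proof -
        have "R ^ \<nu> = (rad ^ \<nu>) ^ (q ^ N)" by (simp add: R_def mult.commute flip: power_mult)
        thus ?thesis using R unfolding Nn by (simp add: power_add)
      qed
      moreover have "BE * (av \<theta> ^ (q ^ N) / R ^ N) = C1 * (av \<theta> ^ (aux_size * q ^ N) * av \<theta> ^ (q ^ N) * B\<psi> ^ (q ^ N)) * (R ^ n / R ^ N)"
        by (simp add: BE_def)
      ultimately show ?thesis by (simp add: power_divide)
    qed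
    finally have up: "av (E $ k) \<le> C1 * (\<Gamma> / rad ^ \<nu>) ^ (q ^ N)" for k using small[of k] by linarith
    have "\<Gamma> / rad ^ \<nu> < 1 / (h * \<Gamma>3)"
      using \<nu>(2) h \<Gamma>3 rad_pos by (simp add: field_simps)
    hence "(\<Gamma> / rad ^ \<nu>) ^ (q ^ N) < (1 / (h * \<Gamma>3)) ^ (q ^ N)"
      using \<Gamma> rad_pos by (intro power_strict_mono) auto
    also have "\<dots> \<le> 1 / (h ^ (q ^ N) * \<Gamma>3)"
    proof -
      have "\<Gamma>3 ^ 1 \<le> \<Gamma>3 ^ (q ^ N)" using \<Gamma>3 by (intro power_increasing) auto
      hence "h ^ (q ^ N) * \<Gamma>3 \<le> (h * \<Gamma>3) ^ (q ^ N)" using h by (simp add: power_mult_distrib)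
      thus ?thesis using h \<Gamma>3 by (auto simp: power_divide intro!: divide_left_mono)
    qed
    finally have "C1 * (\<Gamma> / rad ^ \<nu>) ^ (q ^ N) < C1 * (1 / (h ^ (q ^ N) * \<Gamma>3))"
      using C1(1) by (intro mult_strict_left_mono) auto
    hence up: "av (E $ k) < C1 / (h ^ (q ^ N) * \<Gamma>3)" for k using up[of k] by simp
    have hN: "h ^ (q ^ N) \<ge> 1" using h by simp
    have up1: "av (E $ k) \<le> 1" and up2: "C1 * av (E $ k) < C2 / h ^ (q ^ N)" for k
    proof -
      have c: "C1 * C1 \<le> \<Gamma>3" unfolding \<Gamma>3_def power2_eq_square using mult_left_mono[of 1 "max 1 (1 / C2)" "C1 * C1"] by simp
      have "C1 * 1 \<le> C1 * C1" using C1(1) by (intro mult_left_mono) auto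
      hence "C1 \<le> 1 * \<Gamma>3" using c by simp
      also have "\<dots> \<le> h ^ (q ^ N) * \<Gamma>3" using hN \<Gamma>3 by (intro mult_right_mono) auto
      finally have "C1 / (h ^ (q ^ N) * \<Gamma>3) \<le> 1" using hN \<Gamma>3 by simp
      thus "av (E $ k) \<le> 1" using up[of k] by linarith
      have "C1 * C1 * (1 / C2) \<le> \<Gamma>3" unfolding \<Gamma>3_def power2_eq_square by (intro mult_left_mono) auto
      hence "C1 * C1 / \<Gamma>3 \<le> C2" using C2(1) \<Gamma>3 by (simp add: field_simps)
      hence "C1 * C1 / \<Gamma>3 / h ^ (q ^ N) \<le> C2 / h ^ (q ^ N)" using hN by (intro divide_right_mono) auto
      moreover have "C1 * av (E $ k) < C1 * (C1 / (h ^ (q ^ N) * \<Gamma>3))"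
        using up[of k] C1(1) by (intro mult_strict_left_mono) auto
      ultimately show "C1 * av (E $ k) < C2 / h ^ (q ^ N)" by (simp add: mult_ac)
    qed
    have "\<exists>A'. (\<forall>i k. i \<in> {1..l+1} \<longrightarrow> coeff (A' i) k * iter_den (i - 1) ^ (q ^ N) \<in> W (s4 * q ^ N))
      \<and> (\<exists>i\<in>{1..l+1}. A' i \<noteq> 0)
      \<and> (\<Sum>i\<in>{1..l+1}. fps_of_poly (A' i) * fps_const (iter_den (i - 1) ^ (q ^ N)) * tw (q ^ i) E) = 0"
    proof (rule frobenius_relation_exists[of Q N n, OF _ n0, folded E_def])
      show "Q m \<in> PW (aux_size * q ^ N) n" if "m \<in> J" for m using that by (rule Q(1))
    qed blast
    then obtain A' where A': "\<And>i k. i \<in> {1..l+1} \<Longrightarrow> coeff (A' i) k * iter_den (i - 1) ^ (q ^ N) \<in> W (s4 * q ^ N)"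
      "\<exists>i\<in>{1..l+1}. A' i \<noteq> 0"
      "(\<Sum>i\<in>{1..l+1}. fps_of_poly (A' i) * fps_const (iter_den (i - 1) ^ (q ^ N)) * tw (q ^ i) E) = 0"
      by blast
    define d where "d = subdegree E"
    define e0 where "e0 = E $ d"
    have e0: "e0 \<noteq> 0" using E0 by (simp add: e0_def d_def)
    \<comment> \<open>The lowest degree occurring in any \<open>A' i\<close>. A twist does not
      change the order \<open>d\<close> of \<open>E\<close>, so in degree \<open>k0 + d\<close> each
      summand contributes just one product.\<close>
    define k0 where "k0 = (LEAST k. \<exists>i\<in>{1..l+1}. coeff (A' i) k \<noteq> 0)"
    have "\<exists>k. \<exists>i\<in>{1..l+1}. coeff (A' i) k \<noteq> 0" using A'(2) by (auto simp: poly_eq_iff)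
    hence k0: "\<exists>i\<in>{1..l+1}. coeff (A' i) k0 \<noteq> 0" unfolding k0_def by (rule LeastI_ex)
    have k0_least: "coeff (A' i) k = 0" if "k < k0" "i \<in> {1..l+1}" for k i
      using not_less_Least[OF that(1)[unfolded k0_def]] that(2) by blast
    define \<beta> where "\<beta> = (\<lambda>i. coeff (A' i) k0 * iter_den (i - 1) ^ (q ^ N))"
    have trm: "(fps_of_poly (A' i) * fps_const (iter_den (i - 1) ^ (q ^ N)) * tw (q ^ i) E) $ (k0 + d) = \<beta> i * e0 ^ (q ^ i)"
      if i: "i \<in> {1..l+1}" for i
    proof -
      let ?P = "fps_of_poly (A' i) * fps_const (iter_den (i - 1) ^ (q ^ N))"
      have "(?P * tw (q ^ i) E) $ (k0 + d) = (\<Sum>j\<in>{0..k0 + d}. ?P $ j * tw (q ^ i) E $ (k0 + d - j))"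
        by (rule fps_mult_nth)
      also have "\<dots> = (\<Sum>j\<in>{k0}. ?P $ j * tw (q ^ i) E $ (k0 + d - j))"
      proof (rule sum.mono_neutral_right)
        show "\<forall>j\<in>{0..k0 + d} - {k0}. ?P $ j * tw (q ^ i) E $ (k0 + d - j) = 0"
        proof
          fix j assume j: "j \<in> {0..k0 + d} - {k0}"
          show "?P $ j * tw (q ^ i) E $ (k0 + d - j) = 0"
          proof (cases "j < k0")
            case True
            thus ?thesis using k0_least[OF True i] by simp
          next
            case False
            hence "k0 + d - j < d" using j by auto
            hence z: "E $ (k0 + d - j) = 0" unfolding d_def by (rule nth_less_subdegree_zero)
            show ?thesis unfolding tw_nth z by (simp only: zero_power[OF frobexp_pos[OF frobexp_qk]] mult_zero_right)
          qed
        qed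
      qed auto
      also have "\<dots> = \<beta> i * e0 ^ (q ^ i)" by (simp add: \<beta>_def e0_def)
      finally show ?thesis .
    qed
    have "(\<Sum>i\<in>{1..l+1}. \<beta> i * e0 ^ (q ^ i)) = (\<Sum>i\<in>{1..l+1}. fps_of_poly (A' i) * fps_const (iter_den (i - 1) ^ (q ^ N)) * tw (q ^ i) E) $ (k0 + d)"
      unfolding fps_sum_nth by (intro sum.cong refl) (simp only: trm)
    also have "\<dots> = 0" unfolding A'(3) by simp
    finally have "C2 / av \<theta> ^ (D * (s4 * q ^ N)) \<le> C1 * av \<theta> ^ (s4 * q ^ N) * av e0"
    proof (rule additive_root_lower_bound)
      show "\<exists>i\<in>{1..l+1}. \<beta> i \<noteq> 0" using k0 iter_den_nz by (auto simp: \<beta>_def)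
      fix i assume i: "i \<in> {1..l+1}"
      hence bW: "\<beta> i \<in> W (s4 * q ^ N)" unfolding \<beta>_def by (rule A'(1))
      show "av (\<beta> i) \<le> C1 * av \<theta> ^ (s4 * q ^ N)" by (rule C1(2)[OF bW])
      show "\<beta> i \<noteq> 0 \<Longrightarrow> C2 / av \<theta> ^ (D * (s4 * q ^ N)) \<le> av (\<beta> i)" by (rule C2(2)[OF bW])
    qed (use e0 up1[of d] in \<open>auto simp: e0_def\<close>)
    moreover have "h ^ (q ^ N) = av \<theta> ^ (D * (s4 * q ^ N)) * av \<theta> ^ (s4 * q ^ N)"
      unfolding h_def power_mult[symmetric] power_add[symmetric] by (simp add: algebra_simps)
    ultimately have "C2 / h ^ (q ^ N) \<le> C1 * av e0"
      using th[of "D * (s4 * q ^ N)"] th[of "s4 * q ^ N"] by (simp add: field_simps)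
    thus False using up2[of d] by (simp add: e0_def)
  qed
  thus ?thesis using Q(2) unfolding E_def by blast
qed

end

section \<open>Invariants of unipotent Frobenius systems\<close>

text \<open>Write \<open>r = p ^ v * r'\<close> with \<open>r'\<close> prime to \<open>p\<close>.
  Since \<open>(1 + x) ^ r = (1 + x ^ (p ^ v)) ^ r'\<close>, the binomial coefficient at
  \<open>p ^ v\<close> is \<open>r'\<close> modulo \<open>p\<close>.\<close>

lemma choose_not_all_zero:
  assumes p: "prime p" "CHAR('a::field) = p" and r: "r > 0" "\<nexists>k. r = p ^ k"
  obtains j where "0 < j" "j < r" "of_nat (r choose j) \<noteq> (0 :: 'a)"
proof -
  define v where "v = multiplicity p r"
  obtain r' where r': "r = p ^ v * r'" "\<not> p dvd r'"
    using multiplicity_decompose'[of r p] r(1) p(1) prime_gt_1_nat[OF p(1)] unfolding v_def by auto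
  have pv: "p ^ v > 0" using p(1) by (simp add: prime_gt_0_nat)
  have r1: "r' > 1"
  proof -
    have "r' \<noteq> 0" using r(1) r'(1) by auto
    moreover have "r' \<noteq> 1"
    proof
      assume "r' = 1"
      hence "r = p ^ v" using r'(1) by simp
      thus False using r(2) by blast
    qed
    ultimately show ?thesis by simp
  qed
  have cr: "of_nat (r choose (p ^ v)) = (of_nat r' :: 'a)"
  proof -
    have "[:1, 1 :: 'a:] = 1 + monom 1 1" by (simp add: one_pCons monom_altdef)
    hence "[:1, 1 :: 'a:] ^ (p ^ v) = (1 + monom 1 1) ^ (p ^ v)" by (simp only:)
    also have "\<dots> = 1 + monom 1 (p ^ v)"
      using p freshmans_dream'[of "p ^ v" v "1 :: 'a poly" "monom 1 1"] by (simp add: monom_power)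
    finally have "[:1, 1 :: 'a:] ^ r = (1 + monom 1 (p ^ v)) ^ r'" by (simp add: r'(1) power_mult)
    also have "\<dots> = (\<Sum>k\<le>r'. of_nat (r' choose k) * monom 1 (p ^ v) ^ (r' - k))"
      by (subst binomial_ring) (simp add: add.commute)
    also have "\<dots> = (\<Sum>k\<le>r'. monom (of_nat (r' choose k)) (p ^ v * (r' - k)))"
      by (intro sum.cong refl) (simp add: monom_power of_nat_poly smult_monom)
    finally have "coeff ([:1, 1 :: 'a:] ^ r) (p ^ v) = (\<Sum>k\<le>r'. if p ^ v * (r' - k) = p ^ v then of_nat (r' choose k) else 0)"
      by (simp add: coeff_sum)
    also have "\<dots> = (\<Sum>k\<le>r'. if k = r' - 1 then of_nat (r' choose k) else 0)"
      using pv r1 by (intro sum.cong) auto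
    also have "\<dots> = of_nat r'" using r1 by (simp add: binomial_symmetric[of "r' - Suc 0" r'])
    finally have "coeff ([:1, 1 :: 'a:] ^ r) (p ^ v) = of_nat r'" .
    moreover have "p ^ v \<le> r" using r'(1) r(1) by simp
    ultimately show ?thesis by (simp add: coeff_linear_poly_power)
  qed
  have "p ^ v < r" using r1 pv by (simp add: r'(1))
  moreover have "of_nat r' \<noteq> (0 :: 'a)" using r'(2) p(2) by (simp add: of_nat_eq_0_iff_char_dvd)
  ultimately show ?thesis using that[of "p ^ v"] pv cr by simp
qed

text \<open>In the application \<sigma> is the Frobenius on Laurent series, \<open>k\<close> the
  field of rational functions, \<tau> is \<open>t - \<theta> ^ q\<close>, \<open>X\<close> the
  period series and \<open>g s\<close> a logarithm series divided by \<open>X ^ n s\<close>. The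
  condition \<open>eigen\<close> says that \<open>k\<close> has no eigenvector of nonzero weight,
  and \<open>n_indep\<close> encodes the hypothesis on quotients.\<close>

locale unipotent_system =
  fixes \<sigma> :: "'a::field \<Rightarrow> 'a" and k :: "'a set" and \<tau> X :: 'a and I :: "'s set"
    and g u :: "'s \<Rightarrow> 'a" and n :: "'s \<Rightarrow> nat" and p N :: nat
  assumes \<sigma>_add: "\<And>x y. \<sigma> (x + y) = \<sigma> x + \<sigma> y" and \<sigma>_mult: "\<And>x y. \<sigma> (x * y) = \<sigma> x * \<sigma> y"
    and \<sigma>_1 [simp]: "\<sigma> 1 = 1"
    and p: "prime p" "CHAR('a) = p"
    and k_0 [simp]: "0 \<in> k" and k_1 [simp]: "1 \<in> k" and k_add: "\<And>x y. x \<in> k \<Longrightarrow> y \<in> k \<Longrightarrow> x + y \<in> k"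
    and k_minus: "\<And>x. x \<in> k \<Longrightarrow> - x \<in> k" and k_mult: "\<And>x y. x \<in> k \<Longrightarrow> y \<in> k \<Longrightarrow> x * y \<in> k"
    and k_inverse: "\<And>x. x \<in> k \<Longrightarrow> inverse x \<in> k" and k_\<sigma>: "\<And>x. x \<in> k \<Longrightarrow> \<sigma> x \<in> k"
    and \<tau>: "\<tau> \<in> k" "\<tau> \<noteq> 0" and X: "X \<noteq> 0" "\<sigma> X = \<tau> * X"
    and eigen: "\<And>h w. h \<in> k \<Longrightarrow> \<sigma> h * \<tau> powi w = h \<Longrightarrow> h = 0 \<or> w = 0"
    and I: "finite I" and u: "\<And>s. s \<in> I \<Longrightarrow> u s \<in> k"
    and g: "\<And>s. s \<in> I \<Longrightarrow> \<sigma> (g s) = g s - u s * X powi (- int (n s))"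
    and n: "\<And>s. s \<in> I \<Longrightarrow> n s > 0"
    and n_indep: "\<And>s s' i j. s \<in> I \<Longrightarrow> s' \<in> I \<Longrightarrow> n s * p ^ i = n s' * p ^ j \<Longrightarrow> n s = n s'"
begin

lemma \<sigma>_0 [simp]: "\<sigma> 0 = 0" 
  using \<sigma>_add[of 0 0] by (metis add.right_neutral add_left_cancel)

lemma \<sigma>_inverse: "\<sigma> (inverse x) = inverse (\<sigma> x)"
proof (cases "x = 0")
  case False
  hence "\<sigma> x * \<sigma> (inverse x) = 1" using \<sigma>_mult[of x "inverse x"] by simp
  thus ?thesis by (simp add: inverse_unique)
qed auto

lemma \<sigma>_power: "\<sigma> (x ^ i) = \<sigma> x ^ i"
  by (induction i) (auto simp: \<sigma>_mult)

lemma \<sigma>_powi: "\<sigma> (x powi w) = \<sigma> x powi w"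
  by (simp add: power_int_def \<sigma>_power \<sigma>_inverse)

lemma \<sigma>_sum: "\<sigma> (sum f B) = (\<Sum>i\<in>B. \<sigma> (f i))"
  by (induction B rule: infinite_finite_induct) (auto simp: \<sigma>_add)

lemma \<sigma>_prod: "\<sigma> (prod f B) = (\<Prod>i\<in>B. \<sigma> (f i))"
  by (induction B rule: infinite_finite_induct) (auto simp: \<sigma>_mult)

lemma \<sigma>_of_nat [simp]: "\<sigma> (of_nat i) = of_nat i"
  by (induction i) (auto simp: \<sigma>_add)

lemma k_power: "x \<in> k \<Longrightarrow> x ^ i \<in> k"
  by (induction i) (auto intro: k_mult)

lemma k_powi: "x \<in> k \<Longrightarrow> x powi w \<in> k"
  by (simp add: power_int_def k_power k_inverse)

lemma k_sum: "(\<And>i. i \<in> B \<Longrightarrow> f i \<in> k) \<Longrightarrow> sum f B \<in> k"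
  by (induction B rule: infinite_finite_induct) (auto intro: k_add)

lemma k_prod: "(\<And>i. i \<in> B \<Longrightarrow> f i \<in> k) \<Longrightarrow> prod f B \<in> k"
  by (induction B rule: infinite_finite_induct) (auto intro: k_mult)

lemma k_of_nat: "of_nat i \<in> k"
  by (induction i) (auto intro: k_add)

text \<open>A Laurent polynomial in \<open>X\<close> with polynomial dependence on the \<open>Y s\<close> is encoded by its coefficient
  function on pairs \<open>(w, m)\<close>, standing for the monomial \<open>X powi w * (\<Prod>s\<in>I. Y s ^ m s)\<close>;
  exponent vectors are extensional on \<open>I\<close>. The bound \<open>N\<close> on degrees keeps all sums over
  exponent shifts within a fixed finite box.\<close>

abbreviation "Box \<equiv> PiE I (\<lambda>_. {..N})"
abbreviation "Ext \<equiv> (extensional I :: ('s \<Rightarrow> nat) set)"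

definition plus_ext :: "('s \<Rightarrow> nat) \<Rightarrow> ('s \<Rightarrow> nat) \<Rightarrow> 's \<Rightarrow> nat" (infixl "\<oplus>" 65) where
  "m \<oplus> b = (\<lambda>s\<in>I. m s + b s)"

definition zz :: "'s \<Rightarrow> nat" where "zz = (\<lambda>s\<in>I. 0)"

definition deg :: "('s \<Rightarrow> nat) \<Rightarrow> nat" where "deg m = (\<Sum>s\<in>I. m s)"

definition wt :: "('s \<Rightarrow> nat) \<Rightarrow> int" where "wt m = (\<Sum>s\<in>I. int (n s * m s))"

definition bin :: "('s \<Rightarrow> nat) \<Rightarrow> ('s \<Rightarrow> nat) \<Rightarrow> nat" where "bin m b = (\<Prod>s\<in>I. m s choose b s)"

definition U :: "('s \<Rightarrow> nat) \<Rightarrow> 'a" where "U b = (\<Prod>s\<in>I. (- u s) ^ b s)"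

definition supp :: "(int \<times> ('s \<Rightarrow> nat) \<Rightarrow> 'a) \<Rightarrow> (int \<times> ('s \<Rightarrow> nat)) set" where
  "supp c = {x. c x \<noteq> 0}"

definition laurent :: "nat \<Rightarrow> (int \<times> ('s \<Rightarrow> nat) \<Rightarrow> 'a) \<Rightarrow> bool" where
  "laurent d c \<longleftrightarrow> finite (supp c) \<and> (\<forall>x. c x \<in> k) \<and> (\<forall>x\<in>supp c. snd x \<in> Ext \<and> deg (snd x) \<le> d)"

definition mono :: "int \<times> ('s \<Rightarrow> nat) \<Rightarrow> 'a" where
  "mono x = X powi fst x * (\<Prod>s\<in>I. g s ^ snd x s)"

definition ev :: "(int \<times> ('s \<Rightarrow> nat) \<Rightarrow> 'a) \<Rightarrow> 'a" where
  "ev c = (\<Sum>x\<in>supp c. c x * mono x)"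

text \<open>Applies \<sigma> to the coefficients, multiplies \<open>X\<close> by \<tau> and
  substitutes \<open>Y s - u s * X powi (- n s)\<close> for \<open>Y s\<close>. The expansion is
  collected at the target \<open>(w, m)\<close>, to which a shift \<open>b\<close> brings the source
  \<open>(w + wt b, m \<oplus> b)\<close>.\<close>

definition T :: "(int \<times> ('s \<Rightarrow> nat) \<Rightarrow> 'a) \<Rightarrow> int \<times> ('s \<Rightarrow> nat) \<Rightarrow> 'a" where
  "T c = (\<lambda>(w, m). if m \<in> Ext then
     \<Sum>b\<in>Box. of_nat (bin (m \<oplus> b) m) * U b * \<tau> powi (w + wt b) * \<sigma> (c (w + wt b, m \<oplus> b)) else 0)"

text \<open>Divided-power derivative of order \<open>a\<close> in the \<open>Y s\<close>. Ordinary
  derivatives would also kill monomials such as \<open>Y ^ (p * (p + 1))\<close>, which are not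
  additive.\<close>

definition hasse :: "('s \<Rightarrow> nat) \<Rightarrow> (int \<times> ('s \<Rightarrow> nat) \<Rightarrow> 'a) \<Rightarrow> int \<times> ('s \<Rightarrow> nat) \<Rightarrow> 'a" where
  "hasse a c = (\<lambda>(w, m). if m \<in> Ext then of_nat (bin (m \<oplus> a) a) * c (w, m \<oplus> a) else 0)"

lemma plus_Ext [simp]: "m \<oplus> b \<in> Ext" by (simp add: plus_ext_def)

lemma plus_apply: "s \<in> I \<Longrightarrow> (m \<oplus> b) s = m s + b s" by (simp add: plus_ext_def)

lemma zz_Ext [simp]: "zz \<in> Ext" by (simp add: zz_def)

lemma zz_apply: "s \<in> I \<Longrightarrow> zz s = 0" by (simp add: zz_def)

lemma zz_plus: "b \<in> Ext \<Longrightarrow> zz \<oplus> b = b" and plus_zz: "b \<in> Ext \<Longrightarrow> b \<oplus> zz = b"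
  by (auto simp: plus_ext_def zz_def fun_eq_iff extensional_def)

lemma deg_plus: "deg (m \<oplus> b) = deg m + deg b"
  by (simp add: deg_def plus_apply sum.distrib)

lemma wt_zz [simp]: "wt zz = 0" and deg_zz [simp]: "deg zz = 0"
  by (simp_all add: wt_def deg_def zz_apply)

lemma deg_0: "m \<in> Ext \<Longrightarrow> deg m = 0 \<Longrightarrow> m = zz"
  using I by (auto simp: deg_def zz_def fun_eq_iff extensional_def)

lemma Box_Ext: "b \<in> Box \<Longrightarrow> b \<in> Ext" by (simp add: PiE_def)

lemma finite_Box: "finite Box" using I by (intro finite_PiE) auto

lemma deg_le_Box: "m \<in> Ext \<Longrightarrow> deg m \<le> N \<Longrightarrow> m \<in> Box"
proof -
  assume m: "m \<in> Ext" "deg m \<le> N"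
  have "m s \<le> N" if "s \<in> I" for s
    using member_le_sum[OF that, of m] I m(2) unfolding deg_def by simp
  thus ?thesis using m by (auto simp: PiE_def)
qed

lemma laurentD: "laurent d c \<Longrightarrow> c x \<noteq> 0 \<Longrightarrow> snd x \<in> Ext" "laurent d c \<Longrightarrow> c x \<noteq> 0 \<Longrightarrow> deg (snd x) \<le> d"
  "laurent d c \<Longrightarrow> c x \<in> k" "laurent d c \<Longrightarrow> finite (supp c)"
  unfolding laurent_def supp_def by blast+

lemma U_k: "U b \<in> k" unfolding U_def using u by (intro k_prod k_power k_minus) auto

definition minus_ext :: "('s \<Rightarrow> nat) \<Rightarrow> ('s \<Rightarrow> nat) \<Rightarrow> 's \<Rightarrow> nat" (infixl "\<ominus>" 65) where
  "m \<ominus> b = (\<lambda>s\<in>I. m s - b s)"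

lemma minus_Ext [simp]: "m \<ominus> b \<in> Ext" by (simp add: minus_ext_def)

lemma minus_plus: "m \<in> Ext \<Longrightarrow> (\<And>s. s \<in> I \<Longrightarrow> b s \<le> m s) \<Longrightarrow> (m \<ominus> b) \<oplus> b = m"
  by (auto simp: plus_ext_def minus_ext_def fun_eq_iff extensional_def)

lemma plus_minus: "m \<in> Ext \<Longrightarrow> (m \<oplus> b) \<ominus> b = m"
  by (auto simp: plus_ext_def minus_ext_def fun_eq_iff extensional_def)

text \<open>Pairs of a source term and an admissible shift, with \<open>down\<close> giving the
  exponent where it lands; they index the full expansion of \<open>\<sigma> (ev c)\<close>.\<close>

definition shifts :: "(int \<times> ('s \<Rightarrow> nat) \<Rightarrow> 'a) \<Rightarrow> ((int \<times> ('s \<Rightarrow> nat)) \<times> ('s \<Rightarrow> nat)) set" where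
  "shifts c = Sigma (supp c) (\<lambda>x. PiE I (\<lambda>s. {..snd x s}))"

definition down :: "(int \<times> ('s \<Rightarrow> nat)) \<times> ('s \<Rightarrow> nat) \<Rightarrow> int \<times> ('s \<Rightarrow> nat)" where
  "down = (\<lambda>(x, b). (fst x - wt b, snd x \<ominus> b))"

lemma finite_shifts: "finite (supp c) \<Longrightarrow> finite (shifts c)"
  unfolding shifts_def using I by (intro finite_SigmaI finite_PiE) auto

lemma supp_T:
  assumes "laurent d c" shows "supp (T c) \<subseteq> down ` shifts c"
proof
  fix y assume "y \<in> supp (T c)"
  then obtain w m where y: "y = (w, m)" "T c (w, m) \<noteq> 0" by (cases y) (auto simp: supp_def)
  hence m: "m \<in> Ext" by (auto simp: T_def split: if_splits)
  hence "(\<Sum>b\<in>Box. of_nat (bin (m \<oplus> b) m) * U b * \<tau> powi (w + wt b) * \<sigma> (c (w + wt b, m \<oplus> b))) \<noteq> 0"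
    using y by (simp add: T_def)
  then obtain b where b: "b \<in> Box"
      "of_nat (bin (m \<oplus> b) m) * U b * \<tau> powi (w + wt b) * \<sigma> (c (w + wt b, m \<oplus> b)) \<noteq> 0"
    by (rule sum.not_neutral_contains_not_neutral)
  hence b': "c (w + wt b, m \<oplus> b) \<noteq> 0" by (metis \<sigma>_0 mult_zero_right)
  have "b \<in> PiE I (\<lambda>s. {..(m \<oplus> b) s})" using b(1) by (auto simp: plus_apply PiE_def)
  hence "((w + wt b, m \<oplus> b), b) \<in> shifts c" using b' by (simp add: shifts_def supp_def)
  moreover have "y = down ((w + wt b, m \<oplus> b), b)" using m y by (simp add: down_def plus_minus)
  ultimately show "y \<in> down ` shifts c" by (rule rev_image_eqI)
qed

lemma T_laurent:
  assumes c: "laurent d c" shows "laurent d (T c)"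
  unfolding laurent_def
proof (intro conjI allI ballI)
  show "finite (supp (T c))"
    using finite_subset[OF supp_T[OF c]] finite_shifts[OF laurentD(4)[OF c]] by blast
  show "T c x \<in> k" for x
    unfolding T_def using laurentD(3)[OF c] \<tau>
    by (auto simp: case_prod_unfold intro!: k_sum k_mult k_of_nat U_k k_powi k_\<sigma>)
  fix y assume "y \<in> supp (T c)"
  then obtain x b where xb: "(x, b) \<in> shifts c" "y = down (x, b)" using supp_T[OF c] by auto
  thus "snd y \<in> Ext" by (simp add: down_def)
  have x: "c x \<noteq> 0" "\<And>s. s \<in> I \<Longrightarrow> b s \<le> snd x s" using xb by (auto simp: shifts_def supp_def PiE_def)
  have "deg (snd y) + deg b = deg (snd x)"
    unfolding xb(2) down_def using minus_plus[OF laurentD(1)[OF c x(1)] x(2)] by (simp add: deg_plus[symmetric])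
  thus "deg (snd y) \<le> d" using laurentD(2)[OF c x(1)] by linarith
qed

lemma ev_superset: "finite B \<Longrightarrow> supp c \<subseteq> B \<Longrightarrow> ev c = (\<Sum>x\<in>B. c x * mono x)"
  unfolding ev_def by (intro sum.mono_neutral_left) (auto simp: supp_def)

lemma \<sigma>_mono:
  assumes "m \<in> Ext"
  shows "\<sigma> (mono (w, m)) = (\<Sum>b\<in>PiE I (\<lambda>s. {..m s}). \<tau> powi w * of_nat (bin m b) * U b * mono (w - wt b, m \<ominus> b))"
proof -
  have 1: "\<sigma> (g s) ^ m s = (\<Sum>i\<le>m s. of_nat (m s choose i) * (- u s) ^ i * X powi (- int (n s * i)) * g s ^ (m s - i))"
    if s: "s \<in> I" for s
  proof -
    have "\<sigma> (g s) = - u s * X powi (- int (n s)) + g s" using g[OF s] by simp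
    moreover have "(X powi (- int (n s))) ^ i = X powi (- int (n s * i))" for i
      by (simp add: power_int_power[symmetric] power_int_minus power_mult power_inverse)
    ultimately show ?thesis
      by (simp only: binomial_ring power_mult_distrib) (simp add: mult_ac)
  qed
  have "\<sigma> (mono (w, m)) = \<tau> powi w * X powi w * (\<Prod>s\<in>I. \<sigma> (g s) ^ m s)"
    by (simp add: mono_def \<sigma>_mult \<sigma>_powi \<sigma>_prod \<sigma>_power X(2) power_int_mult_distrib)
  also have "(\<Prod>s\<in>I. \<sigma> (g s) ^ m s) = (\<Prod>s\<in>I. \<Sum>i\<le>m s. of_nat (m s choose i) * (- u s) ^ i * X powi (- int (n s * i)) * g s ^ (m s - i))"
    by (intro prod.cong refl 1)
  also have "\<dots> = (\<Sum>b\<in>PiE I (\<lambda>s. {..m s}). \<Prod>s\<in>I. of_nat (m s choose b s) * (- u s) ^ b s * X powi (- int (n s * b s)) * g s ^ (m s - b s))"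
    using I by (subst prod_sum_PiE) auto
  also have "\<tau> powi w * X powi w * \<dots> = (\<Sum>b\<in>PiE I (\<lambda>s. {..m s}). \<tau> powi w * of_nat (bin m b) * U b * mono (w - wt b, m \<ominus> b))"
    unfolding sum_distrib_left
  proof (intro sum.cong refl)
    fix b assume b: "b \<in> PiE I (\<lambda>s. {..m s})"
    have xw: "X powi w * (\<Prod>s\<in>B. X powi (- int (n s * b s))) = X powi (w - (\<Sum>s\<in>B. int (n s * b s)))" if "finite B" for B
      using that
    proof (induction B rule: finite_induct)
      case (insert s B)
      have "X powi w * (\<Prod>s\<in>insert s B. X powi (- int (n s * b s))) = X powi (- int (n s * b s)) * (X powi w * (\<Prod>s\<in>B. X powi (- int (n s * b s))))"
        using insert.hyps by (simp add: mult_ac)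
      also have "\<dots> = X powi (- int (n s * b s) + (w - (\<Sum>s\<in>B. int (n s * b s))))"
        unfolding insert.IH by (rule power_int_add[symmetric]) (use X(1) in simp)
      also have "- int (n s * b s) + (w - (\<Sum>s\<in>B. int (n s * b s))) = w - (\<Sum>s\<in>insert s B. int (n s * b s))"
        using insert.hyps by simp
      finally show ?case .
    qed simp
    have "(\<Prod>s\<in>I. g s ^ (m s - b s)) = (\<Prod>s\<in>I. g s ^ (m \<ominus> b) s)"
      by (intro prod.cong) (auto simp: minus_ext_def)
    moreover have "(\<Prod>s\<in>I. of_nat (m s choose b s) * (- u s) ^ b s * X powi (- int (n s * b s)) * g s ^ (m s - b s))
       = of_nat (bin m b) * U b * (\<Prod>s\<in>I. X powi (- int (n s * b s))) * (\<Prod>s\<in>I. g s ^ (m s - b s))"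
      by (simp only: prod.distrib bin_def U_def of_nat_prod)
    ultimately show "\<tau> powi w * X powi w * (\<Prod>s\<in>I. of_nat (m s choose b s) * (- u s) ^ b s * X powi (- int (n s * b s)) * g s ^ (m s - b s))
       = \<tau> powi w * of_nat (bin m b) * U b * mono (w - wt b, m \<ominus> b)"
      unfolding mono_def fst_conv snd_conv wt_def xw[OF I, symmetric] by (simp add: mult_ac)
  qed
  finally show ?thesis .
qed

lemma bin_symm: "(\<And>s. s \<in> I \<Longrightarrow> b s \<le> m s) \<Longrightarrow> bin m (m \<ominus> b) = bin m b"
  unfolding bin_def by (intro prod.cong refl) (simp add: minus_ext_def binomial_symmetric[symmetric])

text \<open>Both sides run over the same pairs of a term and a shift, grouped once by target and
  once by source. The bound \<open>d \<le> N\<close> keeps all shifts inside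
  \<open>Box\<close>.\<close>

lemma ev_T:
  assumes c: "laurent d c" and d: "d \<le> N" shows "ev (T c) = \<sigma> (ev c)"
proof -
  define F where "F = (\<lambda>z. of_nat (bin (snd (fst z) \<oplus> snd z) (snd (fst z))) * U (snd z) * \<tau> powi (fst (fst z) + wt (snd z))
    * \<sigma> (c (fst (fst z) + wt (snd z), snd (fst z) \<oplus> snd z)) * mono (fst z))"
  let ?Y = "down ` shifts c"
  have fin: "finite ?Y" using finite_shifts[OF laurentD(4)[OF c]] by blast
  have YE: "snd y \<in> Ext" if "y \<in> ?Y" for y using that by (auto simp: down_def)
  have "ev (T c) = (\<Sum>y\<in>?Y. T c y * mono y)" by (rule ev_superset[OF fin supp_T[OF c]])
  also have "\<dots> = (\<Sum>y\<in>?Y. \<Sum>b\<in>Box. F (y, b))"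
    using YE by (intro sum.cong refl) (auto simp: T_def F_def case_prod_unfold sum_distrib_right)
  also have "\<dots> = (\<Sum>z\<in>?Y \<times> Box. F z)" by (simp add: sum.cartesian_product)
  also have "\<dots> = (\<Sum>z\<in>{z \<in> ?Y \<times> Box. (fst (fst z) + wt (snd z), snd (fst z) \<oplus> snd z) \<in> supp c}. F z)"
    using fin finite_Box by (intro sum.mono_neutral_right) (auto simp: F_def supp_def)
  also have "\<dots> = (\<Sum>(x, b)\<in>shifts c. \<sigma> (c x) * (\<tau> powi fst x * of_nat (bin (snd x) b) * U b * mono (fst x - wt b, snd x \<ominus> b)))"
  proof (rule sum.reindex_bij_witness[where i = "\<lambda>z. (down z, snd z)" and
        j = "\<lambda>z. ((fst (fst z) + wt (snd z), snd (fst z) \<oplus> snd z), snd z)"])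
    fix z assume z: "z \<in> {z \<in> ?Y \<times> Box. (fst (fst z) + wt (snd z), snd (fst z) \<oplus> snd z) \<in> supp c}"
    obtain w m b where zz: "z = ((w, m), b)" by (metis surj_pair)
    have Y: "(w, m) \<in> ?Y" and b: "b \<in> Box" and s: "(w + wt b, m \<oplus> b) \<in> supp c"
      using z unfolding zz by (simp_all only: mem_Collect_eq mem_Times_iff fst_conv snd_conv)
    have m: "m \<in> Ext" using YE[OF Y] by simp
    show "(down ((fst (fst z) + wt (snd z), snd (fst z) \<oplus> snd z), snd z), snd ((fst (fst z) + wt (snd z), snd (fst z) \<oplus> snd z), snd z)) = z"
      using m by (simp add: zz down_def plus_minus)
    show "((fst (fst z) + wt (snd z), snd (fst z) \<oplus> snd z), snd z) \<in> shifts c"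
      using s b by (auto simp: zz shifts_def plus_apply PiE_def)
    have "bin (m \<oplus> b) b = bin (m \<oplus> b) m"
      using bin_symm[of b "m \<oplus> b"] m by (simp add: plus_minus plus_apply)
    thus "(case ((fst (fst z) + wt (snd z), snd (fst z) \<oplus> snd z), snd z) of (x, b) \<Rightarrow>
        \<sigma> (c x) * (\<tau> powi fst x * of_nat (bin (snd x) b) * U b * mono (fst x - wt b, snd x \<ominus> b))) = F z"
      using m by (simp add: zz F_def plus_minus mult_ac)
  next
    fix z assume z: "z \<in> shifts c"
    obtain w m b where zz: "z = ((w, m), b)" by (metis surj_pair)
    have s: "c (w, m) \<noteq> 0" and b: "b \<in> Ext" "\<And>s. s \<in> I \<Longrightarrow> b s \<le> m s"
      using z by (auto simp: zz shifts_def supp_def PiE_def)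
    have m: "m \<in> Ext" using laurentD(1)[OF c s] by simp
    note mp = minus_plus[OF m b(2)]
    show "((fst (fst (down z, snd z)) + wt (snd (down z, snd z)), snd (fst (down z, snd z)) \<oplus> snd (down z, snd z)), snd (down z, snd z)) = z"
      using mp by (simp add: zz down_def)
    have "deg b \<le> deg m" using b(2) by (auto simp: deg_def intro: sum_mono)
    hence "deg b \<le> N" using laurentD(2)[OF c s] d by simp
    hence "b \<in> Box" using b(1) deg_le_Box by blast
    thus "(down z, snd z) \<in> {z \<in> ?Y \<times> Box. (fst (fst z) + wt (snd z), snd (fst z) \<oplus> snd z) \<in> supp c}"
      using z s mp by (auto simp: zz down_def supp_def intro: rev_image_eqI)
  qed
  also have "\<dots> = (\<Sum>x\<in>supp c. \<Sum>b\<in>PiE I (\<lambda>s. {..snd x s}). \<sigma> (c x) * (\<tau> powi fst x * of_nat (bin (snd x) b) * U b * mono (fst x - wt b, snd x \<ominus> b)))"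
    unfolding shifts_def using laurentD(4)[OF c] I by (subst sum.Sigma) (auto intro: finite_PiE)
  also have "\<dots> = (\<Sum>x\<in>supp c. \<sigma> (c x) * \<sigma> (mono x))"
  proof (intro sum.cong refl)
    fix x assume "x \<in> supp c"
    hence "snd x \<in> Ext" using laurentD(1)[OF c] by (auto simp: supp_def)
    from \<sigma>_mono[OF this, of "fst x"] show "(\<Sum>b\<in>PiE I (\<lambda>s. {..snd x s}). \<sigma> (c x) * (\<tau> powi fst x * of_nat (bin (snd x) b) * U b * mono (fst x - wt b, snd x \<ominus> b))) = \<sigma> (c x) * \<sigma> (mono x)"
      by (simp add: sum_distrib_left)
  qed
  also have "\<dots> = \<sigma> (ev c)" by (simp add: ev_def \<sigma>_sum \<sigma>_mult)
  finally show ?thesis .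
qed

text \<open>In top degree only the zero shift contributes, so \<open>T\<close> acts there
  diagonally.\<close>

lemma T_top:
  assumes c: "laurent d c" and m: "m \<in> Ext" "deg m \<ge> d"
  shows "T c (w, m) = \<tau> powi w * \<sigma> (c (w, m))"
proof -
  have "T c (w, m) = (\<Sum>b\<in>Box. of_nat (bin (m \<oplus> b) m) * U b * \<tau> powi (w + wt b) * \<sigma> (c (w + wt b, m \<oplus> b)))"
    using m by (simp add: T_def)
  also have "\<dots> = (\<Sum>b\<in>{zz}. of_nat (bin (m \<oplus> b) m) * U b * \<tau> powi (w + wt b) * \<sigma> (c (w + wt b, m \<oplus> b)))"
  proof (rule sum.mono_neutral_right[OF finite_Box])
    show "{zz} \<subseteq> Box" using deg_le_Box[of zz] by simp
    show "\<forall>b\<in>Box - {zz}. of_nat (bin (m \<oplus> b) m) * U b * \<tau> powi (w + wt b) * \<sigma> (c (w + wt b, m \<oplus> b)) = 0"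
    proof
      fix b assume b: "b \<in> Box - {zz}"
      hence "deg b > 0" using deg_0[OF Box_Ext] by auto
      hence "c (w + wt b, m \<oplus> b) = 0"
        using laurentD(2)[OF c, of "(w + wt b, m \<oplus> b)"] m(2) by (force simp: deg_plus)
      thus "of_nat (bin (m \<oplus> b) m) * U b * \<tau> powi (w + wt b) * \<sigma> (c (w + wt b, m \<oplus> b)) = 0" by simp
    qed
  qed
  also have "\<dots> = \<tau> powi w * \<sigma> (c (w, m))"
    using m(1) by (simp add: plus_zz bin_def U_def zz_apply)
  finally show ?thesis .
qed

text \<open>Differentiation in the \<open>Y s\<close> commutes with their translations; on
  coefficients this is an identity between products of binomials.\<close>

lemma T_hasse:
  assumes a: "a \<in> Ext" shows "T (hasse a c) = hasse a (T c)"
proof (rule ext, clarify)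
  fix w m
  show "T (hasse a c) (w, m) = hasse a (T c) (w, m)"
  proof (cases "m \<in> Ext")
    case True
    have "of_nat (bin (m \<oplus> b) m) * U b * \<tau> powi (w + wt b) * \<sigma> (hasse a c (w + wt b, m \<oplus> b))
        = of_nat (bin (m \<oplus> a) a) * (of_nat (bin ((m \<oplus> a) \<oplus> b) (m \<oplus> a)) * U b * \<tau> powi (w + wt b) * \<sigma> (c (w + wt b, (m \<oplus> a) \<oplus> b)))" for b
    proof -
      have assoc: "(m \<oplus> b) \<oplus> a = (m \<oplus> a) \<oplus> b" by (simp add: plus_ext_def fun_eq_iff add_ac)
      have "bin (m \<oplus> b) m * bin ((m \<oplus> b) \<oplus> a) a = bin (m \<oplus> a) a * bin ((m \<oplus> a) \<oplus> b) (m \<oplus> a)"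
        unfolding bin_def prod.distrib[symmetric]
      proof (intro prod.cong refl)
        fix s assume s: "s \<in> I"
        have "((m s + a s + b s) choose (m s + a s)) * ((m s + a s) choose a s)
            = ((m s + a s + b s) choose a s) * ((m s + a s + b s - a s) choose (m s + a s - a s))"
          by (rule choose_mult) auto
        moreover have "m s + a s + b s - a s = m s + b s" by simp
        ultimately show "((m \<oplus> b) s choose m s) * (((m \<oplus> b) \<oplus> a) s choose a s) = ((m \<oplus> a) s choose a s) * (((m \<oplus> a) \<oplus> b) s choose (m \<oplus> a) s)"
          using s by (simp add: plus_apply mult.commute add_ac)
      qed
      hence "(of_nat (bin (m \<oplus> b) m) * of_nat (bin ((m \<oplus> b) \<oplus> a) a) :: 'a) = of_nat (bin (m \<oplus> a) a) * of_nat (bin ((m \<oplus> a) \<oplus> b) (m \<oplus> a))"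
        unfolding of_nat_mult[symmetric] by simp
      thus ?thesis by (simp add: hasse_def \<sigma>_mult assoc mult_ac)
    qed
    note eq = this
    have "T (hasse a c) (w, m) = (\<Sum>b\<in>Box. of_nat (bin (m \<oplus> b) m) * U b * \<tau> powi (w + wt b) * \<sigma> (hasse a c (w + wt b, m \<oplus> b)))"
      using True by (simp add: T_def)
    also have "\<dots> = of_nat (bin (m \<oplus> a) a) * T c (w, m \<oplus> a)"
      unfolding eq by (simp add: T_def sum_distrib_left)
    finally show ?thesis using True by (simp add: hasse_def)
  qed (simp add: T_def hasse_def)
qed

lemma hasse_laurent:
  assumes c: "laurent d c" and a: "a \<in> Ext" shows "laurent (d - deg a) (hasse a c)"
  unfolding laurent_def
proof (intro conjI allI ballI)
  let ?f = "\<lambda>x. (fst x, snd x \<oplus> a)"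
  have sub: "snd x \<in> Ext \<and> ?f x \<in> supp c" if "x \<in> supp (hasse a c)" for x
    using that by (auto simp: supp_def hasse_def case_prod_unfold split: if_splits)
  have "inj_on ?f (supp (hasse a c))"
  proof (rule inj_onI)
    fix x y assume *: "x \<in> supp (hasse a c)" "y \<in> supp (hasse a c)" "?f x = ?f y"
    hence "(snd x \<oplus> a) \<ominus> a = (snd y \<oplus> a) \<ominus> a" by simp
    thus "x = y" using sub[OF *(1)] sub[OF *(2)] *(3) by (simp add: plus_minus prod_eq_iff)
  qed
  moreover have "?f ` supp (hasse a c) \<subseteq> supp c" using sub by blast
  ultimately show "finite (supp (hasse a c))" using laurentD(4)[OF c] by (rule inj_on_finite)
  show "hasse a c x \<in> k" for x
    using laurentD(3)[OF c] by (auto simp: hasse_def case_prod_unfold intro: k_mult k_of_nat)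
  fix x assume "x \<in> supp (hasse a c)"
  from sub[OF this] have "snd x \<in> Ext" "c (?f x) \<noteq> 0" by (auto simp: supp_def)
  thus "snd x \<in> Ext" "deg (snd x) \<le> d - deg a" using laurentD(2)[OF c, of "?f x"] by (auto simp: deg_plus)
qed

text \<open>Take a relation of least degree \<open>D\<close> and, among those, one with fewest terms
  of degree \<open>D\<close>. Once one of these is normalised, \<open>T c2 - c2\<close> is a
  relation with fewer top terms and hence zero. If \<open>D\<close> were zero, \<open>eigen\<close>
  would reduce \<open>c2\<close> to the constant \<open>1\<close>, which is not a relation.\<close>

lemma invariant_exists:
  assumes c: "laurent d c" "d \<le> N" "c x \<noteq> 0" "ev c = 0"
  obtains c' where "laurent d c'" "T c' = c'" "\<exists>x. c' x \<noteq> 0 \<and> deg (snd x) > 0"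
proof -
  define V where "V = (\<lambda>D. {c. laurent D c \<and> ev c = 0 \<and> (\<exists>x. c x \<noteq> 0)})"
  define D where "D = (LEAST D. V D \<noteq> {})"
  have "V d \<noteq> {}" using c unfolding V_def by blast
  hence VD: "V D \<noteq> {}" and Dd: "D \<le> d"
    unfolding D_def by (rule LeastI, intro Least_le)
  have least: "V D' = {}" if "D' < D" for D' using not_less_Least[of D' "\<lambda>D. V D \<noteq> {}"] that by (auto simp: D_def)
  define top where "top = (\<lambda>c. {x \<in> supp c. deg (snd x) = D})"
  obtain c1 where c1: "c1 \<in> V D" and min: "\<And>c'. c' \<in> V D \<Longrightarrow> card (top c1) \<le> card (top c')"
    using VD ex_has_least_nat[of "\<lambda>c. c \<in> V D" _ "\<lambda>c. card (top c)"] by blast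
  have L1: "laurent D c1" and e1: "ev c1 = 0" and n1: "\<exists>x. c1 x \<noteq> 0" using c1 by (auto simp: V_def)
  have "\<exists>x0. c1 x0 \<noteq> 0 \<and> deg (snd x0) = D"
  proof (rule ccontr)
    assume no: "\<nexists>x0. c1 x0 \<noteq> 0 \<and> deg (snd x0) = D"
    have lt: "deg (snd x) < D" if "c1 x \<noteq> 0" for x
      using no laurentD(2)[OF L1 that] that le_neq_implies_less by blast
    hence "D > 0" using n1 by force
    moreover have "laurent (D - 1) c1"
      unfolding laurent_def using L1 lt by (force simp: laurent_def supp_def)
    ultimately show False using least[of "D - 1"] e1 n1 by (auto simp: V_def)
  qed
  then obtain x0 where x0: "c1 x0 \<noteq> 0" "deg (snd x0) = D" by blast
  define w0 where "w0 = fst x0"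
  \<comment> \<open>Dividing by \<open>c1 x0 * X powi w0\<close> makes the coefficient at
    \<open>(0, snd x0)\<close> equal to \<open>1\<close>, so \<open>T\<close> fixes it.\<close>
  define c2 where "c2 = (\<lambda>x. inverse (c1 x0) * c1 (fst x + w0, snd x))"
  have s2: "supp c2 = (\<lambda>x. (fst x - w0, snd x)) ` supp c1"
  proof (intro equalityI subsetI)
    fix x assume "x \<in> supp c2"
    hence "(fst x + w0, snd x) \<in> supp c1" by (simp add: supp_def c2_def)
    thus "x \<in> (\<lambda>x. (fst x - w0, snd x)) ` supp c1" by (rule rev_image_eqI) simp
  next
    fix x assume "x \<in> (\<lambda>x. (fst x - w0, snd x)) ` supp c1"
    thus "x \<in> supp c2" using x0(1) by (auto simp: supp_def c2_def)
  qed
  have inj: "inj_on (\<lambda>x. (fst x - w0, snd x)) B" for B :: "(int \<times> ('s \<Rightarrow> nat)) set"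
    by (auto simp: inj_on_def prod_eq_iff)
  have L2: "laurent D c2"
    unfolding laurent_def s2
    using L1 laurentD(3)[OF L1, of x0] by (auto simp: laurent_def c2_def intro!: k_mult k_inverse)
  have m2: "mono (fst x - w0, snd x) = X powi (- w0) * mono x" for x
    using X(1) power_int_add[of X "- w0" "fst x"] by (simp add: mono_def add.commute)
  have "ev c2 = (\<Sum>x\<in>supp c1. c2 (fst x - w0, snd x) * mono (fst x - w0, snd x))"
    unfolding ev_def s2 by (subst sum.reindex[OF inj]) simp
  also have "\<dots> = inverse (c1 x0) * X powi (- w0) * ev c1"
    unfolding ev_def sum_distrib_left m2 by (intro sum.cong refl) (simp add: c2_def mult_ac)
  finally have e2: "ev c2 = 0" using e1 by simp
  have c2_0: "c2 (0, snd x0) = 1" using x0 by (simp add: c2_def w0_def)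
  have "top c2 = (\<lambda>x. (fst x - w0, snd x)) ` top c1" unfolding top_def s2 by auto
  hence card2: "card (top c2) = card (top c1)" by (simp add: card_image inj)
  define dd where "dd = (\<lambda>x. T c2 x - c2 x)"
  have LT: "laurent D (T c2)" by (rule T_laurent[OF L2])
  have sdd: "supp dd \<subseteq> supp (T c2) \<union> supp c2" by (auto simp: dd_def supp_def)
  have Ldd: "laurent D dd" unfolding laurent_def
  proof (intro conjI allI ballI)
    show "finite (supp dd)" using finite_subset[OF sdd] laurentD(4)[OF L2] laurentD(4)[OF LT] by blast
    show "dd x \<in> k" for x using k_add[OF laurentD(3)[OF LT] k_minus[OF laurentD(3)[OF L2]], of x x] by (simp add: dd_def)
    fix x assume "x \<in> supp dd"
    hence "x \<in> supp (T c2) \<union> supp c2" using sdd by blast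
    thus "snd x \<in> Ext" "deg (snd x) \<le> D" using L2 LT unfolding laurent_def by blast+
  qed
  have "ev dd = (\<Sum>x\<in>supp (T c2) \<union> supp c2. (T c2 x - c2 x) * mono x)"
    using ev_superset[OF _ sdd] laurentD(4)[OF L2] laurentD(4)[OF LT] by (simp add: dd_def)
  also have "\<dots> = ev (T c2) - ev c2"
    using ev_superset[of "supp (T c2) \<union> supp c2" "T c2"] ev_superset[of "supp (T c2) \<union> supp c2" c2] laurentD(4)[OF L2] laurentD(4)[OF LT]
    by (simp add: left_diff_distrib sum_subtractf)
  also have "\<dots> = 0" using ev_T[OF L2] Dd c(2) e2 by simp
  finally have edd: "ev dd = 0" .
  have "dd x = 0" for x
  proof (rule ccontr)
    assume "dd x \<noteq> 0"
    hence "dd \<in> V D" using Ldd edd unfolding V_def by blast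
    hence "card (top c1) \<le> card (top dd)" by (rule min)
    moreover have "top dd \<subset> top c2"
    proof
      show "top dd \<subseteq> top c2"
      proof
        fix y assume y: "y \<in> top dd"
        hence "snd y \<in> Ext" "deg (snd y) = D" "dd y \<noteq> 0" using laurentD(1)[OF Ldd] by (auto simp: top_def supp_def)
        hence "c2 y \<noteq> 0" using T_top[OF L2, of "snd y" "fst y"] by (auto simp: dd_def)
        thus "y \<in> top c2" using y by (auto simp: top_def supp_def)
      qed
      have "(0, snd x0) \<in> top c2" using c2_0 x0 by (simp add: top_def supp_def)
      moreover have "dd (0, snd x0) = 0"
        using T_top[OF L2 laurentD(1)[OF L1 x0(1)] eq_imp_le[OF x0(2)[symmetric]], of 0] unfolding dd_def c2_0 by simp
      moreover from this have "(0, snd x0) \<notin> top dd" by (simp add: top_def supp_def)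
      ultimately show "top dd \<noteq> top c2" by metis
    qed
    moreover have "finite (top c2)" using laurentD(4)[OF L2] by (simp add: top_def)
    ultimately show False using psubset_card_mono[of "top c2" "top dd"] card2 by linarith
  qed
  hence inv: "T c2 = c2" by (auto simp: dd_def fun_eq_iff)
  have "D > 0"
  proof (rule ccontr)
    assume "\<not> D > 0"
    hence D0: "D = 0" by simp
    have "supp c2 = {(0, zz)}"
    proof (intro equalityI subsetI)
      fix y assume "y \<in> supp c2"
      hence y: "c2 y \<noteq> 0" "snd y \<in> Ext" "deg (snd y) = 0" using laurentD(1,2)[OF L2, of y] D0 by (auto simp: supp_def)
      have "\<sigma> (c2 y) * \<tau> powi fst y = c2 y"
        using T_top[OF L2 y(2), of "fst y"] inv D0 by (simp add: mult.commute)
      hence "fst y = 0" using eigen laurentD(3)[OF L2] y(1) by blast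
      thus "y \<in> {(0, zz)}" using deg_0[OF y(2,3)] by (simp add: prod_eq_iff)
    next
      fix y :: "int \<times> ('s \<Rightarrow> nat)" assume "y \<in> {(0, zz)}"
      moreover have "snd x0 = zz" using deg_0 laurentD(1)[OF L1 x0(1)] x0(2) D0 by blast
      ultimately show "y \<in> supp c2" using c2_0 by (simp add: supp_def)
    qed
    moreover have "snd x0 = zz" using deg_0 laurentD(1)[OF L1 x0(1)] x0(2) D0 by blast
    ultimately have "ev c2 = 1" using c2_0 by (simp add: ev_def mono_def zz_apply)
    thus False using e2 by simp
  qed
  moreover have "laurent d c2" using L2 Dd unfolding laurent_def by force
  moreover have "c2 (0, snd x0) \<noteq> 0" using c2_0 by simp
  ultimately show ?thesis using that[of c2] inv x0(2) snd_conv by metis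
qed

definition single :: "'s \<Rightarrow> nat \<Rightarrow> 's \<Rightarrow> nat" where
  "single s j = (\<lambda>s'\<in>I. if s' = s then j else 0)"

lemma single_Ext [simp]: "single s j \<in> Ext" by (simp add: single_def)

lemma single_apply: "s' \<in> I \<Longrightarrow> single s j s' = (if s' = s then j else 0)" by (simp add: single_def)

lemma deg_single: "s \<in> I \<Longrightarrow> deg (single s j) = j"
  unfolding deg_def using I by (simp add: single_apply cong: sum.cong)

lemma wt_single: "s \<in> I \<Longrightarrow> wt (single s j) = int (n s * j)"
proof -
  assume s: "s \<in> I"
  have "wt (single s j) = (\<Sum>s'\<in>I. if s' = s then int (n s * j) else 0)"
    unfolding wt_def by (intro sum.cong) (auto simp: single_apply)
  thus ?thesis using I s by simp
qed

lemma U_single: "s \<in> I \<Longrightarrow> U (single s j) = (- u s) ^ j"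
proof -
  assume s: "s \<in> I"
  have "U (single s j) = (\<Prod>s'\<in>I. if s' = s then (- u s) ^ j else 1)"
    unfolding U_def by (intro prod.cong) (auto simp: single_apply)
  thus ?thesis using I s by simp
qed

text \<open>A nonconstant invariant of minimal degree is an additive polynomial plus a constant, because
  its Hasse derivatives are invariants of smaller degree.\<close>
theorem additive_relation:
  assumes c: "laurent N c" "c x \<noteq> 0" "ev c = 0"
  obtains s0 i \<kappa> h where "s0 \<in> I" "\<And>s. \<kappa> s \<in> k \<and> \<sigma> (\<kappa> s) = \<kappa> s" "\<kappa> s0 \<noteq> 0" "h \<in> k"
    "(\<Sum>s\<in>{s\<in>I. n s = n s0}. \<kappa> s * (- u s) ^ (p ^ i)) = h - \<tau> powi (- int (n s0 * p ^ i)) * \<sigma> h"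
proof -
  define V where "V = (\<lambda>D. {c. laurent D c \<and> T c = c \<and> (\<exists>x. c x \<noteq> 0 \<and> deg (snd x) > 0)})"
  define D where "D = (LEAST D. V D \<noteq> {})"
  obtain c' where "laurent N c'" "T c' = c'" "\<exists>x. c' x \<noteq> 0 \<and> deg (snd x) > 0"
    by (rule invariant_exists[OF c(1) order_refl c(2,3)])
  hence "c' \<in> V N" by (simp add: V_def)
  hence "V N \<noteq> {}" by blast
  hence VD: "V D \<noteq> {}" and DN: "D \<le> N"
    unfolding D_def by (rule LeastI, intro Least_le)
  have least: "V D' = {}" if "D' < D" for D' using not_less_Least[of D' "\<lambda>D. V D \<noteq> {}"] that by (auto simp: D_def)
  from VD obtain c1 where L: "laurent D c1" and inv: "T c1 = c1" and nc: "\<exists>x. c1 x \<noteq> 0 \<and> deg (snd x) > 0"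
    unfolding V_def by blast
  have D0: "D > 0" using nc laurentD(2)[OF L] by force
  \<comment> \<open>A derivative of positive order is an invariant of smaller degree, so by
    minimality it has only terms of degree zero.\<close>
  have hasse_const: "hasse a c1 (w, m) = 0" if a: "a \<in> Ext" "deg a > 0" and m: "deg m > 0" for a w m
  proof (rule ccontr)
    assume nz: "hasse a c1 (w, m) \<noteq> 0"
    have "hasse a c1 \<in> V (D - deg a)"
      unfolding V_def using hasse_laurent[OF L a(1)] T_hasse[OF a(1), of c1] inv nz m by force
    thus False using least[of "D - deg a"] a(2) D0 by force
  qed
  have split0: "c1 (w, M) = 0 \<or> of_nat (bin M a) = (0 :: 'a)" if "M \<in> Ext" "a \<in> Ext" "\<And>s. s \<in> I \<Longrightarrow> a s \<le> M s" "deg a > 0" "deg a < deg M" for w M a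
  proof -
    have mp: "(M \<ominus> a) \<oplus> a = M" using minus_plus that by blast
    hence "deg (M \<ominus> a) > 0" using that(5) deg_plus[of "M \<ominus> a" a] by simp
    from hasse_const[OF that(2,4) this, of w] mp show ?thesis by (auto simp: hasse_def)
  qed
  \<comment> \<open>By \<open>split0\<close> the intermediate binomials of an occurring monomial
    vanish modulo \<open>p\<close>. In a monomial with two variables the pure part in one of them
    has binomial \<open>1\<close>; an exponent that is not a power of \<open>p\<close> is excluded
    by \<open>choose_not_all_zero\<close>.\<close>
  have shape: "\<exists>s i. s \<in> I \<and> M = single s (p ^ i)" if M: "c1 (w, M) \<noteq> 0" "deg M > 0" for w M
  proof -
    have ME: "M \<in> Ext" using laurentD(1)[OF L M(1)] by simp
    have "\<exists>s\<in>I. M s \<noteq> 0"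
    proof (rule ccontr)
      assume "\<not> (\<exists>s\<in>I. M s \<noteq> 0)"
      thus False using M(2) by (simp add: deg_def)
    qed
    then obtain s where s: "s \<in> I" "M s > 0" by auto
    have le: "single s j s' \<le> M s'" if "s' \<in> I" "j \<le> M s" for s' j using that by (simp add: single_apply)
    have binS: "bin M (single s j) = M s choose j" for j
    proof -
      have "bin M (single s j) = (\<Prod>s'\<in>I. if s' = s then M s choose j else 1)"
        unfolding bin_def by (intro prod.cong) (auto simp: single_apply)
      thus ?thesis using I s by simp
    qed
    have degM: "deg M = M s"
    proof (rule ccontr)
      assume ne: "deg M \<noteq> M s"
      have "M s \<le> deg M" unfolding deg_def using I s by (intro member_le_sum) auto
      hence "deg (single s (M s)) < deg M" using ne s by (simp add: deg_single)
      hence "of_nat (bin M (single s (M s))) = (0 :: 'a)"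
        using split0[OF ME single_Ext le] M(1) s by (auto simp: deg_single)
      thus False by (simp add: binS)
    qed
    have Msing: "M = single s (M s)"
    proof (rule extensionalityI[OF ME single_Ext])
      fix s' assume s': "s' \<in> I"
      show "M s' = single s (M s) s'"
      proof (cases "s' = s")
        case False
        have "M s + (\<Sum>t\<in>I - {s}. M t) = M s" using degM sum.remove[OF I s(1), of M] by (simp add: deg_def)
        hence "M s' = 0" using False s' I by simp
        thus ?thesis using False s' by (simp add: single_apply)
      qed (use s' in \<open>simp add: single_apply\<close>)
    qed
    have "\<exists>i. M s = p ^ i"
    proof (rule ccontr)
      assume "\<nexists>i. M s = p ^ i"
      from choose_not_all_zero[OF p s(2) this] obtain j where j: "0 < j" "j < M s" "of_nat (M s choose j) \<noteq> (0 :: 'a)" by blast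
      have "of_nat (bin M (single s j)) = (0 :: 'a)"
        using split0[OF ME single_Ext le, of j] M(1) j s degM by (auto simp: deg_single)
      thus False using j(3) by (simp add: binS)
    qed
    thus ?thesis using Msing s(1) by metis
  qed
  \<comment> \<open>Differentiating by \<open>M\<close> itself isolates its coefficient in an
    invariant of degree zero, to which \<open>eigen\<close> applies.\<close>
  have const: "w = 0 \<and> \<sigma> (c1 (w, M)) = c1 (w, M)" if M: "c1 (w, M) \<noteq> 0" "deg M > 0" for w M
  proof -
    have ME: "M \<in> Ext" using laurentD(1)[OF L M(1)] by simp
    let ?h = "hasse M c1"
    have "laurent 0 ?h"
      unfolding laurent_def
    proof (intro conjI allI ballI)
      have "laurent (D - deg M) ?h" by (rule hasse_laurent[OF L ME])
      thus "finite (supp ?h)" "?h x \<in> k" "x \<in> supp ?h \<Longrightarrow> snd x \<in> Ext" for x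
        unfolding laurent_def by blast+
      show "x \<in> supp ?h \<Longrightarrow> deg (snd x) \<le> 0" for x
        using hasse_const[OF ME M(2), of "snd x" "fst x"] by (force simp: supp_def)
    qed
    from T_top[OF this zz_Ext, of w] have "?h (w, zz) = \<tau> powi w * \<sigma> (?h (w, zz))"
      using T_hasse[OF ME, of c1] inv by simp
    moreover have "?h (w, zz) = c1 (w, M)" using ME by (simp add: hasse_def zz_plus bin_def)
    ultimately have eq: "\<sigma> (c1 (w, M)) * \<tau> powi w = c1 (w, M)" by (simp add: mult.commute)
    hence "w = 0" using eigen laurentD(3)[OF L] M(1) by blast
    thus ?thesis using eq by simp
  qed
  obtain s0 i where s0: "s0 \<in> I" and i: "c1 (0, single s0 (p ^ i)) \<noteq> 0"
  proof -
    obtain w M where wM: "c1 (w, M) \<noteq> 0" "deg M > 0" using nc by force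
    obtain s i where "s \<in> I" "M = single s (p ^ i)" using shape[OF wM] by blast
    moreover have "w = 0" using const[OF wM] by simp
    ultimately show ?thesis using that wM by blast
  qed
  define P where "P = p ^ i"
  have P0: "P > 0" using p(1) by (simp add: P_def prime_gt_0_nat)
  have PN: "P \<le> N" using laurentD(2)[OF L i] s0 DN by (simp add: deg_single P_def)
  define w where "w = int (n s0 * P)"
  define \<kappa> where "\<kappa> = (\<lambda>s. if s \<in> I then c1 (0, single s P) else 0)"
  \<comment> \<open>Invariance is read off at \<open>X powi (- w)\<close> in degree zero. A term
    \<open>Y s ^ (p ^ j)\<close> lands there only if \<open>n s * p ^ j = n s0 * p ^ i\<close>, and
    \<open>n_indep\<close> then forces \<open>n s = n s0\<close> and equal powers of
    \<open>p\<close>.\<close>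
  define h where "h = c1 (- w, zz)"
  have \<kappa>: "\<kappa> s \<in> k \<and> \<sigma> (\<kappa> s) = \<kappa> s" for s
  proof (cases "s \<in> I \<and> \<kappa> s \<noteq> 0")
    case True
    hence "c1 (0, single s P) \<noteq> 0" by (auto simp: \<kappa>_def)
    thus ?thesis using const[of 0 "single s P"] laurentD(3)[OF L] P0 True by (auto simp: \<kappa>_def deg_single)
  qed (auto simp: \<kappa>_def)
  let ?f = "\<lambda>b. of_nat (bin (zz \<oplus> b) zz) * U b * \<tau> powi (- w + wt b) * \<sigma> (c1 (- w + wt b, zz \<oplus> b))"
  have zB: "zz \<in> Box" using deg_le_Box[of zz] by simp
  have "h = T c1 (- w, zz)" by (simp add: h_def inv)
  also have "\<dots> = (\<Sum>b\<in>Box. ?f b)" by (simp add: T_def)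
  also have "\<dots> = ?f zz + (\<Sum>b\<in>Box - {zz}. ?f b)" by (rule sum.remove[OF finite_Box zB])
  also have "?f zz = \<tau> powi (- w) * \<sigma> h" by (simp add: h_def zz_plus bin_def U_def zz_apply)
  also have "(\<Sum>b\<in>Box - {zz}. ?f b) = (\<Sum>b\<in>(\<lambda>s. single s P) ` {s\<in>I. n s = n s0}. ?f b)"
  proof (rule sum.mono_neutral_right)
    show "(\<lambda>s. single s P) ` {s\<in>I. n s = n s0} \<subseteq> Box - {zz}"
    proof (rule image_subsetI)
      fix s assume "s \<in> {s\<in>I. n s = n s0}"
      hence "deg (single s P) = P" by (simp add: deg_single)
      thus "single s P \<in> Box - {zz}" using P0 PN deg_le_Box[OF single_Ext, of s P] deg_zz by force
    qed
    show "\<forall>b\<in>Box - {zz} - (\<lambda>s. single s P) ` {s\<in>I. n s = n s0}. ?f b = 0"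
    proof (rule ballI, rule ccontr)
      fix b assume b: "b \<in> Box - {zz} - (\<lambda>s. single s P) ` {s\<in>I. n s = n s0}" and nz: "?f b \<noteq> 0"
      have bE: "b \<in> Ext" using b Box_Ext by blast
      have db: "deg b > 0" using b deg_0[OF bE] by auto
      have nz': "c1 (- w + wt b, b) \<noteq> 0" using nz by (auto simp: zz_plus[OF bE])
      obtain s j where s: "s \<in> I" "b = single s (p ^ j)" using shape[OF nz' db] by blast
      have "- w + wt b = 0" using const[OF nz' db] by simp
      hence eq: "n s * p ^ j = n s0 * p ^ i" using s by (simp add: wt_single w_def P_def flip: of_nat_mult of_nat_power)
      hence ns: "n s = n s0" using n_indep s(1) s0 by blast
      hence "p ^ j = p ^ i" using eq n[OF s0] by simp
      thus False using b s ns by (auto simp: P_def)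
    qed
  qed (use finite_Box in auto)
  also have "\<dots> = (\<Sum>s\<in>{s\<in>I. n s = n s0}. ?f (single s P))"
  proof (rule sum.reindex[unfolded o_def], rule inj_onI)
    fix s s' assume s: "s \<in> {s\<in>I. n s = n s0}" "s' \<in> {s\<in>I. n s = n s0}" "single s P = single s' P"
    from fun_cong[OF s(3), of s] show "s = s'" using s(1,2) P0 by (auto simp: single_apply split: if_splits)
  qed
  also have "\<dots> = (\<Sum>s\<in>{s\<in>I. n s = n s0}. \<kappa> s * (- u s) ^ P)"
  proof (intro sum.cong refl)
    fix s assume s: "s \<in> {s\<in>I. n s = n s0}"
    hence "wt (single s P) = w" by (simp add: wt_single w_def)
    thus "?f (single s P) = \<kappa> s * (- u s) ^ P"
      using s \<kappa>[of s] by (simp add: zz_plus bin_def zz_apply U_single \<kappa>_def mult.commute)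
  qed
  finally have "(\<Sum>s\<in>{s\<in>I. n s = n s0}. \<kappa> s * (- u s) ^ P) = h - \<tau> powi (- w) * \<sigma> h"
    by (simp add: algebra_simps)
  moreover have "\<kappa> s0 \<noteq> 0" using i s0 by (simp add: \<kappa>_def P_def)
  moreover have "h \<in> k" using laurentD(3)[OF L] by (simp add: h_def)
  ultimately show ?thesis using that[of s0 \<kappa> h i] s0 \<kappa> unfolding w_def P_def by metis
qed

end

section \<open>Descent to a linear relation\<close>

lemma fps_eventually_zero_poly:
  assumes "\<And>k. k \<ge> n \<Longrightarrow> (f :: 'a::comm_ring_1 fps) $ k = 0"
  obtains P where "f = fps_of_poly P"
proof -
  have "f = fps_of_poly (\<Sum>k<n. monom (f $ k) k)"
    using assms by (intro fps_ext) (simp add: coeff_sum not_less)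
  thus ?thesis using that by blast
qed

context frob_basis
begin

text \<open>The \<open>K\<close>-span of \<open>G\<close>, described by clearing denominators;
  \<open>G_mult\<close> makes it closed under multiplication.\<close>

definition K0 :: "'a set" where "K0 = {x. \<exists>b\<in>Ainf. b \<noteq> 0 \<and> (\<exists>S. b * x \<in> OG G S)}"

lemma OG_common: "x \<in> OG G S \<Longrightarrow> y \<in> OG G T \<Longrightarrow> x \<in> OG G (max S T) \<and> y \<in> OG G (max S T)"
  using OG_mono by (meson max.cobounded1 max.cobounded2)

lemma OG_scale_Ainf: "a \<in> Ainf \<Longrightarrow> x \<in> OG G S \<Longrightarrow> \<exists>T. a * x \<in> OG G T"
  unfolding Ainf_def using OG_scale by blast

lemma K0_0: "0 \<in> K0"
  unfolding K0_def by (auto intro!: bexI[of _ 1])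

lemma K0_add: "x \<in> K0 \<Longrightarrow> y \<in> K0 \<Longrightarrow> x + y \<in> K0"
proof -
  assume "x \<in> K0" "y \<in> K0"
  then obtain a b S T where a: "a \<in> Ainf" "a \<noteq> 0" "a * x \<in> OG G S" and b: "b \<in> Ainf" "b \<noteq> 0" "b * y \<in> OG G T"
    unfolding K0_def by blast
  obtain S' where S': "b * (a * x) \<in> OG G S'" using OG_scale_Ainf[OF b(1) a(3)] by blast
  obtain T' where T': "a * (b * y) \<in> OG G T'" using OG_scale_Ainf[OF a(1) b(3)] by blast
  have "b * (a * x) + a * (b * y) \<in> OG G (max S' T')" using OG_common[OF S' T'] OG_add by blast
  hence "(a * b) * (x + y) \<in> OG G (max S' T')" by (simp add: algebra_simps)
  thus ?thesis unfolding K0_def using a b by (auto intro!: bexI[of _ "a * b"] Ainf_mult)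
qed

lemma K0_mult: "x \<in> K0 \<Longrightarrow> y \<in> K0 \<Longrightarrow> x * y \<in> K0"
proof -
  assume "x \<in> K0" "y \<in> K0"
  then obtain a b S T where a: "a \<in> Ainf" "a \<noteq> 0" "a * x \<in> OG G S" and b: "b \<in> Ainf" "b \<noteq> 0" "b * y \<in> OG G T"
    unfolding K0_def by blast
  have "(a * x) * (b * y) \<in> OG G (S + T + c0)" by (rule OG_mult[OF a(3) b(3)])
  hence "(a * b) * (x * y) \<in> OG G (S + T + c0)" by (simp add: mult_ac)
  thus ?thesis unfolding K0_def using a b by (auto intro!: bexI[of _ "a * b"] Ainf_mult)
qed

lemma K0_minus: "x \<in> K0 \<Longrightarrow> - x \<in> K0"
  unfolding K0_def using OG_minus by force

lemma K0_sum: "(\<And>i. i \<in> I \<Longrightarrow> f i \<in> K0) \<Longrightarrow> sum f I \<in> K0"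
  by (induction I rule: infinite_finite_induct) (auto intro: K0_add K0_0)

lemma K0_Ainf: "1 \<in> K0 \<Longrightarrow> x \<in> Ainf \<Longrightarrow> x \<in> K0"
proof -
  assume "1 \<in> K0" and x: "x \<in> Ainf"
  then obtain b S where b: "b \<in> Ainf" "b \<noteq> 0" "b * 1 \<in> OG G S" unfolding K0_def by blast
  obtain T where "x * (b * 1) \<in> OG G T" using OG_scale_Ainf[OF x b(3)] by blast
  thus ?thesis unfolding K0_def using b by (auto simp: mult.commute intro!: bexI[of _ b])
qed

lemma K0_common_denominator:
  assumes "finite Y" "Y \<subseteq> K0"
  obtains b S where "b \<in> Ainf" "b \<noteq> 0" "\<And>y. y \<in> Y \<Longrightarrow> b * y \<in> OG G S"
proof -
  from assms have "\<exists>b\<in>Ainf. b \<noteq> 0 \<and> (\<exists>S. \<forall>y\<in>Y. b * y \<in> OG G S)"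
  proof (induction Y rule: finite_induct)
    case (insert x Y)
    then obtain b S where b: "b \<in> Ainf" "b \<noteq> 0" "\<forall>y\<in>Y. b * y \<in> OG G S" by auto
    obtain a T where a: "a \<in> Ainf" "a \<noteq> 0" "a * x \<in> OG G T" using insert.prems unfolding K0_def by auto
    obtain T' where T': "b * (a * x) \<in> OG G T'" using OG_scale_Ainf[OF b(1) a(3)] by blast
    obtain r where r: "a \<in> A r" using a(1) by (auto simp: Ainf_def)
    have Y: "(a * b) * y \<in> OG G (r + S)" if "y \<in> Y" for y
      using OG_scale[OF r, of "b * y" G S] b(3) that by (simp add: mult.assoc)
    have "(a * b) * y \<in> OG G (max (r + S) T')" if "y \<in> insert x Y" for y
    proof (cases "y = x")
      case True
      have "(a * b) * x \<in> OG G T'" using T' by (simp add: mult_ac)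
      thus ?thesis unfolding True by (rule OG_mono) simp
    next
      case False
      hence "(a * b) * y \<in> OG G (r + S)" using that by (intro Y) simp
      thus ?thesis by (rule OG_mono) simp
    qed
    moreover have "a * b \<in> Ainf" "a * b \<noteq> 0" using a b by (auto intro: Ainf_mult)
    ultimately show ?case by blast
  qed (auto intro!: bexI[of _ 1])
  thus ?thesis using that by blast
qed

definition PK :: "'a poly set" where "PK = {P. \<forall>k. coeff P k \<in> K0}"

lemma PK_mult: "P \<in> PK \<Longrightarrow> Q \<in> PK \<Longrightarrow> P * Q \<in> PK"
  by (auto simp: PK_def coeff_mult intro!: K0_sum K0_mult)

lemma PK_minus: "P \<in> PK \<Longrightarrow> - P \<in> PK"
  by (auto simp: PK_def intro: K0_minus)

lemma PK_const: "c \<in> K0 \<Longrightarrow> [:c:] \<in> PK"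
  by (auto simp: PK_def coeff_pCons K0_0 split: nat.splits)

lemma PK_power: "1 \<in> K0 \<Longrightarrow> P \<in> PK \<Longrightarrow> P ^ i \<in> PK"
  by (induction i) (auto intro: PK_mult simp: PK_const one_pCons)

lemma PK_prod: "1 \<in> K0 \<Longrightarrow> (\<And>i. i \<in> I \<Longrightarrow> f i \<in> PK) \<Longrightarrow> prod f I \<in> PK"
  by (induction I rule: infinite_finite_induct) (auto intro: PK_mult simp: PK_const one_pCons)

lemma K0_of_nat: "1 \<in> K0 \<Longrightarrow> of_nat i \<in> K0"
  by (induction i) (auto intro: K0_add K0_0)

end

context frob_field
begin

definition lin :: "'c poly" where "lin = [:- (\<theta> ^ q), 1:]"

lemma fps_lin: "fps_of_poly lin = fps_X - fps_const (\<theta> ^ q)"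
  unfolding lin_def by (simp add: fps_of_poly_linear flip: fps_const_neg)

lemma lin_nz [simp]: "lin \<noteq> 0" by (simp add: lin_def)

lemma theta_Ainf: "\<theta> ^ k \<in> Ainf"
  using A_theta[of 1 0 k] by (auto simp: Ainf_def)

text \<open>The vector of all monomials with exponents at most \<open>M\<close> satisfies a linear Frobenius
  difference system, so a relation between its values lifts to a relation between functions.\<close>
lemma lift_relation:
  fixes H :: "'x \<Rightarrow> 'c fps"
  assumes I: "finite I"
    and H: "\<And>x. x \<in> I \<Longrightarrow> fbd rad (H x)" "\<And>x. x \<in> I \<Longrightarrow> has_val rad (H x) \<theta> (v x)"
      "\<And>x. x \<in> I \<Longrightarrow> tw q (H x) = fps_of_poly lin ^ n x * (H x - fps_of_poly (u x))"
    and u: "\<And>x k. x \<in> I \<Longrightarrow> coeff (u x) k \<in> Kbar q \<theta>"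
    and J: "J = PiE I (\<lambda>_. {..M})"
    and \<rho>: "\<And>m. m \<in> J \<Longrightarrow> \<rho> m \<in> Kbar q \<theta>" "m0 \<in> J" "\<rho> m0 \<noteq> 0" "(\<Sum>m\<in>J. \<rho> m * (\<Prod>x\<in>I. v x ^ m x)) = 0"
  obtains P where "\<exists>m\<in>J. P m \<noteq> 0" "(\<Sum>m\<in>J. fps_of_poly (P m) * (\<Prod>x\<in>I. H x ^ m x)) = 0"
proof -
  have J_fin: "finite J" unfolding J using I by (intro finite_PiE) auto
  define Z where "Z = (\<Union>x\<in>I. coeff (u x) ` {..degree (u x)}) \<union> \<rho> ` J"
  have Z: "finite Z" "Z \<subseteq> Kbar q \<theta>" using I J_fin u \<rho>(1) by (auto simp: Z_def)
  obtain G c0 where B: "frob_basis av p e q \<theta> G c0"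
    and G: "\<And>z. z \<in> insert 1 Z \<Longrightarrow> \<exists>b\<in>Ainf. b \<noteq> 0 \<and> (\<exists>S. b * z \<in> OG G S)"
  proof (rule integral_basis[OF Z])
    fix G c assume *: "finite G" "G \<noteq> {}" "0 \<notin> G" "\<And>g h. g \<in> G \<Longrightarrow> h \<in> G \<Longrightarrow> g * h \<in> OG G c"
      "\<And>a. (\<forall>g\<in>G. a g \<in> Ainf) \<Longrightarrow> (\<Sum>g\<in>G. a g * g) = 0 \<Longrightarrow> \<forall>g\<in>G. a g = 0"
      and d: "\<And>z. z \<in> insert 1 Z \<Longrightarrow> \<exists>b\<in>Ainf. b \<noteq> 0 \<and> (\<exists>S. b * z \<in> OG G S)"
    have "frob_basis av p e q \<theta> G c"
      using frob_field_axioms by (rule frob_basis.intro, unfold frob_basis_axioms_def) (intro conjI * allI impI; assumption)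
    thus thesis using d by (rule that)
  qed
  interpret B: frob_basis av p e q \<theta> G c0 by (rule B)
  have one: "1 \<in> B.K0" and ZK: "\<And>z. z \<in> Z \<Longrightarrow> z \<in> B.K0" using G unfolding B.K0_def by blast+
  have uK: "u x \<in> B.PK" if x: "x \<in> I" for x
    unfolding B.PK_def
  proof safe
    fix k show "coeff (u x) k \<in> B.K0"
    proof (cases "k \<le> degree (u x)")
      case True
      thus ?thesis using x by (intro ZK) (auto simp: Z_def)
    qed (simp add: coeff_eq_0 B.K0_0)
  qed
  have linK: "lin \<in> B.PK"
    using B.K0_minus[OF B.K0_Ainf[OF one theta_Ainf[of q]]] one
    by (auto simp: B.PK_def lin_def coeff_pCons B.K0_0 split: nat.splits)
  \<comment> \<open>Factor by factor, the coefficients in the binomial expansion of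
    \<open>lin ^ (n x * m x) * (H x - u x) ^ m x\<close>, the Frobenius image of
    \<open>H x ^ m x\<close>.\<close>
  define BB where "BB = (\<lambda>m m'. \<Prod>x\<in>I. lin ^ (n x * m x) * [:of_nat (m x choose m' x):] * (- u x) ^ (m x - m' x))"
  have BBK: "BB m m' \<in> B.PK" for m m'
    unfolding BB_def using one uK linK
    by (intro B.PK_prod B.PK_mult B.PK_power B.PK_const B.K0_of_nat B.PK_minus) auto
  \<comment> \<open>Includes \<open>1\<close> so that the denominator \<open>b\<close> itself has
    size \<open>s0\<close>.\<close>
  define Y where "Y = insert 1 (\<rho> ` J \<union> (\<Union>m\<in>J. \<Union>m'\<in>J. coeff (BB m m') ` {..degree (BB m m')}))"
  have "finite Y" using J_fin by (auto simp: Y_def)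
  moreover have "Y \<subseteq> B.K0" using one ZK BBK by (auto simp: Y_def Z_def B.PK_def)
  ultimately obtain b S where b: "b \<in> Ainf" "b \<noteq> 0" "\<And>y. y \<in> Y \<Longrightarrow> b * y \<in> OG G S"
    using B.K0_common_denominator by blast
  define s0 where "s0 = S + c0"
  have bW: "b * y \<in> B.W s0" if "y \<in> Y" for y using b(3)[OF that] by (simp add: B.W_def s0_def)
  define \<delta> where "\<delta> = Suc (Max ((\<lambda>(m, m'). degree (BB m m')) ` (J \<times> J)))"
  have deg: "degree (BB m m') < \<delta>" if "m \<in> J" "m' \<in> J" for m m'
  proof -
    have "degree (BB m m') \<le> Max ((\<lambda>(m, m'). degree (BB m m')) ` (J \<times> J))"
      using J_fin that by (intro Max_ge) (auto intro!: rev_image_eqI[of "(m, m')"])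
    thus ?thesis by (simp add: \<delta>_def)
  qed
  define \<psi> where "\<psi> = (\<lambda>m. \<Prod>x\<in>I. H x ^ m x)"
  have fe: "tw q (\<psi> m) = (\<Sum>m'\<in>J. fps_of_poly (BB m m') * \<psi> m')" if m: "m \<in> J" for m
  proof -
    have one_var: "tw q (H x ^ m x) = (\<Sum>i\<le>M. fps_of_poly (lin ^ (n x * m x) * [:of_nat (m x choose i):] * (- u x) ^ (m x - i)) * H x ^ i)"
      if x: "x \<in> I" for x
    proof -
      have mx: "m x \<le> M" using m x J by auto
      have "tw q (H x ^ m x) = fps_of_poly lin ^ (n x * m x) * (H x + fps_of_poly (- u x)) ^ m x"
        unfolding tw_power[OF frobexp_q] H(3)[OF x] by (simp add: power_mult_distrib fps_of_poly_uminus flip: power_mult)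
      also have "(H x + fps_of_poly (- u x)) ^ m x = (\<Sum>i\<le>m x. of_nat (m x choose i) * H x ^ i * fps_of_poly (- u x) ^ (m x - i))"
        by (rule binomial_ring)
      also have "\<dots> = (\<Sum>i\<le>M. of_nat (m x choose i) * H x ^ i * fps_of_poly (- u x) ^ (m x - i))"
        using mx by (intro sum.mono_neutral_left) (auto simp: binomial_eq_0)
      finally show ?thesis
        by (simp add: sum_distrib_left fps_of_poly_mult fps_of_poly_power fps_of_poly_smult fps_of_nat mult_ac)
    qed
    have "tw q (\<psi> m) = (\<Prod>x\<in>I. \<Sum>i\<le>M. fps_of_poly (lin ^ (n x * m x) * [:of_nat (m x choose i):] * (- u x) ^ (m x - i)) * H x ^ i)"
      unfolding \<psi>_def tw_prod[OF frobexp_q] by (intro prod.cong refl one_var)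
    also have "\<dots> = (\<Sum>m'\<in>J. \<Prod>x\<in>I. fps_of_poly (lin ^ (n x * m x) * [:of_nat (m x choose m' x):] * (- u x) ^ (m x - m' x)) * H x ^ m' x)"
      unfolding J using I by (subst prod_sum_PiE) auto
    also have "\<dots> = (\<Sum>m'\<in>J. fps_of_poly (BB m m') * \<psi> m')"
      by (simp only: prod.distrib BB_def \<psi>_def fps_of_poly_prod fps_of_poly_mult)
    finally show ?thesis .
  qed
  interpret S: frob_system av p e q \<theta> G c0 J \<psi> "\<lambda>m m'. smult b (BB m m')" b "\<lambda>m. b * \<rho> m" "\<lambda>m. \<Prod>x\<in>I. v x ^ m x" m0 s0 \<delta>
  proof unfold_locales
    show "fps_const b * tw q (\<psi> m) = (\<Sum>m'\<in>J. fps_of_poly (smult b (BB m m')) * \<psi> m')" if "m \<in> J" for m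
      unfolding fe[OF that] by (simp add: sum_distrib_left fps_of_poly_smult mult.assoc)
    show "b \<in> B.W s0" using bW[of 1] by (simp add: Y_def)
    show "smult b (BB m m') \<in> B.PW s0 \<delta>" if "m \<in> J" "m' \<in> J" for m m'
      unfolding B.PW_def
    proof safe
      fix k
      show "coeff (smult b (BB m m')) k \<in> B.W s0"
      proof (cases "k \<le> degree (BB m m')")
        case True
        hence "coeff (BB m m') k \<in> Y" using that by (auto simp: Y_def)
        thus ?thesis using bW by simp
      qed (simp add: coeff_eq_0)
      show "\<delta> \<le> k \<Longrightarrow> coeff (smult b (BB m m')) k = 0" using deg[OF that] by (simp add: coeff_eq_0)
    qed
    show "b * \<rho> m \<in> B.W s0" if "m \<in> J" for m using that by (intro bW) (simp add: Y_def)
    have "(\<Sum>m\<in>J. b * \<rho> m * (\<Prod>x\<in>I. v x ^ m x)) = b * (\<Sum>m\<in>J. \<rho> m * (\<Prod>x\<in>I. v x ^ m x))"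
      by (simp add: sum_distrib_left mult.assoc)
    thus "(\<Sum>m\<in>J. b * \<rho> m * (\<Prod>x\<in>I. v x ^ m x)) = 0" using \<rho>(4) by simp
    show "fbd rad (\<psi> m)" for m unfolding \<psi>_def using H(1) rad_pos by (intro fbd_prod fbd_power) auto
    show "has_val rad (\<psi> m) \<theta> (\<Prod>x\<in>I. v x ^ m x)" for m
      unfolding \<psi>_def using H(2) rad_pos by (intro has_val_prod has_val_power) auto
  qed (use J_fin \<rho>(2,3) b(2) in auto)
  obtain N Q where Q: "\<exists>m\<in>J. Q m \<noteq> 0" "(\<Sum>m\<in>J. fps_of_poly (Q m) * tw (q ^ N) (\<psi> m)) = 0"
    using S.functional_relation by blast
  \<comment> \<open>The field is algebraically closed, so the coefficients have
    \<open>q ^ N\<close>-th roots and the twist can be undone on the whole relation.\<close>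
  have "\<exists>P. twp (q ^ N) P = Q m" for m
  proof -
    obtain r where r: "\<And>x. r x ^ (q ^ N) = (x :: 'c)" using frob_surj[OF frobexp_qk] by metis
    have r0: "r 0 = 0" using r[of 0] by simp
    have "twp (q ^ N) (map_poly r (Q m)) = Q m"
      by (rule poly_eqI) (simp add: coeff_twp coeff_map_poly r0 r)
    thus ?thesis by blast
  qed
  then obtain P where P: "\<And>m. twp (q ^ N) (P m) = Q m" by metis
  have "tw (q ^ N) (\<Sum>m\<in>J. fps_of_poly (P m) * \<psi> m) = 0"
    unfolding tw_sum[OF frobexp_qk] tw_mult[OF frobexp_qk] tw_poly[OF frobexp_qk] P by (rule Q(2))
  hence "(\<Sum>m\<in>J. fps_of_poly (P m) * \<psi> m) = 0" using tw_eq_0[OF frobexp_qk] by blast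
  moreover have "\<exists>m\<in>J. P m \<noteq> 0" using Q(1) P by (metis twp_def map_poly_0)
  ultimately show ?thesis using that unfolding \<psi>_def by blast
qed

lemma zero_power_q [simp]: "(0 :: 'c) ^ q = 0"
  by (rule zero_power[OF q_pos])

section \<open>The Frobenius on Laurent series and on rational functions\<close>

definition sg :: "'c fls \<Rightarrow> 'c fls" where "sg f = Abs_fls (\<lambda>n. (f $$ n) ^ q)"

lemma sg_nth [simp]: "sg f $$ n = (f $$ n) ^ q"
  unfolding sg_def by (rule nth_Abs_fls_lower_bound[of "fls_subdegree f"]) auto

lemma sg_add: "sg (f + g) = sg f + sg g"
  by (intro fls_eqI) (simp add: frob_add[OF frobexp_q p(2)])

lemma sg_subdegree: "fls_subdegree (sg f) = fls_subdegree f"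
proof (cases "f = 0")
  case True
  hence "sg f = 0" by (intro fls_eqI) simp
  thus ?thesis using True by simp
next
  case False
  thus ?thesis by (intro fls_subdegree_eqI) auto
qed

lemma sg_mult: "sg (f * g) = sg f * sg g"
proof (rule fls_eqI)
  fix n
  have "sg (f * g) $$ n = (\<Sum>i=fls_subdegree f..n - fls_subdegree g. f $$ i * g $$ (n - i)) ^ q"
    by (simp add: fls_times_nth(2))
  also have "\<dots> = (\<Sum>i=fls_subdegree f..n - fls_subdegree g. sg f $$ i * sg g $$ (n - i))"
    by (simp add: frob_sum[OF frobexp_q p(2)] power_mult_distrib)
  also have "\<dots> = (sg f * sg g) $$ n" by (simp add: fls_times_nth(2) sg_subdegree)
  finally show "sg (f * g) $$ n = (sg f * sg g) $$ n" .
qed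

lemma sg_fps: "sg (fps_to_fls f) = fps_to_fls (tw q f)"
  by (intro fls_eqI) simp

lemma sg_1: "sg 1 = 1"
  using sg_fps[of 1] tw_1[OF frobexp_q] by simp

definition \<iota> :: "'c poly \<Rightarrow> 'c fls" where "\<iota> P = fps_to_fls (fps_of_poly P)"

lemma \<iota>_add: "\<iota> (P + Q) = \<iota> P + \<iota> Q" and \<iota>_mult: "\<iota> (P * Q) = \<iota> P * \<iota> Q"
  and \<iota>_minus: "\<iota> (- P) = - \<iota> P" and \<iota>_0 [simp]: "\<iota> 0 = 0" and \<iota>_1 [simp]: "\<iota> 1 = 1"
  and \<iota>_inject [simp]: "\<iota> P = \<iota> Q \<longleftrightarrow> P = Q"
  by (auto simp: \<iota>_def fps_of_poly_add fps_of_poly_mult fps_of_poly_uminus fls_times_fps_to_fls fps_of_poly_eq_iff)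

lemma \<iota>_diff: "\<iota> (P - Q) = \<iota> P - \<iota> Q"
  using \<iota>_add[of P "-Q"] \<iota>_minus by simp

lemma \<iota>_power: "\<iota> (P ^ i) = \<iota> P ^ i"
  by (induction i) (auto simp: \<iota>_mult)

lemma \<iota>_sum: "\<iota> (sum f I) = (\<Sum>i\<in>I. \<iota> (f i))"
  by (induction I rule: infinite_finite_induct) (auto simp: \<iota>_add)

lemma \<iota>_eq_0 [simp]: "\<iota> P = 0 \<longleftrightarrow> P = 0" by (metis \<iota>_inject \<iota>_0)

lemma sg_\<iota>: "sg (\<iota> P) = \<iota> (twp q P)"
  by (simp add: \<iota>_def sg_fps tw_poly[OF frobexp_q])

lemma twp_eq_0: "twp q P = 0 \<longleftrightarrow> P = 0"
  by (auto simp: poly_eq_iff coeff_twp)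

lemma degree_twp_eq: "degree (twp q P) = degree P"
proof (rule antisym[OF degree_twp])
  show "degree P \<le> degree (twp q P)" by (cases "P = 0") (auto simp: coeff_twp intro!: le_degree)
qed

lemma twp_surj: "\<exists>Q. twp q Q = P"
proof -
  obtain r where r: "\<And>x. r x ^ q = (x :: 'c)" using frob_surj[OF frobexp_q] by metis
  have r0: "r 0 = 0" using r[of 0] by simp
  have "twp q (map_poly r P) = P" by (rule poly_eqI) (simp add: coeff_twp coeff_map_poly r0 r)
  thus ?thesis by blast
qed

lemma twp_fixed_iff: "twp q P = P \<longleftrightarrow> P \<in> PF"
  by (auto simp: poly_eq_iff coeff_twp PF_def Fq_def)

definition Rat :: "'c fls set" where "Rat = {\<iota> P / \<iota> Q | P Q. Q \<noteq> 0}"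

lemma RatI: "Q \<noteq> 0 \<Longrightarrow> \<iota> P / \<iota> Q \<in> Rat" by (auto simp: Rat_def)

lemma RatE: "x \<in> Rat \<Longrightarrow> (\<And>P Q. Q \<noteq> 0 \<Longrightarrow> x = \<iota> P / \<iota> Q \<Longrightarrow> thesis) \<Longrightarrow> thesis"
  by (auto simp: Rat_def)

lemma Rat_\<iota>: "\<iota> P \<in> Rat" using RatI[of 1 P] by simp

lemma Rat_add: "x \<in> Rat \<Longrightarrow> y \<in> Rat \<Longrightarrow> x + y \<in> Rat"
proof (elim RatE)
  fix P Q P' Q' assume *: "Q \<noteq> 0" "x = \<iota> P / \<iota> Q" "Q' \<noteq> 0" "y = \<iota> P' / \<iota> Q'"
  hence "x + y = \<iota> (P * Q' + P' * Q) / \<iota> (Q * Q')" by (simp add: \<iota>_add \<iota>_mult add_frac_eq)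
  thus ?thesis using RatI[of "Q * Q'"] * by simp
qed

lemma Rat_mult: "x \<in> Rat \<Longrightarrow> y \<in> Rat \<Longrightarrow> x * y \<in> Rat"
proof (elim RatE)
  fix P Q P' Q' assume *: "Q \<noteq> 0" "x = \<iota> P / \<iota> Q" "Q' \<noteq> 0" "y = \<iota> P' / \<iota> Q'"
  hence "x * y = \<iota> (P * P') / \<iota> (Q * Q')" by (simp add: \<iota>_mult)
  thus ?thesis using RatI[of "Q * Q'"] * by simp
qed

lemma Rat_minus: "x \<in> Rat \<Longrightarrow> - x \<in> Rat"
  using Rat_mult[OF Rat_\<iota>[of "-1"], of x] by (simp add: \<iota>_minus)

lemma Rat_inverse: "x \<in> Rat \<Longrightarrow> inverse x \<in> Rat"
proof (elim RatE)
  fix P Q assume *: "Q \<noteq> 0" "x = \<iota> P / \<iota> Q"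
  show ?thesis
  proof (cases "P = 0")
    case False
    thus ?thesis using * RatI[OF False, of Q] by simp
  qed (use * Rat_\<iota>[of 0] in simp)
qed

lemma sg_0 [simp]: "sg 0 = 0" using sg_\<iota>[of 0] by (simp add: twp_def)

lemma sg_inverse: "sg (inverse x) = inverse (sg x)"
proof (cases "x = 0")
  case False
  hence "sg x * sg (inverse x) = 1" using sg_mult[of x "inverse x"] sg_1 by simp
  thus ?thesis by (simp add: inverse_unique)
qed auto

lemma sg_divide: "sg (x / y) = sg x / sg y"
  by (simp add: divide_inverse sg_mult sg_inverse)

lemma Rat_sg: "x \<in> Rat \<Longrightarrow> sg x \<in> Rat"
  by (elim RatE) (auto simp: sg_divide sg_\<iota> twp_eq_0 intro: RatI)

lemma sg_minus: "sg (- x) = - sg x"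
  by (intro fls_eqI) (simp add: frob_minus[OF frobexp_q p(2)])

lemma sg_diff: "sg (x - y) = sg x - sg y"
  using sg_add[of x "-y"] sg_minus by simp

lemma sg_eq_0: "sg x = 0 \<Longrightarrow> x = 0"
  using sg_mult[of x "inverse x"] sg_1 by (cases "x = 0") auto

text \<open>Compare degrees: the Frobenius preserves those of numerator and denominator, while
  \<open>lin powi w\<close> changes their difference by \<open>w\<close>.\<close>

lemma Rat_eigen:
  assumes h: "h \<in> Rat" and eq: "sg h * \<iota> lin powi w = h" shows "h = 0 \<or> w = 0"
proof (rule ccontr)
  assume c: "\<not> (h = 0 \<or> w = 0)"
  obtain P Q where PQ: "Q \<noteq> 0" "h = \<iota> P / \<iota> Q" using h by (elim RatE)
  have P: "P \<noteq> 0" using c PQ by auto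
  have nz: "\<iota> Q \<noteq> 0" "\<iota> (twp q Q) \<noteq> 0" "\<iota> lin \<noteq> 0" using PQ by (auto simp: twp_eq_0)
  have lp: "degree (lin ^ j) = j" for j by (simp add: degree_power_eq lin_def)
  have e1: "\<iota> (twp q P) / \<iota> (twp q Q) * \<iota> lin powi w = \<iota> P / \<iota> Q"
    using eq unfolding PQ(2) sg_divide sg_\<iota> .
  have nz': "twp q P \<noteq> 0" "twp q Q \<noteq> 0" using P PQ by (auto simp: twp_eq_0)
  show False
  proof (cases "w \<ge> 0")
    case True
    define j where "j = nat w"
    have w: "w = int j" using True by (simp add: j_def)
    have "\<iota> (twp q P * lin ^ j * Q) = \<iota> (P * twp q Q)"
      using e1 nz unfolding w by (simp add: \<iota>_mult \<iota>_power field_simps)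
    hence "degree (twp q P * lin ^ j * Q) = degree (P * twp q Q)" by simp
    hence "j = 0" using P PQ nz' by (simp add: degree_mult_eq lp degree_twp_eq)
    thus False using c w by simp
  next
    case False
    define j where "j = nat (- w)"
    have w: "w = - int j" using False by (simp add: j_def)
    have "\<iota> (twp q P * Q) = \<iota> (P * twp q Q * lin ^ j)"
      using e1 nz unfolding w by (simp add: \<iota>_mult \<iota>_power power_int_minus field_simps)
    hence "degree (twp q P * Q) = degree (P * twp q Q * lin ^ j)" by simp
    hence "j = 0" using P PQ nz' by (simp add: degree_mult_eq lp degree_twp_eq)
    thus False using False w by simp
  qed
qed

text \<open>The ideal of denominators of \<open>h\<close> has a unique monic generator, which the Frobenius fixes.\<close>
lemma Frobenius_fixed_denominator:
  assumes h: "h \<in> Rat" and step: "\<And>d. \<iota> d * h \<in> range \<iota> \<Longrightarrow> \<iota> d * sg h \<in> range \<iota>"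
  obtains b where "b \<in> PF" "b \<noteq> 0" "\<iota> b * h \<in> range \<iota>"
proof -
  define Den where "Den = {d. d \<noteq> 0 \<and> \<iota> d * h \<in> range \<iota>}"
  obtain P Q where PQ: "Q \<noteq> 0" "h = \<iota> P / \<iota> Q" using h by (elim RatE)
  have "Q \<in> Den" using PQ by (simp add: Den_def)
  then obtain d0 where d0: "d0 \<in> Den" and least: "\<And>d. d \<in> Den \<Longrightarrow> degree d0 \<le> degree d"
    using ex_has_least_nat[of "\<lambda>d. d \<in> Den" Q degree] by blast
  define b where "b = smult (inverse (lead_coeff d0)) d0"
  have d0nz: "d0 \<noteq> 0" using d0 by (simp add: Den_def)
  have b: "b \<noteq> 0" "lead_coeff b = 1" "degree b = degree d0" using d0nz by (auto simp: b_def)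
  have b_eq: "b = [:inverse (lead_coeff d0):] * d0" by (simp add: b_def)
  have bh: "\<iota> b * h \<in> range \<iota>"
  proof -
    obtain R where "\<iota> d0 * h = \<iota> R" using d0 by (auto simp: Den_def)
    hence "\<iota> b * h = \<iota> ([:inverse (lead_coeff d0):] * R)" unfolding b_eq \<iota>_mult by (simp add: mult.assoc)
    thus ?thesis by blast
  qed
  have dvd: "b dvd d" if dh: "\<iota> d * h \<in> range \<iota>" for d
  proof -
    obtain R where R1: "\<iota> d * h = \<iota> R" using dh by blast
    obtain R' where R2: "\<iota> b * h = \<iota> R'" using bh by blast
    note R = R1 R2
    have "\<iota> (d mod b) * h = \<iota> (R - (d div b) * R')"
    proof -
      have "d mod b = d - (d div b) * b" by (simp add: minus_div_mult_eq_mod)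
      thus ?thesis using R by (simp add: \<iota>_diff \<iota>_mult left_diff_distrib mult.assoc)
    qed
    moreover have "d mod b = 0 \<or> degree (d mod b) < degree b" using degree_mod_less[OF b(1)] by blast
    ultimately have "d mod b = 0" using least[of "d mod b"] b(3) by (force simp: Den_def)
    thus ?thesis by auto
  qed
  \<comment> \<open>\<open>\<iota> b * sg h\<close> is the Frobenius image of
    \<open>\<iota> b' * h\<close>, so \<open>b'\<close> is again a denominator and \<open>b\<close>
    divides it. Equal degrees and leading coefficients give \<open>b' = b\<close>.\<close>
  obtain b' where b': "twp q b' = b" using twp_surj by blast
  obtain R where R: "\<iota> b * sg h = \<iota> R" using step[OF bh] by auto
  obtain R' where R': "twp q R' = R" using twp_surj by blast
  have "sg (\<iota> b' * h - \<iota> R') = 0" by (simp add: sg_diff sg_mult sg_\<iota> b' R' R)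
  hence "\<iota> b' * h = \<iota> R'" using sg_eq_0 by fastforce
  hence "b dvd b'" by (intro dvd) auto
  then obtain r where r: "b' = b * r" by (elim dvdE)
  have b'nz: "b' \<noteq> 0" using b' b(1) twp_eq_0 by auto
  hence "degree b' = degree b + degree r" using r b(1) by (auto simp: degree_mult_eq)
  moreover have "degree b' = degree b" using b' degree_twp_eq by metis
  ultimately obtain c where c: "r = [:c:]" by (metis add_cancel_right_right degree_eq_zeroE)
  have "lead_coeff b' ^ q = lead_coeff b" using b' degree_twp_eq[of b'] by (auto simp: coeff_twp)
  hence "lead_coeff b' ^ q = 1 ^ q" using b(2) by simp
  hence "lead_coeff b' = 1" using frob_inj[OF frobexp_q] by blast
  hence "c = 1" using r c b(2) by (simp split: if_splits)
  hence "b' = b" using r c by simp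
  hence "b \<in> PF" using b' twp_fixed_iff by simp
  thus ?thesis using that b(1) bh by blast
qed

text \<open>A fixed denominator forces a fixed numerator, so the fixed field is
  \<open>F_q(t)\<close>.\<close>

lemma Rat_fixed:
  assumes "x \<in> Rat" "sg x = x"
  obtains a b where "a \<in> PF" "b \<in> PF" "b \<noteq> 0" "x = \<iota> a / \<iota> b"
proof -
  obtain b where b: "b \<in> PF" "b \<noteq> 0" "\<iota> b * x \<in> range \<iota>"
    using Frobenius_fixed_denominator[OF assms(1)] assms(2) by auto
  then obtain a where a: "\<iota> b * x = \<iota> a" by auto
  have "\<iota> (twp q a) = \<iota> a" using b(1) by (simp add: sg_\<iota>[symmetric] a[symmetric] sg_mult assms(2)) (simp add: sg_\<iota> twp_fixed_iff)
  hence "a \<in> PF" using twp_fixed_iff by simp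
  moreover have "x = \<iota> a / \<iota> b" using a b(2) by (simp add: field_simps)
  ultimately show ?thesis using that b by blast
qed

lemma PF_prod: "(\<And>i. i \<in> I \<Longrightarrow> f i \<in> PF) \<Longrightarrow> prod f I \<in> PF"
  by (induction I rule: infinite_finite_induct) (auto intro: PF_mult)

text \<open>Nonzero fixed coefficients have absolute value one, whereas boundedness at a radius
  above one makes coefficients tend to zero.\<close>

lemma fps_fixed_bounded:
  assumes "tw q c = c" "fbd rad c"
  obtains P where "P \<in> PF" "c = fps_of_poly P"
proof -
  have cF: "c $ k \<in> F" for k using assms(1) by (metis (mono_tags) tw_nth Fq_def mem_Collect_eq)
  obtain B where B: "bdd c rad B" using assms(2) by (auto simp: fbd_def)
  obtain n where n: "B < rad ^ n" using real_arch_pow[OF rad_gt_1] by blast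
  have "c $ k = 0" if "k \<ge> n" for k
  proof (rule ccontr)
    assume "c $ k \<noteq> 0"
    hence "av (c $ k) = 1" using av_F cF by blast
    hence "rad ^ k \<le> B" using B unfolding bdd_def by (metis mult_1)
    moreover have "rad ^ n \<le> rad ^ k" using rad_gt_1 that by (intro power_increasing) auto
    ultimately show False using n by linarith
  qed
  then obtain P where P: "c = fps_of_poly P" by (rule fps_eventually_zero_poly)
  hence "P \<in> PF" using cF by (simp add: PF_def)
  thus ?thesis using that P by blast
qed

text \<open>The power map is additive, but additivity covers finite sums only; hence the truncation
  \<open>f0\<close> and a remainder whose power starts beyond index \<open>j\<close>.\<close>

lemma fps_frob_power_nth:
  assumes m: "frobexp m" shows "((f :: 'c fps) ^ m) $ j = (if m dvd j then (f $ (j div m)) ^ m else 0)"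
proof -
  let ?N = "Suc j"
  define f0 where "f0 = (\<Sum>i<?N. fps_const (f $ i) * fps_X ^ i)"
  have ch: "CHAR('c fps) = p" using p(2) by simp
  have "f = f0 + fps_X ^ ?N * fps_shift ?N f"
    unfolding f0_def
    by (intro fps_ext) (auto simp: fps_sum_nth fps_X_power_mult_nth fps_X_power_nth if_distrib simp del: power_Suc cong: if_cong)
  hence "f ^ m = (f0 + fps_X ^ ?N * fps_shift ?N f) ^ m" by (rule arg_cong)
  also have "\<dots> = (\<Sum>i<?N. (fps_const (f $ i) * fps_X ^ i) ^ m) + (fps_X ^ ?N * fps_shift ?N f) ^ m"
    unfolding frob_add[OF m ch] f0_def frob_sum[OF m ch] ..
  also have "\<dots> $ j = (\<Sum>i<?N. (fps_const ((f $ i) ^ m) * fps_X ^ (i * m)) $ j) + (fps_X ^ (?N * m) * fps_shift ?N f ^ m) $ j"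
    by (simp only: power_mult_distrib fps_const_power power_mult fps_add_nth fps_sum_nth)
  also have "(fps_X ^ (?N * m) * fps_shift ?N f ^ m) $ j = 0"
  proof -
    have "j < ?N * m" using frobexp_pos[OF m] by (cases m) auto
    thus ?thesis by (simp add: fps_X_power_mult_nth)
  qed
  also have "(\<Sum>i<?N. (fps_const ((f $ i) ^ m) * fps_X ^ (i * m)) $ j) = (\<Sum>i<?N. if j = i * m then (f $ i) ^ m else 0)"
    by (intro sum.cong) (auto simp: fps_X_power_nth)
  also have "\<dots> = (if m dvd j then (f $ (j div m)) ^ m else 0)"
  proof (cases "m dvd j")
    case True
    then obtain i0 where i0: "j = i0 * m" by (metis dvd_def mult.commute)
    have "i0 < ?N" using i0 frobexp_pos[OF m] by (cases m) auto
    moreover have "(\<Sum>i<?N. if j = i * m then (f $ i) ^ m else 0) = (\<Sum>i<?N. if i = i0 then (f $ i) ^ m else 0)"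
      using i0 frobexp_pos[OF m] by (intro sum.cong) auto
    ultimately show ?thesis using i0 frobexp_pos[OF m] True by simp
  next
    case False
    hence "(\<Sum>i<?N. if j = i * m then (f $ i) ^ m else 0) = 0" by (intro sum.neutral) auto
    thus ?thesis using False by simp
  qed
  finally show ?thesis by simp
qed

definition frob_root :: "nat \<Rightarrow> 'c \<Rightarrow> 'c" where "frob_root m x = (SOME y. y ^ m = x)"

lemma frob_root_power: "frobexp m \<Longrightarrow> frob_root m x ^ m = x"
  unfolding frob_root_def by (rule someI_ex) (rule frob_surj)

lemma frob_root_eq: "frobexp m \<Longrightarrow> y ^ m = x \<Longrightarrow> frob_root m x = y"
  by (rule frob_inj[of m]) (simp_all add: frob_root_power)

text \<open>The components of \<open>f\<close> with respect to the basis \<open>1, t, \<dots>, t ^ (m - 1)\<close> over \<open>m\<close>-th powers.\<close>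
definition frob_component :: "nat \<Rightarrow> nat \<Rightarrow> 'c fps \<Rightarrow> 'c fps" where
  "frob_component m b f = Abs_fps (\<lambda>k. frob_root m (f $ (m * k + b)))"

lemma frob_component_add: "frobexp m \<Longrightarrow> frob_component m b (f + g) = frob_component m b f + frob_component m b g"
  by (intro fps_ext) (simp add: frob_component_def frob_root_power frob_add p frob_root_eq)

lemma frob_component_0: "frobexp m \<Longrightarrow> frob_component m b 0 = 0"
  using frobexp_pos[of m] by (intro fps_ext) (simp add: frob_component_def frob_root_eq zero_power)

lemma frob_component_sum: "frobexp m \<Longrightarrow> frob_component m b (sum f I) = (\<Sum>i\<in>I. frob_component m b (f i))"
  by (induction I rule: infinite_finite_induct) (auto simp: frob_component_add frob_component_0)

text \<open>\<open>g ^ m\<close> is supported on multiples of \<open>m\<close>, so multiplication by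
  it does not mix residue classes, and taking \<open>m\<close>-th roots is additive. This is what
  turns \<open>m\<close>-th powers of the series into linear terms.\<close>

lemma frob_component_mult_power:
  assumes m: "frobexp m" and b: "b < m" shows "frob_component m b (f * g ^ m) = frob_component m b f * g"
proof (rule fps_ext)
  fix k
  have m0: "m > 0" using b by simp
  have "(f * g ^ m) $ (m * k + b) = (\<Sum>j\<in>{0..m * k + b}. (g ^ m) $ j * f $ (m * k + b - j))"
    by (subst mult.commute) (rule fps_mult_nth)
  also have "\<dots> = (\<Sum>j\<in>(\<lambda>i. m * i) ` {0..k}. (g ^ m) $ j * f $ (m * k + b - j))"
  proof (rule sum.mono_neutral_right)
    show "\<forall>j\<in>{0..m * k + b} - (\<lambda>i. m * i) ` {0..k}. (g ^ m) $ j * f $ (m * k + b - j) = 0"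
    proof
      fix j assume j: "j \<in> {0..m * k + b} - (\<lambda>i. m * i) ` {0..k}"
      have "\<not> m dvd j"
      proof
        assume "m dvd j"
        then obtain i where i: "j = m * i" by (elim dvdE)
        have "m * i < m * (k + 1)" using j i b by (auto simp: algebra_simps)
        hence "i \<le> k" using m0 by (simp only: mult_less_cancel1) simp
        thus False using j i by auto
      qed
      thus "(g ^ m) $ j * f $ (m * k + b - j) = 0" by (simp add: fps_frob_power_nth[OF m])
    qed
    show "(\<lambda>i. m * i) ` {0..k} \<subseteq> {0..m * k + b}" by (auto intro!: trans_le_add1 mult_le_mono2)
  qed auto
  also have "\<dots> = (\<Sum>i\<in>{0..k}. (g ^ m) $ (m * i) * f $ (m * k + b - m * i))"
    using m0 by (subst sum.reindex) (auto simp: inj_on_def)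
  also have "\<dots> = (\<Sum>i\<in>{0..k}. (g $ i * frob_root m (f $ (m * (k - i) + b))) ^ m)"
  proof (intro sum.cong refl)
    fix i assume "i \<in> {0..k}"
    hence "m * i \<le> m * k" by simp
    hence "m * k + b - m * i = m * (k - i) + b" by (simp add: diff_mult_distrib2)
    thus "(g ^ m) $ (m * i) * f $ (m * k + b - m * i) = (g $ i * frob_root m (f $ (m * (k - i) + b))) ^ m"
      using m0 by (simp add: fps_frob_power_nth[OF m] power_mult_distrib frob_root_power[OF m])
  qed
  also have "\<dots> = (\<Sum>i\<in>{0..k}. g $ i * frob_root m (f $ (m * (k - i) + b))) ^ m"
    by (simp add: frob_sum[OF m p(2)])
  finally have "frob_root m ((f * g ^ m) $ (m * k + b)) = (\<Sum>i\<in>{0..k}. g $ i * frob_root m (f $ (m * (k - i) + b)))"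
    by (simp only: frob_root_eq[OF m refl])
  also have "\<dots> = (g * frob_component m b f) $ k" by (simp add: fps_mult_nth frob_component_def)
  finally show "frob_component m b (f * g ^ m) $ k = (frob_component m b f * g) $ k" by (simp add: frob_component_def mult.commute)
qed

lemma frob_component_poly: 
  assumes m: "frobexp m" obtains P where "frob_component m b (fps_of_poly Q) = fps_of_poly P"
proof (rule fps_eventually_zero_poly)
  fix k assume "k \<ge> Suc (degree Q)"
  moreover have "k \<le> m * k" using frobexp_pos[OF m] by simp
  ultimately have "degree Q < m * k + b" by linarith
  thus "frob_component m b (fps_of_poly Q) $ k = 0"
    using frobexp_pos[OF m] by (simp add: frob_component_def coeff_eq_0 zero_power frob_root_eq[OF m])
qed

lemma frob_root_F: "frobexp m \<Longrightarrow> x \<in> F \<Longrightarrow> frob_root m x \<in> F"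
proof -
  assume m: "frobexp m" and x: "x \<in> F"
  have "(frob_root m x ^ q) ^ m = (frob_root m x ^ m) ^ q" by (simp add: mult.commute flip: power_mult)
  also have "\<dots> = frob_root m x ^ m" using x by (simp add: frob_root_power[OF m] Fq_def)
  finally show ?thesis using frob_inj[OF m] by (auto simp: Fq_def)
qed

lemma frob_component_PF:
  assumes m: "frobexp m" and Q: "Q \<in> PF"
  obtains P where "P \<in> PF" "frob_component m b (fps_of_poly Q) = fps_of_poly P"
proof -
  obtain P where P: "frob_component m b (fps_of_poly Q) = fps_of_poly P" by (rule frob_component_poly[OF m])
  have "coeff P k \<in> F" for k
    using frob_root_F[OF m, of "coeff Q (m * k + b)"] Q arg_cong[OF P, of "\<lambda>f. f $ k"] by (simp add: frob_component_def PF_def)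
  hence "P \<in> PF" by (simp add: PF_def)
  thus ?thesis using that P by blast
qed

end

context na_field
begin

text \<open>When the constant term dominates the Gauss norm, the recursion for the inverse preserves
  the reciprocal bound.\<close>

lemma bdd_inverse:
  assumes f: "bdd f \<rho> (av (f $ 0))" "f $ 0 \<noteq> 0" and \<rho>: "\<rho> > 0"
  shows "bdd (inverse f) \<rho> (1 / av (f $ 0))"
  unfolding bdd_def
proof
  let ?g = "inverse f"
  have f0: "av (f $ 0) > 0" using f(2) by (rule av_pos)
  fix n
  show "av (?g $ n) * \<rho> ^ n \<le> 1 / av (f $ 0)"
  proof (induction n rule: less_induct)
    case (less n)
    show ?case
    proof (cases "n = 0")
      case True
      thus ?thesis by (simp add: av_divide inverse_eq_divide)
    next
      case False
      have "f * ?g = 1" using inverse_mult_eq_1'[OF f(2)] .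
      hence "(f * ?g) $ n = 0" using False by simp
      hence "f $ 0 * ?g $ n + (\<Sum>i\<in>{Suc 0..n}. f $ i * ?g $ (n - i)) = 0"
        unfolding fps_mult_nth by (simp add: sum.atLeast_Suc_atMost)
      hence "av (f $ 0 * ?g $ n) = av (\<Sum>i\<in>{Suc 0..n}. f $ i * ?g $ (n - i))"
        by (metis add_eq_0_iff av_minus)
      also have "\<dots> \<le> 1 / \<rho> ^ n"
      proof (rule av_sum_le)
        fix i assume i: "i \<in> {Suc 0..n}"
        have "av (f $ i) * \<rho> ^ i \<le> av (f $ 0)" using f(1) by (simp add: bdd_def)
        moreover have "av (?g $ (n - i)) * \<rho> ^ (n - i) \<le> 1 / av (f $ 0)" using i by (intro less) auto
        ultimately have "(av (f $ i) * \<rho> ^ i) * (av (?g $ (n - i)) * \<rho> ^ (n - i)) \<le> av (f $ 0) * (1 / av (f $ 0))"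
          using \<rho> by (intro mult_mono) auto
        also have "(av (f $ i) * \<rho> ^ i) * (av (?g $ (n - i)) * \<rho> ^ (n - i)) = av (f $ i * ?g $ (n - i)) * (\<rho> ^ i * \<rho> ^ (n - i))"
          by (simp add: av_mult mult_ac)
        also have "\<rho> ^ i * \<rho> ^ (n - i) = \<rho> ^ n" using i by (simp add: power_add[symmetric])
        finally show "av (f $ i * ?g $ (n - i)) \<le> 1 / \<rho> ^ n" using \<rho> f(2) by (simp add: field_simps)
      qed (use \<rho> in auto)
      finally show ?thesis using \<rho> f0 by (simp add: av_mult field_simps)
    qed
  qed
qed

end

context frob_field
begin

lemma sg_power: "sg (x ^ i) = sg x ^ i"
  by (induction i) (auto simp: sg_1 sg_mult)

lemma sg_powi: "sg (x powi w) = sg x powi w"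
  by (simp add: power_int_def sg_power sg_inverse)

lemma poly_twp: "frobexp m \<Longrightarrow> poly (twp m P) (x ^ m) = poly P x ^ m"
proof (induction P)
  case (pCons a P)
  have "twp m (pCons a P) = pCons (a ^ m) (twp m P)"
    unfolding twp_def using frobexp_pos[OF pCons.prems] by (rule_tac map_poly_pCons) (simp add: zero_power)
  thus ?case using pCons by (simp add: frob_add[OF pCons.prems p(2)] power_mult_distrib)
qed (simp add: twp_def frobexp_pos zero_power)

text \<open>With \<open>X = Pf\<close> and \<open>g s = L s / Pf ^ n s\<close>, a monomial in
  \<open>Pf\<close> and the \<open>L s\<close> becomes one in \<open>X\<close> and the
  \<open>g s\<close>, the exponent of \<open>X\<close> growing by the weight of the
  \<open>L\<close>-part.\<close>

lemma additive_functional_relation: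
  fixes L :: "'s \<Rightarrow> 'c fps"
  assumes I: "finite I"
    and Pf: "tw q Pf = fps_of_poly lin * Pf" "Pf \<noteq> 0"
    and L: "\<And>s. s \<in> I \<Longrightarrow> tw q (L s) = fps_of_poly lin ^ n s * (L s - fps_of_poly (u s))"
    and n: "\<And>s. s \<in> I \<Longrightarrow> n s > 0"
      "\<And>s s' i j. s \<in> I \<Longrightarrow> s' \<in> I \<Longrightarrow> n s * p ^ i = n s' * p ^ j \<Longrightarrow> n s = n s'"
    and J: "J = PiE (insert None (Some ` I)) (\<lambda>_. {..M})"
    and P: "\<exists>m\<in>J. P m \<noteq> 0"
      "(\<Sum>m\<in>J. fps_of_poly (P m) * (\<Prod>x\<in>insert None (Some ` I). (case x of None \<Rightarrow> Pf | Some s \<Rightarrow> L s) ^ m x)) = 0"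
  obtains s0 i \<kappa> h where "s0 \<in> I" "\<And>s. \<kappa> s \<in> Rat \<and> sg (\<kappa> s) = \<kappa> s" "\<kappa> s0 \<noteq> 0" "h \<in> Rat"
    "(\<Sum>s\<in>{s\<in>I. n s = n s0}. \<kappa> s * (- \<iota> (u s)) ^ (p ^ i)) = h - \<iota> lin powi (- int (n s0 * p ^ i)) * sg h"
proof -
  define X where "X = fps_to_fls Pf"
  define g where "g = (\<lambda>s. fps_to_fls (L s) * X powi (- int (n s)))"
  have X: "X \<noteq> 0" using Pf(2) by (simp add: X_def)
  have lnz: "\<iota> lin \<noteq> 0" by simp
  have sgX: "sg X = \<iota> lin * X" by (simp add: X_def sg_fps Pf(1) fls_times_fps_to_fls \<iota>_def)
  have sgg: "sg (g s) = g s - \<iota> (u s) * X powi (- int (n s))" if s: "s \<in> I" for s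
  proof -
    have "sg (g s) = \<iota> lin ^ n s * (fps_to_fls (L s) - \<iota> (u s)) * ((\<iota> lin * X) powi (- int (n s)))"
      unfolding g_def sg_mult sg_powi sgX sg_fps L[OF s]
      by (simp add: fls_times_fps_to_fls fps_to_fls_power \<iota>_def)
    also have "(\<iota> lin * X) powi (- int (n s)) = inverse (\<iota> lin ^ n s) * X powi (- int (n s))"
      by (simp add: power_int_minus power_mult_distrib)
    also have "\<iota> lin ^ n s * (fps_to_fls (L s) - \<iota> (u s)) * (inverse (\<iota> lin ^ n s) * X powi (- int (n s)))
      = (\<iota> lin ^ n s * inverse (\<iota> lin ^ n s)) * ((fps_to_fls (L s) - \<iota> (u s)) * X powi (- int (n s)))"
      by (simp only: mult_ac)
    also have "\<iota> lin ^ n s * inverse (\<iota> lin ^ n s) = 1" using lnz by simp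
    finally show ?thesis by (simp add: g_def left_diff_distrib)
  qed
  \<comment> \<open>\<open>card I * M\<close> bounds the total degree in the \<open>L s\<close> of
    the monomials indexed by \<open>J\<close>.\<close>
  interpret U: unipotent_system sg Rat "\<iota> lin" X I g "\<lambda>s. \<iota> (u s)" n p "card I * M"
  proof unfold_locales
    show "0 \<in> Rat" using Rat_\<iota>[of 0] by simp
    show "1 \<in> Rat" using Rat_\<iota>[of 1] by simp
    show "CHAR('c fls) = p" using p(2) by simp
  qed (use sg_add sg_mult sg_1 p(1) Rat_add Rat_minus Rat_mult Rat_inverse Rat_sg Rat_\<iota> lnz X sgX Rat_eigen I sgg n in auto)
  define conv where "conv = (\<lambda>m. (int (m None + (\<Sum>s\<in>I. n s * m (Some s))), restrict (\<lambda>s. m (Some s)) I))"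
  have J_fin: "finite J" unfolding J using I by (intro finite_PiE) auto
  have inj: "inj_on conv J"
  proof (rule inj_onI)
    fix m m' assume m: "m \<in> J" "m' \<in> J" and eq: "conv m = conv m'"
    have S: "m (Some s) = m' (Some s)" if "s \<in> I" for s
      using fun_cong[OF arg_cong[OF eq, of snd], of s] that by (simp add: conv_def)
    have "int (m None + (\<Sum>s\<in>I. n s * m (Some s))) = int (m' None + (\<Sum>s\<in>I. n s * m' (Some s)))"
      using eq unfolding conv_def by simp
    hence "m None = m' None" using S by simp
    thus "m = m'" using m S unfolding J by (intro PiE_ext[OF m[unfolded J]]) auto
  qed
  define c where "c = (\<lambda>x. if x \<in> conv ` J then \<iota> (P (inv_into J conv x)) else 0)"
  have c: "c (conv m) = \<iota> (P m)" if "m \<in> J" for m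
    using that by (simp add: c_def inv_into_f_f[OF inj])
  have supp: "U.supp c \<subseteq> conv ` J" by (auto simp: U.supp_def c_def)
  have Lc: "U.laurent (card I * M) c"
    unfolding U.laurent_def
  proof (intro conjI allI ballI)
    show "finite (U.supp c)" using finite_subset[OF supp] J_fin by blast
    show "c x \<in> Rat" for x using Rat_\<iota>[of 0] by (auto simp: c_def Rat_\<iota>)
    fix x assume "x \<in> U.supp c"
    then obtain m where m: "m \<in> J" "x = conv m" using supp by auto
    show "snd x \<in> extensional I" by (simp add: m(2) conv_def)
    have "U.deg (snd x) = (\<Sum>s\<in>I. m (Some s))" by (simp add: U.deg_def m(2) conv_def)
    also have "\<dots> \<le> card I * M" using m(1) sum_bounded_above[of I "\<lambda>s. m (Some s)" M] by (auto simp: J)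
    finally show "U.deg (snd x) \<le> card I * M" .
  qed
  have mono: "U.mono (conv m) = fps_to_fls (\<Prod>x\<in>insert None (Some ` I). (case x of None \<Rightarrow> Pf | Some s \<Rightarrow> L s) ^ m x)" for m
  proof -
    have fp: "fps_to_fls (prod f A) = (\<Prod>x\<in>A. fps_to_fls (f x))" for f :: "'s \<Rightarrow> 'c fps" and A
      by (induction A rule: infinite_finite_induct) (auto simp: fls_times_fps_to_fls)
    have "U.mono (conv m) = X ^ (m None + (\<Sum>s\<in>I. n s * m (Some s))) * (\<Prod>s\<in>I. g s ^ m (Some s))"
      by (simp add: U.mono_def conv_def power_int_of_nat del: of_nat_add)
    also have "\<dots> = X ^ m None * (\<Prod>s\<in>I. (X ^ n s * g s) ^ m (Some s))"
      by (simp add: power_add power_sum power_mult power_mult_distrib prod.distrib mult.assoc)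
    also have "(\<Prod>s\<in>I. (X ^ n s * g s) ^ m (Some s)) = (\<Prod>s\<in>I. fps_to_fls (L s) ^ m (Some s))"
    proof (intro prod.cong refl)
      fix s
      have "X ^ n s * g s = fps_to_fls (L s) * (X ^ n s * inverse (X ^ n s))"
        by (simp add: g_def power_int_minus mult_ac)
      also have "X ^ n s * inverse (X ^ n s) = 1" using X by simp
      finally show "(X ^ n s * g s) ^ m (Some s) = fps_to_fls (L s) ^ m (Some s)" by simp
    qed
    finally have "U.mono (conv m) = fps_to_fls (Pf ^ m None * (\<Prod>s\<in>I. L s ^ m (Some s)))"
      by (simp add: X_def fp fls_times_fps_to_fls fps_to_fls_power)
    moreover have "(\<Prod>x\<in>insert None (Some ` I). (case x of None \<Rightarrow> Pf | Some s \<Rightarrow> L s) ^ m x) = Pf ^ m None * (\<Prod>s\<in>I. L s ^ m (Some s))"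
      using I by (subst prod.insert) (auto simp: prod.reindex)
    ultimately show ?thesis by simp
  qed
  have "U.ev c = (\<Sum>x\<in>conv ` J. c x * U.mono x)" by (rule U.ev_superset) (use J_fin supp in auto)
  also have "\<dots> = (\<Sum>m\<in>J. c (conv m) * U.mono (conv m))" by (simp add: sum.reindex[OF inj])
  also have "\<dots> = (\<Sum>m\<in>J. fps_to_fls (fps_of_poly (P m) * (\<Prod>x\<in>insert None (Some ` I). (case x of None \<Rightarrow> Pf | Some s \<Rightarrow> L s) ^ m x)))"
    by (intro sum.cong refl) (simp add: c mono \<iota>_def fls_times_fps_to_fls)
  also have "\<dots> = fps_to_fls (\<Sum>m\<in>J. fps_of_poly (P m) * (\<Prod>x\<in>insert None (Some ` I). (case x of None \<Rightarrow> Pf | Some s \<Rightarrow> L s) ^ m x))"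
  proof -
    have "fps_to_fls (sum f A) = (\<Sum>x\<in>A. fps_to_fls (f x))" for f :: "('s option \<Rightarrow> nat) \<Rightarrow> 'c fps" and A
      by (induction A rule: infinite_finite_induct) auto
    thus ?thesis by simp
  qed
  finally have ev: "U.ev c = 0" unfolding P(2) by simp
  obtain m1 where m1: "m1 \<in> J" "P m1 \<noteq> 0" using P(1) by blast
  have "c (conv m1) \<noteq> 0" using m1 by (simp add: c)
  show ?thesis
  proof (rule U.additive_relation[OF Lc \<open>c (conv m1) \<noteq> 0\<close> ev])
    fix s0 i \<kappa> h assume "s0 \<in> I" "\<And>s. \<kappa> s \<in> Rat \<and> sg (\<kappa> s) = \<kappa> s" "\<kappa> s0 \<noteq> 0" "h \<in> Rat"
      "(\<Sum>s\<in>{s\<in>I. n s = n s0}. \<kappa> s * (- \<iota> (u s)) ^ (p ^ i)) = h - \<iota> lin powi (- int (n s0 * p ^ i)) * sg h"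
    thus ?thesis by (rule that)
  qed
qed

lemma fps_unit_power_inverse: "(f :: 'c fps) $ 0 \<noteq> 0 \<Longrightarrow> f ^ w * inverse f ^ w = 1"
  using inverse_mult_eq_1'[of f] by (simp flip: power_mult_distrib)

text \<open>The additive relation shows that a combination of \<open>p ^ i\<close>-th powers of the logarithms is a
  multiple of a power of \<open>Pf\<close>; extracting \<open>p ^ i\<close>-th roots componentwise and evaluating at \<open>\<theta>\<close>
  makes it a linear relation over \<open>K\<close>.\<close>
lemma linear_relation:
  fixes L :: "'s \<Rightarrow> 'c fps"
  assumes I: "finite I"
    and Pf: "tw q Pf = fps_of_poly lin * Pf" "Pf $ 0 \<noteq> 0" "fbd rad (inverse Pf)" "has_val rad Pf \<theta> \<omega>"
    and L: "\<And>s. s \<in> I \<Longrightarrow> tw q (L s) = fps_of_poly lin ^ n s * (L s - fps_of_poly (u s))"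
      "\<And>s. s \<in> I \<Longrightarrow> has_val rad (L s) \<theta> (v s)"
    and n: "\<And>s. s \<in> I \<Longrightarrow> n s > 0"
      "\<And>s s' i j. s \<in> I \<Longrightarrow> s' \<in> I \<Longrightarrow> n s * p ^ i = n s' * p ^ j \<Longrightarrow> n s = n s'"
    and J: "J = PiE (insert None (Some ` I)) (\<lambda>_. {..M})"
    and P: "\<exists>m\<in>J. P m \<noteq> 0"
      "(\<Sum>m\<in>J. fps_of_poly (P m) * (\<Prod>x\<in>insert None (Some ` I). (case x of None \<Rightarrow> Pf | Some s \<Rightarrow> L s) ^ m x)) = 0"
  obtains s0 a c where "s0 \<in> I" "\<And>s. a s \<in> PF" "c \<in> PF" "a s0 \<noteq> 0"
    "(\<Sum>s\<in>{s\<in>I. n s = n s0}. poly (a s) \<theta> * v s) = poly c \<theta> * \<omega> ^ n s0"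
proof -
  have Pfnz: "Pf \<noteq> 0" using Pf(2) by auto
  obtain s0 i \<kappa> h where s0: "s0 \<in> I" and \<kappa>: "\<And>s. \<kappa> s \<in> Rat \<and> sg (\<kappa> s) = \<kappa> s" "\<kappa> s0 \<noteq> 0" and h: "h \<in> Rat"
    and rel: "(\<Sum>s\<in>{s\<in>I. n s = n s0}. \<kappa> s * (- \<iota> (u s)) ^ (p ^ i)) = h - \<iota> lin powi (- int (n s0 * p ^ i)) * sg h"
  proof (rule additive_functional_relation[OF I Pf(1) Pfnz L(1) n J P])
    fix s0 i \<kappa> h assume "s0 \<in> I" "\<And>s. \<kappa> s \<in> Rat \<and> sg (\<kappa> s) = \<kappa> s" "\<kappa> s0 \<noteq> 0" "h \<in> Rat"
      "(\<Sum>s\<in>{s\<in>I. n s = n s0}. \<kappa> s * (- \<iota> (u s)) ^ (p ^ i)) = h - \<iota> lin powi (- int (n s0 * p ^ i)) * sg h"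
    thus thesis by (rule that)
  qed
  define I' where "I' = {s\<in>I. n s = n s0}"
  have I': "finite I'" "s0 \<in> I'" using I s0 by (auto simp: I'_def)
  define m where "m = p ^ i"
  have m: "frobexp m" by (simp add: m_def frobexp_pk)
  have m0: "m > 0" by (rule frobexp_pos[OF m])
  define w where "w = n s0 * m"
  have "\<exists>a b. a \<in> PF \<and> b \<in> PF \<and> b \<noteq> 0 \<and> \<kappa> s = \<iota> a / \<iota> b" for s
    using Rat_fixed[of "\<kappa> s"] \<kappa>(1) by metis
  then obtain a b where ab: "\<And>s. a s \<in> PF" "\<And>s. b s \<in> PF" "\<And>s. b s \<noteq> 0" "\<And>s. \<kappa> s = \<iota> (a s) / \<iota> (b s)" by metis
  \<comment> \<open>A denominator over \<open>F_q\<close> is fixed by the Frobenius, so clearing it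
    preserves the shape of the equation.\<close>
  define bb where "bb = prod b I'"
  have bb: "bb \<in> PF" "bb \<noteq> 0" using ab I' by (auto simp: bb_def intro: PF_prod)
  define a1 where "a1 = (\<lambda>s. if s \<in> I' then a s * prod b (I' - {s}) else 0)"
  have a1: "a1 s \<in> PF" for s using ab by (auto simp: a1_def intro!: PF_mult PF_prod)
  have a1_eq: "\<iota> bb * \<kappa> s = \<iota> (a1 s)" if "s \<in> I'" for s
  proof -
    have "bb = b s * prod b (I' - {s})" unfolding bb_def using I' that by (rule_tac prod.remove) auto
    thus ?thesis using that ab(3)[of s] by (simp add: a1_def ab(4) \<iota>_mult)
  qed
  define V where "V = (\<Sum>s\<in>I'. a1 s * (- u s) ^ m)"
  define h1 where "h1 = \<iota> bb * h"
  have h1: "h1 \<in> Rat" using h Rat_\<iota> by (auto simp: h1_def intro: Rat_mult)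
  have sgbb: "sg (\<iota> bb) = \<iota> bb" using bb(1) by (simp add: sg_\<iota> twp_fixed_iff)
  have sgh1: "sg h1 = \<iota> (lin ^ w) * (h1 - \<iota> V)"
  proof -
    have "\<iota> V = \<iota> bb * (\<Sum>s\<in>I'. \<kappa> s * (- \<iota> (u s)) ^ m)"
      unfolding V_def \<iota>_sum sum_distrib_left
      by (intro sum.cong refl) (simp add: \<iota>_mult \<iota>_power \<iota>_minus a1_eq[symmetric] mult.assoc)
    also have "(\<Sum>s\<in>I'. \<kappa> s * (- \<iota> (u s)) ^ m) = h - inverse (\<iota> (lin ^ w)) * sg h"
      using rel unfolding I'_def m_def w_def by (simp add: power_int_minus \<iota>_power power_int_of_nat del: of_nat_mult)
    also have "\<iota> bb * \<dots> = h1 - inverse (\<iota> (lin ^ w)) * sg h1"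
      by (simp add: h1_def sg_mult sgbb right_diff_distrib mult_ac)
    finally show ?thesis by (simp add: mult.assoc[symmetric])
  qed
  \<comment> \<open>The equation \<open>sgh1\<close> expresses \<open>sg h1\<close> by
    \<open>h1\<close> and polynomials, so every denominator of \<open>h1\<close> is one of
    \<open>sg h1\<close>.\<close>
  obtain b2 where b2: "b2 \<in> PF" "b2 \<noteq> 0" "\<iota> b2 * h1 \<in> range \<iota>"
  proof (rule Frobenius_fixed_denominator[OF h1])
    fix d assume "\<iota> d * h1 \<in> range \<iota>"
    then obtain R where R: "\<iota> d * h1 = \<iota> R" by blast
    have "\<iota> d * sg h1 = \<iota> (lin ^ w) * (\<iota> d * h1 - \<iota> d * \<iota> V)" unfolding sgh1 by (simp add: algebra_simps)
    also have "\<dots> = \<iota> (lin ^ w * (R - d * V))" unfolding R by (simp only: \<iota>_mult \<iota>_diff)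
    finally show "\<iota> d * sg h1 \<in> range \<iota>" by blast
  qed
  then obtain h2 where h2: "\<iota> b2 * h1 = \<iota> h2" by blast
  define a2 where "a2 = (\<lambda>s. b2 * a1 s)"
  have a2: "a2 s \<in> PF" for s using b2(1) a1 by (simp add: a2_def PF_mult)
  have a2_s0: "a2 s0 \<noteq> 0"
  proof -
    have "\<iota> (a1 s0) \<noteq> 0" unfolding a1_eq[OF I'(2), symmetric] using bb(2) \<kappa>(2) by simp
    thus ?thesis using b2(2) by (simp add: a2_def)
  qed
  have "\<iota> (twp q h2) = \<iota> (lin ^ w * (h2 - b2 * V))"
  proof -
    have "\<iota> (twp q h2) = \<iota> b2 * sg h1"
      using b2(1) by (simp add: sg_\<iota>[symmetric] h2[symmetric] sg_mult) (simp add: sg_\<iota> twp_fixed_iff)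
    thus ?thesis unfolding sgh1 by (simp add: \<iota>_mult \<iota>_diff h2[symmetric] algebra_simps)
  qed
  hence twh2: "twp q h2 = lin ^ w * (h2 - b2 * V)" by simp
  have chf: "CHAR('c fps) = p" using p(2) by simp
  \<comment> \<open>Subtracting the combination of the \<open>L s\<close> removes the inhomogeneous
    term. \<open>F0\<close> obeys the equation of \<open>Pf ^ w\<close>, so the quotient is fixed by
    the Frobenius and bounded, hence a polynomial over \<open>F_q\<close>.\<close>
  define F0 where "F0 = fps_of_poly h2 - (\<Sum>s\<in>I'. fps_of_poly (a2 s) * (- L s) ^ m)"
  have b2V: "fps_of_poly (b2 * V) = (\<Sum>s\<in>I'. fps_of_poly (a2 s) * (- fps_of_poly (u s)) ^ m)"
    unfolding V_def a2_def by (simp add: fps_of_poly_mult fps_of_poly_sum fps_of_poly_power fps_of_poly_uminus sum_distrib_left mult.assoc)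
  have twF0: "tw q F0 = fps_of_poly lin ^ w * F0"
  proof -
    have "tw q (fps_of_poly (a2 s) * (- L s) ^ m) = fps_of_poly lin ^ w * (fps_of_poly (a2 s) * (- L s) ^ m - fps_of_poly (a2 s) * (- fps_of_poly (u s)) ^ m)"
      if s: "s \<in> I'" for s
    proof -
      have sI: "s \<in> I" "n s = n s0" using s by (auto simp: I'_def)
      have "tw q (- L s) = fps_of_poly lin ^ n s0 * (- L s - - fps_of_poly (u s))"
        using tw_diff[OF frobexp_q, of 0 "L s"] L(1)[OF sI(1)] sI(2) by (simp add: tw_0[OF frobexp_q] right_diff_distrib)
      hence "tw q ((- L s) ^ m) = fps_of_poly lin ^ w * ((- L s) ^ m - (- fps_of_poly (u s)) ^ m)"
        by (simp only: tw_power[OF frobexp_q] power_mult_distrib frob_diff[OF m chf] w_def power_mult)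
      moreover have "tw q (fps_of_poly (a2 s)) = fps_of_poly (a2 s)"
        using a2[of s] by (simp add: tw_poly[OF frobexp_q] twp_fixed_iff)
      ultimately show ?thesis by (simp only: tw_mult[OF frobexp_q] right_diff_distrib mult_ac)
    qed
    hence "tw q F0 = fps_of_poly (twp q h2) - (\<Sum>s\<in>I'. fps_of_poly lin ^ w * (fps_of_poly (a2 s) * (- L s) ^ m - fps_of_poly (a2 s) * (- fps_of_poly (u s)) ^ m))"
      unfolding F0_def tw_diff[OF frobexp_q] tw_sum[OF frobexp_q] tw_poly[OF frobexp_q] by simp
    also have "\<dots> = fps_of_poly lin ^ w * F0"
      unfolding twh2 F0_def fps_of_poly_mult[of "lin ^ w"] fps_of_poly_diff b2V fps_of_poly_power
      by (simp add: right_diff_distrib sum_subtractf sum_distrib_left)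
    finally show ?thesis .
  qed
  define cc where "cc = F0 * inverse Pf ^ w"
  have F0_eq: "F0 = cc * Pf ^ w"
    using fps_unit_power_inverse[OF Pf(2), of w] by (simp add: cc_def mult.assoc mult.commute[of "inverse Pf ^ w"])
  have "(fps_of_poly lin ^ w * Pf ^ w) * tw q cc = (fps_of_poly lin ^ w * Pf ^ w) * cc"
  proof -
    have "tw q F0 = tw q cc * (fps_of_poly lin * Pf) ^ w"
      unfolding F0_eq tw_mult[OF frobexp_q] tw_power[OF frobexp_q] Pf(1) ..
    hence "fps_of_poly lin ^ w * (cc * Pf ^ w) = tw q cc * (fps_of_poly lin * Pf) ^ w"
      using twF0 by (simp only: F0_eq)
    thus ?thesis by (simp only: power_mult_distrib mult_ac)
  qed
  hence fixed: "tw q cc = cc" using Pfnz by simp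
  have Lfbd: "fbd rad (L s)" if "s \<in> I'" for s
    using that has_val_fbd[OF L(2) rad_pos] by (simp add: I'_def)
  have "fbd rad cc"
    unfolding cc_def F0_def using rad_pos Lfbd Pf(3)
    by (intro fbd_mult fbd_power fbd_diff fbd_sum fbd_poly fbd_minus) auto
  then obtain c' where c': "c' \<in> PF" "cc = fps_of_poly c'" using fps_fixed_bounded[OF fixed] by blast
  have eq: "fps_of_poly h2 = (\<Sum>s\<in>I'. fps_of_poly (a2 s) * (- L s) ^ m) + fps_of_poly c' * (Pf ^ n s0) ^ m"
    using F0_eq unfolding F0_def c'(2) w_def power_mult[of Pf "n s0" m] by (simp only: diff_eq_eq add.commute)
  \<comment> \<open>The residue class \<open>r\<close> is chosen to contain a nonzero coefficient of
    \<open>a2 s0\<close>, so that \<open>L s0\<close> keeps a nonzero coefficient.\<close>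
  obtain j where j: "coeff (a2 s0) j \<noteq> 0" using a2_s0 by (auto simp: poly_eq_iff)
  define r where "r = j mod m"
  have r: "r < m" using m0 by (simp add: r_def)
  obtain h3 where h3: "frob_component m r (fps_of_poly h2) = fps_of_poly h3" by (rule frob_component_poly[OF m])
  have "\<exists>P. P \<in> PF \<and> frob_component m r (fps_of_poly (a2 s)) = fps_of_poly P" for s using frob_component_PF[OF m a2] by metis
  then obtain a3 where a3: "\<And>s. a3 s \<in> PF" "\<And>s. frob_component m r (fps_of_poly (a2 s)) = fps_of_poly (a3 s)" by metis
  obtain c3 where c3: "c3 \<in> PF" "frob_component m r (fps_of_poly c') = fps_of_poly c3" by (rule frob_component_PF[OF m c'(1)])
  have a3_s0: "a3 s0 \<noteq> 0"
  proof
    assume "a3 s0 = 0"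
    hence "frob_component m r (fps_of_poly (a2 s0)) $ (j div m) = 0" using a3(2)[of s0] by simp
    hence "frob_root m (coeff (a2 s0) j) = 0" by (simp add: frob_component_def r_def)
    thus False using frob_root_power[OF m, of "coeff (a2 s0) j"] j m0 by (simp add: zero_power)
  qed
  have eq3: "fps_of_poly h3 = (\<Sum>s\<in>I'. fps_of_poly (a3 s) * (- L s)) + fps_of_poly c3 * Pf ^ n s0"
    using arg_cong[OF eq, of "frob_component m r"]
    unfolding frob_component_add[OF m] frob_component_sum[OF m] frob_component_mult_power[OF m r] h3 a3(2) c3(2) .
  have fixPF: "tw q (fps_of_poly P) = fps_of_poly P" if "P \<in> PF" for P
    using that by (simp add: tw_poly[OF frobexp_q] twp_fixed_iff)
  \<comment> \<open>Applying the Frobenius to the extracted relation and using the relation again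
    eliminates the series. The factor \<open>lin ^ n s0\<close> with \<open>n s0 > 0\<close>
    vanishes at \<open>\<theta> ^ q\<close>, which means that \<open>h3\<close> vanishes at
    \<theta>.\<close>
  have "fps_of_poly (twp q h3) = fps_of_poly (lin ^ n s0 * (h3 + (\<Sum>s\<in>I'. a3 s * u s)))"
  proof -
    have "fps_of_poly (twp q h3) = tw q (fps_of_poly h3)" by (simp add: tw_poly[OF frobexp_q])
    also have "\<dots> = (\<Sum>s\<in>I'. fps_of_poly (a3 s) * tw q (- L s)) + fps_of_poly c3 * (fps_of_poly lin * Pf) ^ n s0"
      unfolding eq3 tw_add[OF frobexp_q] tw_sum[OF frobexp_q] tw_mult[OF frobexp_q] tw_power[OF frobexp_q] Pf(1)
        fixPF[OF a3(1)] fixPF[OF c3(1)] ..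
    also have "(\<Sum>s\<in>I'. fps_of_poly (a3 s) * tw q (- L s)) = (\<Sum>s\<in>I'. fps_of_poly lin ^ n s0 * (fps_of_poly (a3 s) * (- L s) + fps_of_poly (a3 s * u s)))"
    proof (intro sum.cong refl)
      fix s assume "s \<in> I'"
      hence sI: "s \<in> I" "n s = n s0" by (auto simp: I'_def)
      have "tw q (- L s) = fps_of_poly lin ^ n s0 * (- L s + fps_of_poly (u s))"
        using tw_diff[OF frobexp_q, of 0 "L s"] L(1)[OF sI(1)] sI(2) by (simp add: tw_0[OF frobexp_q] right_diff_distrib)
      thus "fps_of_poly (a3 s) * tw q (- L s) = fps_of_poly lin ^ n s0 * (fps_of_poly (a3 s) * (- L s) + fps_of_poly (a3 s * u s))"
        by (simp only: fps_of_poly_mult distrib_left distrib_right mult_ac)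
    qed
    also have "\<dots> = fps_of_poly lin ^ n s0 * ((\<Sum>s\<in>I'. fps_of_poly (a3 s) * (- L s)) + (\<Sum>s\<in>I'. fps_of_poly (a3 s * u s)))"
      by (simp only: sum_distrib_left[symmetric] sum.distrib)
    also have "\<dots> + fps_of_poly c3 * (fps_of_poly lin * Pf) ^ n s0 = fps_of_poly lin ^ n s0 * (fps_of_poly h3 + (\<Sum>s\<in>I'. fps_of_poly (a3 s * u s)))"
      unfolding eq3 by (simp add: power_mult_distrib algebra_simps)
    finally show ?thesis by (simp add: fps_of_poly_mult fps_of_poly_power fps_of_poly_add fps_of_poly_sum)
  qed
  hence "twp q h3 = lin ^ n s0 * (h3 + (\<Sum>s\<in>I'. a3 s * u s))" by (simp only: fps_of_poly_eq_iff)
  hence "poly (twp q h3) (\<theta> ^ q) = 0" using n(1)[OF s0] by (simp add: lin_def)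
  hence h3_0: "poly h3 \<theta> = 0" unfolding poly_twp[OF frobexp_q] by simp
  have "has_val rad (fps_of_poly h3) \<theta> ((\<Sum>s\<in>I'. poly (a3 s) \<theta> * (- v s)) + poly c3 \<theta> * \<omega> ^ n s0)"
    unfolding eq3 using rad_pos L(2) Pf(4)
    by (intro has_val_add has_val_sum has_val_mult has_val_poly has_val_minus has_val_power) (auto simp: I'_def)
  hence "(\<Sum>s\<in>I'. poly (a3 s) \<theta> * (- v s)) + poly c3 \<theta> * \<omega> ^ n s0 = 0"
    using has_val_unique[OF _ has_val_poly[OF rad_pos, of h3] rad_gt rad_gt] h3_0 by simp
  hence "(\<Sum>s\<in>I'. poly (a3 s) \<theta> * v s) = poly c3 \<theta> * \<omega> ^ n s0"
    by (simp add: sum_negf)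
  thus ?thesis using that[of s0 a3 c3] s0 a3(1) c3(1) a3_s0 unfolding I'_def by simp
qed

lemma Kbar_0: "0 \<in> Kbar q \<theta>"
  unfolding Kbar_def algebraic_over_def
  by (auto intro!: exI[of _ "[:0, 1:]"] simp: coeff_pCons split: nat.splits)

end

theorem theorem4p2:
  fixes av :: "'c::field \<Rightarrow> real" and p e q d :: nat and \<theta> \<zeta> :: 'c
    and n r :: "nat \<Rightarrow> nat" and u :: "nat \<Rightarrow> nat \<Rightarrow> 'c poly"
  assumes abs: "nonarch_abs av" and compl: "av_complete av" and clo: "alg_closed TYPE('c)"
    and p: "prime p" "CHAR('c) = p" and q: "e \<ge> 1" "q = p ^ e"
    and \<theta>: "\<not> algebraic_over (Fq q) \<theta>" "av \<theta> > 1"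
    and \<zeta>: "\<zeta> ^ (q - 1) = - \<theta>"
    and npos: "\<forall>i\<in>{1..d}. n i \<ge> 1"
    and npow: "\<forall>i\<in>{1..d}. \<forall>j\<in>{1..d}. i \<noteq> j \<longrightarrow>
                 \<not> (\<exists>k::int. real (n i) = real (n j) * real p powi k)"
    and u_Kbar: "\<forall>i\<in>{1..d}. \<forall>j\<in>{1..r i}. \<forall>k. coeff (u i j) k \<in> Kbar q \<theta>"
    and u_small: "\<forall>i\<in>{1..d}. \<forall>j\<in>{1..r i}.
                 poly_norm av (u i j) < av \<theta> powr (real (n i) * real q / (real q - 1))"
    and linind: "\<forall>i\<in>{1..d}. lin_indep_over (Kfield q \<theta>)
                 (\<lambda>j. if j = 0 then pi_tilde av q \<theta> \<zeta> ^ n i else Lval av q \<theta> (u i j) (n i)) {0..r i}"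
  shows "alg_indep_over (Kbar q \<theta>)
           (\<lambda>x. case x of None \<Rightarrow> pi_tilde av q \<theta> \<zeta>
                         | Some (i, j) \<Rightarrow> Lval av q \<theta> (u i j) (n i))
           (insert None (Some ` (SIGMA i:{1..d}. {1..r i})))"
proof (rule ccontr)
  interpret frob_field av p e q \<theta>
    using assms by unfold_locales auto
  define I where "I = (SIGMA i:{1..d}. {1..r i})"
  define I1 where "I1 = insert None (Some ` I)"
  have I: "finite I" by (simp add: I_def)
  have I1: "finite I1" using I by (simp add: I1_def)
  define val where "val = (\<lambda>x. case x of None \<Rightarrow> pi_tilde av q \<theta> \<zeta> | Some (i, j) \<Rightarrow> Lval av q \<theta> (u i j) (n i))"
  assume "\<not> alg_indep_over (Kbar q \<theta>)
           (\<lambda>x. case x of None \<Rightarrow> pi_tilde av q \<theta> \<zeta>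
                         | Some (i, j) \<Rightarrow> Lval av q \<theta> (u i j) (n i))
           (insert None (Some ` (SIGMA i:{1..d}. {1..r i})))"
  then obtain Ms c where Ms: "finite Ms" "\<forall>m\<in>Ms. \<forall>i. i \<notin> I1 \<longrightarrow> m i = 0" "\<forall>m\<in>Ms. c m \<in> Kbar q \<theta>"
      "(\<Sum>m\<in>Ms. c m * (\<Prod>i\<in>I1. val i ^ m i)) = 0" and nz: "\<exists>m\<in>Ms. c m \<noteq> 0"
    unfolding alg_indep_over_def I1_def I_def val_def by blast
  obtain Pf where Pf: "bdd Pf rad (av \<zeta> ^ q)" "Pf $ 0 = \<zeta> ^ q"
    "tw q Pf = (fps_X - fps_const (\<theta> ^ q)) * Pf" "has_val rad Pf \<theta> (pi_tilde av q \<theta> \<zeta>)"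
    by (rule Pi_exists[OF \<zeta>])
  have "\<zeta> \<noteq> 0" using \<zeta> \<theta>_nz q_ge_2 by (auto simp: zero_power)
  hence Pf0: "Pf $ 0 \<noteq> 0" using Pf(2) by simp
  have Pfinv: "fbd rad (inverse Pf)"
    unfolding fbd_def using bdd_inverse[OF _ Pf0 rad_pos] Pf(1,2) by (auto simp: av_power)
  have "\<exists>L. fbd rad L \<and> tw q L = (fps_X - fps_const (\<theta> ^ q)) ^ n i * (L - fps_of_poly (u i j))
      \<and> has_val rad L \<theta> (Lval av q \<theta> (u i j) (n i))" if "(i, j) \<in> I" for i j
    using that u_small L_exists[of "u i j" "n i"] unfolding I_def by (metis SigmaE2)
  then obtain L0 where L0: "\<And>i j. (i, j) \<in> I \<Longrightarrow> fbd rad (L0 i j)"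
      "\<And>i j. (i, j) \<in> I \<Longrightarrow> tw q (L0 i j) = (fps_X - fps_const (\<theta> ^ q)) ^ n i * (L0 i j - fps_of_poly (u i j))"
      "\<And>i j. (i, j) \<in> I \<Longrightarrow> has_val rad (L0 i j) \<theta> (Lval av q \<theta> (u i j) (n i))"
    by metis
  define L where "L = (\<lambda>(i, j). L0 i j)"
  define ns where "ns = (\<lambda>s::nat \<times> nat. n (fst s))"
  define us where "us = (\<lambda>(i, j). u i j)"
  define vs where "vs = (\<lambda>(i, j). Lval av q \<theta> (u i j) (n i))"
  have L: "fbd rad (L s)" "tw q (L s) = fps_of_poly lin ^ ns s * (L s - fps_of_poly (us s))"
    "has_val rad (L s) \<theta> (vs s)" if "s \<in> I" for s
    using that L0[of "fst s" "snd s"] by (auto simp: L_def ns_def us_def vs_def fps_lin case_prod_unfold)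
  have Pffe: "tw q Pf = fps_of_poly lin * Pf" using Pf(3) by (simp add: fps_lin)
  define H where "H = (\<lambda>x. case x of None \<Rightarrow> Pf | Some s \<Rightarrow> L s)"
  define M where "M = Max (insert 0 ((\<lambda>(m, x). m x) ` (Ms \<times> I1)))"
  have M: "m x \<le> M" if "m \<in> Ms" "x \<in> I1" for m x
    unfolding M_def using that Ms(1) I1 by (intro Max_ge) (auto intro!: rev_image_eqI[of "(m, x)"])
  define J where "J = PiE I1 (\<lambda>_. {..M})"
  have J_fin: "finite J" unfolding J_def using I1 by (intro finite_PiE) auto
  \<comment> \<open>Algebraic independence uses exponents that vanish outside \<open>I1\<close>, the
    Frobenius system extensional ones; \<open>ext0\<close> and \<open>restrict\<close>
    translate.\<close>
  define ext0 where "ext0 = (\<lambda>f x. if x \<in> I1 then f x else 0 :: nat)"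
  define \<rho> where "\<rho> = (\<lambda>f. if ext0 f \<in> Ms then c (ext0 f) else 0)"
  have ext0_restrict: "ext0 (restrict m I1) = m" if "m \<in> Ms" for m
    using that Ms(2) by (auto simp: ext0_def fun_eq_iff)
  have restrict_J: "restrict m I1 \<in> J" if "m \<in> Ms" for m using M that by (auto simp: J_def)
  obtain m1 where m1: "m1 \<in> Ms" "c m1 \<noteq> 0" using nz by blast
  have sum\<rho>: "(\<Sum>f\<in>J. \<rho> f * (\<Prod>x\<in>I1. val x ^ f x)) = 0"
  proof -
    have inj: "inj_on (\<lambda>m. restrict m I1) Ms" by (rule inj_on_inverseI) (rule ext0_restrict)
    have "(\<Sum>f\<in>J. \<rho> f * (\<Prod>x\<in>I1. val x ^ f x)) = (\<Sum>f\<in>(\<lambda>m. restrict m I1) ` Ms. \<rho> f * (\<Prod>x\<in>I1. val x ^ f x))"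
    proof (rule sum.mono_neutral_right[OF J_fin])
      show "\<forall>f\<in>J - (\<lambda>m. restrict m I1) ` Ms. \<rho> f * (\<Prod>x\<in>I1. val x ^ f x) = 0"
      proof
        fix f assume f: "f \<in> J - (\<lambda>m. restrict m I1) ` Ms"
        have "f = restrict (ext0 f) I1" using f by (auto simp: ext0_def J_def fun_eq_iff PiE_def extensional_def)
        hence "ext0 f \<notin> Ms" using f by auto
        thus "\<rho> f * (\<Prod>x\<in>I1. val x ^ f x) = 0" by (simp add: \<rho>_def)
      qed
    qed (use restrict_J in auto)
    also have "\<dots> = (\<Sum>m\<in>Ms. c m * (\<Prod>i\<in>I1. val i ^ m i))"
      by (subst sum.reindex[OF inj]) (auto simp: \<rho>_def ext0_restrict intro!: sum.cong)
    finally show ?thesis using Ms(4) by simp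
  qed
  obtain P where P: "\<exists>m\<in>J. P m \<noteq> 0" "(\<Sum>m\<in>J. fps_of_poly (P m) * (\<Prod>x\<in>I1. H x ^ m x)) = 0"
  proof (rule lift_relation[OF I1 _ _ _ _ J_def _ _ _ sum\<rho>])
    show "fbd rad (H x)" if "x \<in> I1" for x
      using that L(1) Pf(1) by (auto simp: H_def I1_def fbd_def)
    show "has_val rad (H x) \<theta> (val x)" if "x \<in> I1" for x
      using that L(3) Pf(4) by (auto simp: H_def I1_def val_def vs_def case_prod_unfold)
    \<comment> \<open>The period fits the scheme with \<open>n = 1\<close> and
      \<open>u = 0\<close>.\<close>
    show "tw q (H x) = fps_of_poly lin ^ (case x of None \<Rightarrow> 1 | Some s \<Rightarrow> ns s) * (H x - fps_of_poly (case x of None \<Rightarrow> 0 | Some s \<Rightarrow> us s))"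
      if "x \<in> I1" for x
      using that L(2) Pffe by (auto simp: H_def I1_def)
    show "coeff (case x of None \<Rightarrow> 0 | Some s \<Rightarrow> us s) k \<in> Kbar q \<theta>" if "x \<in> I1" for x k
      using that u_Kbar by (auto simp: I1_def us_def I_def Kbar_0)
    show "\<rho> m \<in> Kbar q \<theta>" if "m \<in> J" for m using Ms(3) Kbar_0 by (auto simp: \<rho>_def)
    show "restrict m1 I1 \<in> J" using restrict_J m1 by blast
    show "\<rho> (restrict m1 I1) \<noteq> 0" using m1 by (simp add: \<rho>_def ext0_restrict)
  qed
  \<comment> \<open>Equal weights make the quotient of the two values of \<open>n\<close> an
    integral power of \<open>p\<close>, possibly with negative exponent; \<open>npow\<close>
    excludes this for distinct indices.\<close>
  have indep: "fst s = fst s'" if "s \<in> I" "s' \<in> I" "ns s * p ^ a = ns s' * p ^ b" for s s' a b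
  proof (rule ccontr)
    assume ne: "fst s \<noteq> fst s'"
    have p0: "real p > 0" using p_ge_2 by simp
    have "real (ns s) * real p ^ a = real (ns s') * real p ^ b" using that(3) by (metis of_nat_mult of_nat_power)
    hence "real (ns s) = real (ns s') * (real p ^ b / real p ^ a)" using p0 by (simp add: field_simps)
    also have "real p ^ b / real p ^ a = real p powi (int b - int a)"
      using p0 by (simp add: power_int_diff)
    finally show False using npow ne that(1,2) unfolding I_def ns_def by fastforce
  qed
  have vals: "\<exists>s0 a c. s0 \<in> I \<and> (\<forall>s. a s \<in> PF) \<and> c \<in> PF \<and> a s0 \<noteq> 0 \<and>
      (\<Sum>s\<in>{s\<in>I. ns s = ns s0}. poly (a s) \<theta> * vs s) = poly c \<theta> * pi_tilde av q \<theta> \<zeta> ^ ns s0"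
  proof (rule linear_relation[OF I Pffe Pf0 Pfinv Pf(4), of L ns us vs J M P])
    show "ns s > 0" if "s \<in> I" for s using that npos by (auto simp: ns_def I_def)
    show "ns s = ns s'" if "s \<in> I" "s' \<in> I" "ns s * p ^ a = ns s' * p ^ b" for s s' a b
      using indep[OF that] by (simp add: ns_def)
    show "(\<Sum>m\<in>J. fps_of_poly (P m) * (\<Prod>x\<in>insert None (Some ` I). (case x of None \<Rightarrow> Pf | Some s \<Rightarrow> L s) ^ m x)) = 0"
      using P(2) by (simp only: H_def I1_def)
  qed (use L P(1) in \<open>auto simp: J_def I1_def\<close>)
  then obtain s0 a c where s0: "s0 \<in> I" and a: "\<And>s. a s \<in> PF" "a s0 \<noteq> 0" and cPF: "c \<in> PF"
    and rel: "(\<Sum>s\<in>{s\<in>I. ns s = ns s0}. poly (a s) \<theta> * vs s) = poly c \<theta> * pi_tilde av q \<theta> \<zeta> ^ ns s0" by blast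
  define i where "i = fst s0"
  have i: "i \<in> {1..d}" "snd s0 \<in> {1..r i}" using s0 by (auto simp: I_def i_def)
  have set_eq: "{s\<in>I. ns s = ns s0} = Pair i ` {1..r i}"
  proof (intro equalityI subsetI)
    fix s assume "s \<in> {s\<in>I. ns s = ns s0}"
    hence s: "s \<in> I" "ns s = ns s0" by auto
    \<comment> \<open>With exponents zero: equal values of \<open>n\<close> already force equal
      indices, so only one row of logarithms remains.\<close>
    have "fst s = i" unfolding i_def using indep[OF s(1) s0, of 0 0] s(2) by simp
    thus "s \<in> Pair i ` {1..r i}" using s(1) by (auto simp: I_def intro!: rev_image_eqI[of "snd s"])
  next
    fix s assume "s \<in> Pair i ` {1..r i}"
    thus "s \<in> {s\<in>I. ns s = ns s0}" using i by (auto simp: I_def ns_def i_def)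
  qed
  have "(\<Sum>s\<in>{s\<in>I. ns s = ns s0}. poly (a s) \<theta> * vs s) = (\<Sum>j\<in>{1..r i}. poly (a (i, j)) \<theta> * Lval av q \<theta> (u i j) (n i))"
    unfolding set_eq by (subst sum.reindex) (auto simp: inj_on_def vs_def)
  hence rel': "(\<Sum>j\<in>{1..r i}. poly (a (i, j)) \<theta> * Lval av q \<theta> (u i j) (n i)) = poly c \<theta> * pi_tilde av q \<theta> \<zeta> ^ n i"
    using rel by (simp add: ns_def i_def)
  \<comment> \<open>Index \<open>0\<close> carries the power of the period, moved to the other side
    with a sign.\<close>
  define co where "co = (\<lambda>j. if j = 0 then - poly c \<theta> else poly (a (i, j)) \<theta>)"
  let ?x = "\<lambda>j. if j = 0 then pi_tilde av q \<theta> \<zeta> ^ n i else Lval av q \<theta> (u i j) (n i)"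
  have "(\<Sum>j\<in>{0..r i}. co j * ?x j) = co 0 * ?x 0 + (\<Sum>j\<in>{1..r i}. co j * ?x j)"
    by (simp add: sum.atLeast_Suc_atMost)
  also have "(\<Sum>j\<in>{1..r i}. co j * ?x j) = (\<Sum>j\<in>{1..r i}. poly (a (i, j)) \<theta> * Lval av q \<theta> (u i j) (n i))"
    by (intro sum.cong) (auto simp: co_def)
  finally have "(\<Sum>j\<in>{0..r i}. co j * ?x j) = 0" unfolding rel' by (simp add: co_def)
  moreover have "\<forall>j\<in>{0..r i}. co j \<in> Kfield q \<theta>"
  proof -
    have "poly f \<theta> \<in> K" if "f \<in> PF" for f using that by (intro K_Ainf) (auto simp: Ainf_iff)
    thus ?thesis using a(1) cPF by (auto simp: co_def intro: K_minus)
  qed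
  ultimately have "\<forall>j\<in>{0..r i}. co j = 0"
    using linind i(1) unfolding lin_indep_over_def by blast
  hence "co (snd s0) = 0" using i(2) by simp
  hence "poly (a s0) \<theta> = 0" using i(2) by (auto simp: co_def i_def)
  thus False using PF_eval_nz a by blast
qed

end
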